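(* Let $H$ be a subgroup of $G$ and let $(\pi,E)$ be a non-degenerate well-behaved system of imprimitivity for $\mathcal{A}$ over $G/H$. Then there exists a unique, up to unitary equivalence, inducible well-behaved $*$-representation $\rho$ of $\mathcal{A}_H$ such that $(\pi,E)$ is unitarily equivalent to the system of imprimitivity induced by $\rho$.
   Context: A $*$-representation $\pi$ of a $*$-algebra $\mathcal{A}$ on a dense linear subspace $\mathcal{D}(\pi)$ of a Hilbert space $\mathcal{H}_\pi$ is an algebra homomorphism of $\mathcal{A}$ into the linear operators on $\mathcal{D}(\pi)$ with $\langle\pi(a)\varphi,\psi\rangle=\langle\varphi,\pi(a^* )\psi\rangle$. The graph topology of $\pi$ is given by the norms $\varphi\mapsto\|\varphi\|+\|\pi(a)\varphi\|$; $\pi$ is closed if $\mathcal{D}(\pi)$ is complete in it; the closure of $\pi$ is its extension by continuity to the completion. A closed $*$-representation $\pi$ of a commutative $*$-algebra $\mathcal{B}$ is integrable if $\overline{\pi(b^* )}=\pi(b)^*$ for all $b\in\mathcal{B}$. $\mathrm{Res}_{\mathcal{B}}$ denotes restriction to $\mathcal{B}$. $\sum\mathcal{A}^2$ is the set of finite sums of elements $a^*a$. Standing assumptions. $G$ is a discrete group and $\mathcal{A}=\bigoplus_{g\in G}\mathcal{A}_g$ is a unital $G$-graded $*$-algebra ($\mathcal{A}_g\mathcal{A}_h\subseteq\mathcal{A}_{gh}$, $\mathcal{A}_g^*\subseteq\mathcal{A}_{g^{-1}}$) such that $\mathcal{B}:=\mathcal{A}_e$ is commutative and countably generated. $\widehat{\mathcal{B}}^+$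 is the set of characters (nontrivial $*$-homomorphisms $\mathcal{B}\to\mathbb{C}$) that are nonnegative on $\sum\mathcal{A}^2\cap\mathcal{B}$. It is assumed that $\chi(c^*d)\chi(d^*c)=\chi(c^*c)\chi(d^*d)$ for all $\chi\in\widehat{\mathcal{B}}^+$, $g\in G$, $c,d\in\mathcal{A}_g$, and that $\widehat{\mathcal{B}}^+$ is locally compact in the weakest topology making all functions $f_b(\chi)=\chi(b)$, $b\in\mathcal{B}$, continuous. Partial action: $\mathcal{D}_g$ is the set of $\chi\in\widehat{\mathcal{B}}^+$ with $\chi(a_g^*a_g)\neq0$ for some $a_g\in\mathcal{A}_g$; for such $\chi$, $\chi^g(b)=\chi(a_g^*ba_g)/\chi(a_g^*a_g)$ (independent of $a_g$, again in $\widehat{\mathcal{B}}^+$). For $\Delta\subseteq\widehat{\mathcal{B}}^+$, $\Delta^g=\{\chi^g:\chi\in\Delta\cap\mathcal{D}_g\}$. A $*$-representation $\pi$ of $\mathcal{A}$ is well-behaved if (a) $\mathrm{Res}_{\mathcal{B}}\pi$ is integrable and there is a spectral measure $E_\pi$ on $\widehat{\mathcal{B}}^+$ with $\overline{\pi(b)}=\int f_b\,dE_\pi$ for $b\in\mathcal{B}$, and (b) $E_\pi(\Delta^g)\pi(a_g)\subseteq\pi(a_g)E_\pi(\Delta)$ for all $g\in G$, $a_g\in\mathcal{A}_g$ and Borel sets $\Delta\subseteq\widehat{\mathcal{B}}^+$. For a subgroup $H$, $\mathcal{A}_H=\bigoplus_{h\in H}\mathcal{A}_h$, and well-behaved $*$-representations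 $\rho$ of $\mathcal{A}_H$ are defined in the same way, with a spectral measure $E_\rho$ on $\widehat{\mathcal{B}}^+$ and $g$ ranging over $H$. Induction: $p_H:\mathcal{A}\to\mathcal{A}_H$ is the canonical projection. A $*$-representation $\rho$ of $\mathcal{A}_H$ is inducible if the form $\langle a_1\otimes v_1,a_2\otimes v_2\rangle_0=\langle\rho(p_H(a_2^*a_1))v_1,v_2\rangle$ on $\mathcal{A}\otimes_{\mathcal{A}_H}\mathcal{D}(\rho)$ is nonnegative; then $\mathrm{Ind}\,\rho$ is the closure of the representation $a\mapsto([b\otimes v]\mapsto[ab\otimes v])$ on the quotient by the kernel $\{\eta:\langle\eta,\eta\rangle_0=0\}$. For $X\subseteq G$, $\mathcal{A}_X=\bigoplus_{g\in X}\mathcal{A}_g$; $G/H$ is the set of left cosets. A system of imprimitivity for $\mathcal{A}$ over $G/H$ is a pair $(\pi,E)$ of a $*$-representation $\pi$ of $\mathcal{A}$ and a map $E$ from $G/H$ to projections of $\mathcal{H}_\pi$ with $E(t_1)E(t_2)=0$ for $t_1\neq t_2$, $\sum_tE(t)=I$ and $E(gt)\pi(a_g)\subseteq\pi(a_g)E(t)$ for all $g\in G$, $t\in G/H$, $a_g\in\mathcal{A}_g$. With $\mathcal{D}_t(\pi)=\mathrm{Ran}\,E(t)\cap\mathcal{D}(\pi)$, it is non-degenerate if the span of $\pi(\mathcal{A}_t)\mathcal{D}_H(\pi)$ is dense in $\mathcal{D}_t(\pi)$ in the graph topology of $\pi$ for all $t\in G/H$. It is well-behaved if $\pi$ is well-behaved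 and $E(t)E_\pi(\Delta)=E_\pi(\Delta)E(t)$ for all $t\in G/H$ and all Borel $\Delta\subseteq\widehat{\mathcal{B}}^+$. The system of imprimitivity induced by $\rho$ is $(\mathrm{Ind}\,\rho,E)$ with $E(t)$ the projection onto the closed span of the vectors $[a_t\otimes v]$, $a_t\in\mathcal{A}_t$, $v\in\mathcal{D}(\rho)$. Unitary equivalence of systems means a unitary intertwining both the representations (including domains) and the projections. *)

theory Defs
  imports
    "HOL-Analysis.Analysis"
    "HOL-Algebra.Module"
    "HOL-Algebra.AbelCoset"
    "HOL-Algebra.Left_Coset"
begin

section \<open>Graded complex *-algebras\<close>

text \<open>Unital complex *-algebras. The sort \<^class>\<open>ring_1\<close> is not used, since it would exclude the
  zero algebra.\<close>

class complex_star_algebra = ring + monoid_mult +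
  fixes scaleC :: "complex \<Rightarrow> 'a \<Rightarrow> 'a" (infixr \<open>*\<^sub>C\<close> 75)
    and star :: "'a \<Rightarrow> 'a" (\<open>(_\<^sup>\<star>)\<close> [1000] 999)
  assumes scaleC_add_right: "c *\<^sub>C (x + y) = c *\<^sub>C x + c *\<^sub>C y"
    and scaleC_add_left: "(c + d) *\<^sub>C x = c *\<^sub>C x + d *\<^sub>C x"
    and scaleC_scaleC: "c *\<^sub>C d *\<^sub>C x = (c * d) *\<^sub>C x"
    and scaleC_one: "1 *\<^sub>C x = x"
    and mult_scaleC_left: "(c *\<^sub>C x) * y = c *\<^sub>C (x * y)"
    and mult_scaleC_right: "x * (c *\<^sub>C y) = c *\<^sub>C (x * y)"
    and star_star: "(x\<^sup>\<star>)\<^sup>\<star> = x"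
    and star_mult: "(x * y)\<^sup>\<star> = y\<^sup>\<star> * x\<^sup>\<star>"
    and star_add: "(x + y)\<^sup>\<star> = x\<^sup>\<star> + y\<^sup>\<star>"
    and star_scaleC: "(c *\<^sub>C x)\<^sup>\<star> = cnj c *\<^sub>C x\<^sup>\<star>"

abbreviation csubspace :: "'a::complex_star_algebra set \<Rightarrow> bool"
  where "csubspace \<equiv> module.subspace scaleC"

abbreviation cspan :: "'a::complex_star_algebra set \<Rightarrow> 'a set"
  where "cspan \<equiv> module.span scaleC"

definition star_subalgebra :: "'a::complex_star_algebra set \<Rightarrow> bool"
  where "star_subalgebra S \<longleftrightarrow>
    csubspace S \<and> 1 \<in> S \<and> (\<forall>x\<in>S. \<forall>y\<in>S. x * y \<in> S) \<and> (\<forall>x\<in>S. x\<^sup>\<star> \<in> S)"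

definition countably_generated :: "'a::complex_star_algebra set \<Rightarrow> bool"
  where "countably_generated B \<longleftrightarrow> (\<exists>C. countable C \<and> C \<subseteq> B \<and> star_subalgebra hull C = B)"

definition sum_squares :: "'a::complex_star_algebra set"
  where "sum_squares = {\<Sum>i<n. (f i)\<^sup>\<star> * f i | f (n::nat). True}"

definition homogeneous_decomposition ::
    "('g, 'm) monoid_scheme \<Rightarrow> ('g \<Rightarrow> 'a::complex_star_algebra set) \<Rightarrow> 'a \<Rightarrow> ('g \<Rightarrow> 'a) \<Rightarrow> bool"
  where "homogeneous_decomposition G \<A> a f \<longleftrightarrow>
    (\<forall>g\<in>carrier G. f g \<in> \<A> g) \<and> (\<forall>g. g \<notin> carrier G \<longrightarrow> f g = 0) \<and>
    finite {g. f g \<noteq> 0} \<and> a = (\<Sum>g | f g \<noteq> 0. f g)"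

definition graded_star_algebra ::
    "('g, 'm) monoid_scheme \<Rightarrow> ('g \<Rightarrow> 'a::complex_star_algebra set) \<Rightarrow> bool"
  where "graded_star_algebra G \<A> \<longleftrightarrow>
    group G \<and>
    (\<forall>g\<in>carrier G. csubspace (\<A> g)) \<and>
    (\<forall>a. \<exists>!f. homogeneous_decomposition G \<A> a f) \<and>
    (\<forall>g\<in>carrier G. \<forall>h\<in>carrier G. \<forall>a\<in>\<A> g. \<forall>b\<in>\<A> h. a * b \<in> \<A> (g \<otimes>\<^bsub>G\<^esub> h)) \<and>
    (\<forall>g\<in>carrier G. \<forall>a\<in>\<A> g. a\<^sup>\<star> \<in> \<A> (inv\<^bsub>G\<^esub> g))"

definition component ::
    "('g, 'm) monoid_scheme \<Rightarrow> ('g \<Rightarrow> 'a::complex_star_algebra set) \<Rightarrow> 'a \<Rightarrow> 'g \<Rightarrow> 'a"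
  where "component G \<A> a = (THE f. homogeneous_decomposition G \<A> a f)"

definition graded_part :: "('g \<Rightarrow> 'a::complex_star_algebra set) \<Rightarrow> 'g set \<Rightarrow> 'a set"
  where "graded_part \<A> X = cspan (\<Union>g\<in>X. \<A> g)"

definition graded_proj ::
    "('g, 'm) monoid_scheme \<Rightarrow> ('g \<Rightarrow> 'a::complex_star_algebra set) \<Rightarrow> 'g set \<Rightarrow> 'a \<Rightarrow> 'a"
  where "graded_proj G \<A> X a = (\<Sum>g | g \<in> X \<and> component G \<A> a g \<noteq> 0. component G \<A> a g)"


section \<open>Characters and the partial action\<close>

text \<open>Characters of the subalgebra \<open>B\<close> are functions on the whole type, so they are taken to be
  extensional on \<open>B\<close>.\<close>

definition character :: "'a::complex_star_algebra set \<Rightarrow> ('a \<Rightarrow> complex) \<Rightarrow> bool"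
  where "character B \<omega> \<longleftrightarrow>
    \<omega> \<in> extensional B \<and>
    (\<forall>x\<in>B. \<forall>y\<in>B. \<omega> (x + y) = \<omega> x + \<omega> y) \<and>
    (\<forall>c. \<forall>x\<in>B. \<omega> (c *\<^sub>C x) = c * \<omega> x) \<and>
    (\<forall>x\<in>B. \<forall>y\<in>B. \<omega> (x * y) = \<omega> x * \<omega> y) \<and>
    (\<forall>x\<in>B. \<omega> (x\<^sup>\<star>) = cnj (\<omega> x)) \<and>
    (\<exists>x\<in>B. \<omega> x \<noteq> 0)"

definition pos_chars ::
    "('g, 'm) monoid_scheme \<Rightarrow> ('g \<Rightarrow> 'a::complex_star_algebra set) \<Rightarrow> ('a \<Rightarrow> complex) set"
  where "pos_chars G \<A> =
    {\<omega>. character (\<A> \<one>\<^bsub>G\<^esub>) \<omega> \<and> (\<forall>x \<in> sum_squares \<inter> \<A> \<one>\<^bsub>G\<^esub>. \<omega> x \<in> \<real>\<^sub>\<ge>\<^sub>0)}"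

definition char_topology ::
    "('g, 'm) monoid_scheme \<Rightarrow> ('g \<Rightarrow> 'a::complex_star_algebra set) \<Rightarrow> ('a \<Rightarrow> complex) topology"
  where "char_topology G \<A> =
    topology_generated_by {{\<omega> \<in> pos_chars G \<A>. \<omega> b \<in> U} | b U. b \<in> \<A> \<one>\<^bsub>G\<^esub> \<and> open U}"

definition char_borel ::
    "('g, 'm) monoid_scheme \<Rightarrow> ('g \<Rightarrow> 'a::complex_star_algebra set) \<Rightarrow> ('a \<Rightarrow> complex) measure"
  where "char_borel G \<A> = sigma (pos_chars G \<A>) {U. openin (char_topology G \<A>) U}"

definition action_dom ::
    "('g, 'm) monoid_scheme \<Rightarrow> ('g \<Rightarrow> 'a::complex_star_algebra set) \<Rightarrow> 'g \<Rightarrow> ('a \<Rightarrow> complex) set"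
  where "action_dom G \<A> g = {\<omega> \<in> pos_chars G \<A>. \<exists>a\<in>\<A> g. \<omega> (a\<^sup>\<star> * a) \<noteq> 0}"

definition char_action ::
    "('g, 'm) monoid_scheme \<Rightarrow> ('g \<Rightarrow> 'a::complex_star_algebra set) \<Rightarrow> 'g \<Rightarrow> ('a \<Rightarrow> complex)
      \<Rightarrow> ('a \<Rightarrow> complex)"
  where "char_action G \<A> g \<omega> =
    (let a = (SOME a. a \<in> \<A> g \<and> \<omega> (a\<^sup>\<star> * a) \<noteq> 0)
     in restrict (\<lambda>b. \<omega> (a\<^sup>\<star> * b * a) / \<omega> (a\<^sup>\<star> * a)) (\<A> \<one>\<^bsub>G\<^esub>))"

definition set_action ::
    "('g, 'm) monoid_scheme \<Rightarrow> ('g \<Rightarrow> 'a::complex_star_algebra set) \<Rightarrow> 'g \<Rightarrow> ('a \<Rightarrow> complex) set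
      \<Rightarrow> ('a \<Rightarrow> complex) set"
  where "set_action G \<A> g \<Delta> = char_action G \<A> g ` (\<Delta> \<inter> action_dom G \<A> g)"


section \<open>Hilbert spaces\<close>

text \<open>A Hilbert space is a module record over the field of complex numbers together with an inner
  product, linear in the first variable. The fields \<^const>\<open>mult\<close> and \<^const>\<open>one\<close> inherited from
  rings are irrelevant.\<close>

definition complex_field :: "complex ring"
  where "complex_field = \<lparr>carrier = UNIV, mult = (*), one = 1, zero = 0, add = (+)\<rparr>"

record 'v ip_space = "(complex, 'v) module" +
  ip :: "'v \<Rightarrow> 'v \<Rightarrow> complex"

definition vnorm :: "'v ip_space \<Rightarrow> 'v \<Rightarrow> real"
  where "vnorm V x = sqrt (Re (ip V x x))"

text \<open>The case distinction makes the function symmetric on the whole type, as required by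
  \<^locale>\<open>Metric_space\<close>.\<close>

definition vdist :: "'v ip_space \<Rightarrow> 'v \<Rightarrow> 'v \<Rightarrow> real"
  where "vdist V x y = (if x \<in> carrier V \<and> y \<in> carrier V then vnorm V (x \<ominus>\<^bsub>V\<^esub> y) else 0)"

abbreviation vtop :: "'v ip_space \<Rightarrow> 'v topology"
  where "vtop V \<equiv> Metric_space.mtopology (carrier V) (vdist V)"

definition hilbert_space :: "'v ip_space \<Rightarrow> bool"
  where "hilbert_space V \<longleftrightarrow>
    module complex_field V \<and>
    (\<forall>x\<in>carrier V. \<forall>y\<in>carrier V. \<forall>z\<in>carrier V. ip V (x \<oplus>\<^bsub>V\<^esub> y) z = ip V x z + ip V y z) \<and>
    (\<forall>c. \<forall>x\<in>carrier V. \<forall>y\<in>carrier V. ip V (c \<odot>\<^bsub>V\<^esub> x) y = c * ip V x y) \<and>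
    (\<forall>x\<in>carrier V. \<forall>y\<in>carrier V. ip V y x = cnj (ip V x y)) \<and>
    (\<forall>x\<in>carrier V. ip V x x \<in> \<real>\<^sub>\<ge>\<^sub>0) \<and>
    (\<forall>x\<in>carrier V. ip V x x = 0 \<longrightarrow> x = \<zero>\<^bsub>V\<^esub>) \<and>
    Metric_space.mcomplete (carrier V) (vdist V)"

definition vspan :: "'v ip_space \<Rightarrow> 'v set \<Rightarrow> 'v set"
  where "vspan V X = (\<lambda>S. submodule S complex_field V) hull X"

definition linear_map :: "'v ip_space \<Rightarrow> 'v set \<Rightarrow> 'w ip_space \<Rightarrow> ('v \<Rightarrow> 'w) \<Rightarrow> bool"
  where "linear_map V D W T \<longleftrightarrow>
    (\<forall>x\<in>D. T x \<in> carrier W) \<and>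
    (\<forall>x\<in>D. \<forall>y\<in>D. T (x \<oplus>\<^bsub>V\<^esub> y) = T x \<oplus>\<^bsub>W\<^esub> T y) \<and>
    (\<forall>c. \<forall>x\<in>D. T (c \<odot>\<^bsub>V\<^esub> x) = c \<odot>\<^bsub>W\<^esub> T x)"

definition projection :: "'v ip_space \<Rightarrow> ('v \<Rightarrow> 'v) \<Rightarrow> bool"
  where "projection V P \<longleftrightarrow>
    linear_map V (carrier V) V P \<and>
    (\<forall>x\<in>carrier V. P (P x) = P x) \<and>
    (\<forall>x\<in>carrier V. \<forall>y\<in>carrier V. ip V (P x) y = ip V x (P y))"

definition proj_onto :: "'v ip_space \<Rightarrow> 'v set \<Rightarrow> 'v \<Rightarrow> 'v"
  where "proj_onto V S x = (THE y. y \<in> S \<and> (\<forall>z\<in>S. ip V (x \<ominus>\<^bsub>V\<^esub> y) z = 0))"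

definition unitary :: "'v ip_space \<Rightarrow> 'w ip_space \<Rightarrow> ('v \<Rightarrow> 'w) \<Rightarrow> bool"
  where "unitary V W U \<longleftrightarrow>
    linear_map V (carrier V) W U \<and> bij_betw U (carrier V) (carrier W) \<and>
    (\<forall>x\<in>carrier V. \<forall>y\<in>carrier V. ip W (U x) (U y) = ip V x y)"

text \<open>Unbounded operators are identified with their graphs.\<close>

definition op_closure :: "'v ip_space \<Rightarrow> ('v \<times> 'v) set \<Rightarrow> ('v \<times> 'v) set"
  where "op_closure V T = prod_topology (vtop V) (vtop V) closure_of T"

definition op_adjoint :: "'v ip_space \<Rightarrow> ('v \<times> 'v) set \<Rightarrow> ('v \<times> 'v) set"
  where "op_adjoint V T =
    {(y, z). y \<in> carrier V \<and> z \<in> carrier V \<and> (\<forall>(x, w)\<in>T. ip V w y = ip V x z)}"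


section \<open>Quotients and completions\<close>

text \<open>The operations on cosets are those induced by representatives; they are meaningful only when
  \<open>N\<close> is a subspace and \<open>ip V\<close> vanishes whenever one of its arguments is in \<open>N\<close>.\<close>

definition quotient_space :: "'v ip_space \<Rightarrow> 'v set \<Rightarrow> 'v set ip_space"
  where "quotient_space V N =
    \<lparr>carrier = a_rcosets\<^bsub>V\<^esub> N, mult = undefined, one = undefined, zero = N, add = set_add V,
     smult = (\<lambda>c X. \<Union>x\<in>X. N +>\<^bsub>V\<^esub> (c \<odot>\<^bsub>V\<^esub> x)),
     ip = (\<lambda>X Y. the_elem {ip V x y | x y. x \<in> X \<and> y \<in> Y})\<rparr>"

definition ip_kernel :: "'v ip_space \<Rightarrow> 'v set"
  where "ip_kernel V = {x \<in> carrier V. ip V x x = 0}"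

definition cauchy_space :: "'v ip_space \<Rightarrow> (nat \<Rightarrow> 'v) ip_space"
  where "cauchy_space V =
    \<lparr>carrier = {s. Metric_space.MCauchy (carrier V) (vdist V) s},
     mult = undefined, one = undefined, zero = (\<lambda>_. \<zero>\<^bsub>V\<^esub>), add = (\<lambda>s t n. s n \<oplus>\<^bsub>V\<^esub> t n),
     smult = (\<lambda>c s n. c \<odot>\<^bsub>V\<^esub> s n),
     ip = (\<lambda>s t. lim (\<lambda>n. ip V (s n) (t n)))\<rparr>"

text \<open>Cauchy sequences modulo null sequences.\<close>

definition completion :: "'v ip_space \<Rightarrow> (nat \<Rightarrow> 'v) set ip_space"
  where "completion V = quotient_space (cauchy_space V) (ip_kernel (cauchy_space V))"

definition completion_embed :: "'v ip_space \<Rightarrow> 'v \<Rightarrow> (nat \<Rightarrow> 'v) set"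
  where "completion_embed V x =
    ip_kernel (cauchy_space V) +>\<^bsub>cauchy_space V\<^esub> (\<lambda>_. x)"


section \<open>Spectral measures and spectral integrals\<close>

definition spectral_measure :: "'x measure \<Rightarrow> 'v ip_space \<Rightarrow> ('x set \<Rightarrow> 'v \<Rightarrow> 'v) \<Rightarrow> bool"
  where "spectral_measure M V E \<longleftrightarrow>
    (\<forall>\<Delta>\<in>sets M. projection V (E \<Delta>)) \<and>
    (\<forall>\<phi>\<in>carrier V. E (space M) \<phi> = \<phi>) \<and>
    (\<forall>F::nat \<Rightarrow> 'x set. range F \<subseteq> sets M \<and> disjoint_family F \<longrightarrow>
      (\<forall>\<phi>\<in>carrier V. limitin (vtop V) (\<lambda>n. \<Oplus>\<^bsub>V\<^esub>i\<in>{..<n}. E (F i) \<phi>) (E (\<Union>i. F i) \<phi>) sequentially))"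

definition scalar_measure :: "'x measure \<Rightarrow> 'v ip_space \<Rightarrow> ('x set \<Rightarrow> 'v \<Rightarrow> 'v) \<Rightarrow> 'v \<Rightarrow> 'x measure"
  where "scalar_measure M V E \<phi> =
    measure_of (space M) (sets M) (\<lambda>\<Delta>. ennreal (Re (ip V (E \<Delta> \<phi>) \<phi>)))"

definition simple_spectral_integral ::
    "'x measure \<Rightarrow> 'v ip_space \<Rightarrow> ('x set \<Rightarrow> 'v \<Rightarrow> 'v) \<Rightarrow> ('x \<Rightarrow> complex) \<Rightarrow> 'v \<Rightarrow> 'v"
  where "simple_spectral_integral M V E s \<phi> =
    (\<Oplus>\<^bsub>V\<^esub>c\<in>s ` space M. c \<odot>\<^bsub>V\<^esub> E (s -` {c} \<inter> space M) \<phi>)"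

text \<open>The graph of the normal operator \<open>\<integral> f dE\<close>. Its domain consists of the vectors \<open>\<phi>\<close> for which
  \<open>f\<close> is square integrable with respect to \<open>\<langle>E(\<cdot>)\<phi>,\<phi>\<rangle>\<close>. By the isometry
  \<open>\<parallel>(\<integral> s dE)\<phi>\<parallel>\<^sup>2 = \<integral> |s|\<^sup>2 d\<langle>E(\<cdot>)\<phi>,\<phi>\<rangle>\<close> for simple \<open>s\<close>, the value at \<open>\<phi>\<close> is the limit along any
  sequence of simple functions converging to \<open>f\<close> in the \<open>L\<^sup>2\<close>-space of this measure.\<close>

definition spectral_integral ::
    "'x measure \<Rightarrow> 'v ip_space \<Rightarrow> ('x set \<Rightarrow> 'v \<Rightarrow> 'v) \<Rightarrow> ('x \<Rightarrow> complex) \<Rightarrow> ('v \<times> 'v) set"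
  where "spectral_integral M V E f =
    {(\<phi>, \<psi>). \<phi> \<in> carrier V \<and>
      (\<integral>\<^sup>+x. ennreal ((cmod (f x))\<^sup>2) \<partial>scalar_measure M V E \<phi>) < \<infinity> \<and>
      (\<exists>s. (\<forall>n. simple_function M (s n)) \<and>
        (\<lambda>n. \<integral>\<^sup>+x. ennreal ((cmod (f x - s n x))\<^sup>2) \<partial>scalar_measure M V E \<phi>) \<longlonglongrightarrow> 0 \<and>
        limitin (vtop V) (\<lambda>n. simple_spectral_integral M V E (s n) \<phi>) \<psi> sequentially)}"


section \<open>Representations\<close>

record ('a, 'v) rep =
  rep_alg :: "'a set"
  rep_space :: "'v ip_space"
  rep_dom :: "'v set"
  rep_op :: "'a \<Rightarrow> 'v \<Rightarrow> 'v"

definition star_representation ::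
    "'a::complex_star_algebra set \<Rightarrow> ('a, 'v) rep \<Rightarrow> bool"
  where "star_representation S \<pi> \<longleftrightarrow>
    (let V = rep_space \<pi>; D = rep_dom \<pi> in
      rep_alg \<pi> = S \<and> hilbert_space V \<and> submodule D complex_field V \<and>
      vtop V closure_of D = carrier V \<and>
      (\<forall>a\<in>S. linear_map V D V (rep_op \<pi> a) \<and> rep_op \<pi> a ` D \<subseteq> D) \<and>
      (\<forall>a\<in>S. \<forall>b\<in>S. \<forall>\<phi>\<in>D. rep_op \<pi> (a + b) \<phi> = rep_op \<pi> a \<phi> \<oplus>\<^bsub>V\<^esub> rep_op \<pi> b \<phi>) \<and>
      (\<forall>c. \<forall>a\<in>S. \<forall>\<phi>\<in>D. rep_op \<pi> (c *\<^sub>C a) \<phi> = c \<odot>\<^bsub>V\<^esub> rep_op \<pi> a \<phi>) \<and>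
      (\<forall>a\<in>S. \<forall>b\<in>S. \<forall>\<phi>\<in>D. rep_op \<pi> (a * b) \<phi> = rep_op \<pi> a (rep_op \<pi> b \<phi>)) \<and>
      (\<forall>a\<in>S. \<forall>\<phi>\<in>D. \<forall>\<psi>\<in>D. ip V (rep_op \<pi> a \<phi>) \<psi> = ip V \<phi> (rep_op \<pi> (a\<^sup>\<star>) \<psi>)))"

definition Res :: "'a set \<Rightarrow> ('a, 'v) rep \<Rightarrow> ('a, 'v) rep"
  where "Res S \<pi> = \<pi>\<lparr>rep_alg := S\<rparr>"

definition rep_graph :: "('a, 'v) rep \<Rightarrow> 'a \<Rightarrow> ('v \<times> 'v) set"
  where "rep_graph \<pi> a = {(\<phi>, rep_op \<pi> a \<phi>) | \<phi>. \<phi> \<in> rep_dom \<pi>}"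

definition graph_norm :: "('a, 'v) rep \<Rightarrow> 'a \<Rightarrow> 'v \<Rightarrow> real"
  where "graph_norm \<pi> a \<phi> = vnorm (rep_space \<pi>) \<phi> + vnorm (rep_space \<pi>) (rep_op \<pi> a \<phi>)"

definition graph_topology :: "('a, 'v) rep \<Rightarrow> 'v topology"
  where "graph_topology \<pi> = topology_generated_by
    {{\<psi> \<in> rep_dom \<pi>. graph_norm \<pi> a (\<psi> \<ominus>\<^bsub>rep_space \<pi>\<^esub> \<phi>) < \<epsilon>} | a \<phi> \<epsilon>.
      a \<in> rep_alg \<pi> \<and> \<phi> \<in> rep_dom \<pi> \<and> \<epsilon> > 0}"

text \<open>The graph topology need not be metrizable, so completeness is expressed by filters rather than
  sequences.\<close>

definition graph_cauchy :: "('a, 'v) rep \<Rightarrow> 'v filter \<Rightarrow> bool"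
  where "graph_cauchy \<pi> F \<longleftrightarrow>
    F \<noteq> bot \<and> (\<forall>\<^sub>F \<phi> in F. \<phi> \<in> rep_dom \<pi>) \<and>
    (\<forall>a\<in>rep_alg \<pi>. \<forall>\<epsilon>>0. \<exists>P. eventually P F \<and>
      (\<forall>\<phi> \<psi>. P \<phi> \<and> P \<psi> \<longrightarrow> graph_norm \<pi> a (\<phi> \<ominus>\<^bsub>rep_space \<pi>\<^esub> \<psi>) < \<epsilon>))"

definition closed_rep :: "('a, 'v) rep \<Rightarrow> bool"
  where "closed_rep \<pi> \<longleftrightarrow>
    (\<forall>F. graph_cauchy \<pi> F \<longrightarrow> (\<exists>\<phi>\<in>rep_dom \<pi>. limitin (graph_topology \<pi>) (\<lambda>x. x) \<phi> F))"

text \<open>All \<open>\<pi>(a)\<close> are closable, so the completion of the domain in the graph topology embeds into the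
  Hilbert space: its elements are the norm limits of Cauchy filters.\<close>

definition rep_closure :: "('a, 'v) rep \<Rightarrow> ('a, 'v) rep"
  where "rep_closure \<pi> =
    (let V = rep_space \<pi> in
     \<lparr>rep_alg = rep_alg \<pi>, rep_space = V,
      rep_dom = {\<phi>. \<exists>F. graph_cauchy \<pi> F \<and> limitin (vtop V) (\<lambda>x. x) \<phi> F},
      rep_op = (\<lambda>a \<phi>. THE \<psi>. \<exists>F. graph_cauchy \<pi> F \<and> limitin (vtop V) (\<lambda>x. x) \<phi> F \<and>
        limitin (vtop V) (rep_op \<pi> a) \<psi> F)\<rparr>)"

definition integrable_rep :: "('a::complex_star_algebra, 'v) rep \<Rightarrow> bool"
  where "integrable_rep \<pi> \<longleftrightarrow>
    closed_rep \<pi> \<and>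
    (\<forall>b\<in>rep_alg \<pi>. op_closure (rep_space \<pi>) (rep_graph \<pi> (b\<^sup>\<star>)) =
      op_adjoint (rep_space \<pi>) (rep_graph \<pi> b))"

definition unitarily_equivalent :: "('a, 'v) rep \<Rightarrow> ('a, 'w) rep \<Rightarrow> bool"
  where "unitarily_equivalent \<pi> \<rho> \<longleftrightarrow>
    rep_alg \<pi> = rep_alg \<rho> \<and>
    (\<exists>U. unitary (rep_space \<pi>) (rep_space \<rho>) U \<and> U ` rep_dom \<pi> = rep_dom \<rho> \<and>
      (\<forall>a\<in>rep_alg \<pi>. \<forall>\<phi>\<in>rep_dom \<pi>. U (rep_op \<pi> a \<phi>) = rep_op \<rho> a (U \<phi>)))"


section \<open>Well-behaved representations\<close>

text \<open>\<open>K\<close> is the subgroup such that \<open>\<pi>\<close> is a representation of \<open>graded_part \<A> K\<close>. The condition on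
  \<open>E\<close> determines it uniquely on Borel sets: since \<open>\<A> \<one>\<close> is countably generated, the Borel sets are
  generated by countably many of the functions \<open>\<omega> \<mapsto> \<omega> b\<close>, and the spectral measure of the normal
  operator \<open>\<integral> \<omega> b dE(\<omega>)\<close> is unique.\<close>

definition well_behaved_with ::
    "('g, 'm) monoid_scheme \<Rightarrow> ('g \<Rightarrow> 'a::complex_star_algebra set) \<Rightarrow> 'g set \<Rightarrow> ('a, 'v) rep
      \<Rightarrow> (('a \<Rightarrow> complex) set \<Rightarrow> 'v \<Rightarrow> 'v) \<Rightarrow> bool"
  where "well_behaved_with G \<A> K \<pi> E \<longleftrightarrow>
    integrable_rep (Res (\<A> \<one>\<^bsub>G\<^esub>) \<pi>) \<and>
    spectral_measure (char_borel G \<A>) (rep_space \<pi>) E \<and>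
    (\<forall>b\<in>\<A> \<one>\<^bsub>G\<^esub>. op_closure (rep_space \<pi>) (rep_graph \<pi> b) =
      spectral_integral (char_borel G \<A>) (rep_space \<pi>) E (\<lambda>\<omega>. \<omega> b)) \<and>
    (\<forall>g\<in>K. \<forall>a\<in>\<A> g. \<forall>\<Delta>\<in>sets (char_borel G \<A>). \<forall>\<phi>\<in>rep_dom \<pi>.
      E \<Delta> \<phi> \<in> rep_dom \<pi> \<and> E (set_action G \<A> g \<Delta>) (rep_op \<pi> a \<phi>) = rep_op \<pi> a (E \<Delta> \<phi>))"

definition well_behaved ::
    "('g, 'm) monoid_scheme \<Rightarrow> ('g \<Rightarrow> 'a::complex_star_algebra set) \<Rightarrow> 'g set \<Rightarrow> ('a, 'v) rep \<Rightarrow> bool"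
  where "well_behaved G \<A> K \<pi> \<longleftrightarrow> (\<exists>E. well_behaved_with G \<A> K \<pi> E)"


section \<open>Induced representations\<close>

text \<open>The free vector space on \<open>\<A> \<times> \<D>(\<rho>)\<close>, with the sesquilinear form that is
  \<open>\<langle>\<rho>(p\<^sub>H(a\<^sub>2\<^sup>\<star>a\<^sub>1))v\<^sub>1,v\<^sub>2\<rangle>\<close> on basis vectors.\<close>

definition free_space ::
    "('g, 'm) monoid_scheme \<Rightarrow> ('g \<Rightarrow> 'a::complex_star_algebra set) \<Rightarrow> 'g set \<Rightarrow> ('a, 'v) rep
      \<Rightarrow> ('a \<times> 'v \<Rightarrow> complex) ip_space"
  where "free_space G \<A> H \<rho> =
    \<lparr>carrier = {f. finite {x. f x \<noteq> 0} \<and> {x. f x \<noteq> 0} \<subseteq> UNIV \<times> rep_dom \<rho>},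
     mult = undefined, one = undefined, zero = (\<lambda>_. 0), add = (\<lambda>f h x. f x + h x),
     smult = (\<lambda>c f x. c * f x),
     ip = (\<lambda>f h. \<Sum>(a1, v1) | f (a1, v1) \<noteq> 0. \<Sum>(a2, v2) | h (a2, v2) \<noteq> 0.
       f (a1, v1) * cnj (h (a2, v2)) *
         ip (rep_space \<rho>) (rep_op \<rho> (graded_proj G \<A> H (a2\<^sup>\<star> * a1)) v1) v2)\<rparr>"

definition basis_vec :: "'a \<Rightarrow> 'v \<Rightarrow> 'a \<times> 'v \<Rightarrow> complex"
  where "basis_vec a v = (\<lambda>x. if x = (a, v) then 1 else 0)"

definition tensor_relations ::
    "('g, 'm) monoid_scheme \<Rightarrow> ('g \<Rightarrow> 'a::complex_star_algebra set) \<Rightarrow> 'g set \<Rightarrow> ('a, 'v) rep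
      \<Rightarrow> ('a \<times> 'v \<Rightarrow> complex) set"
  where "tensor_relations G \<A> H \<rho> =
    (let V = rep_space \<rho>; D = rep_dom \<rho> in
     vspan (free_space G \<A> H \<rho>)
      ({\<lambda>x. basis_vec (a + b) v x - basis_vec a v x - basis_vec b v x | a b v. v \<in> D} \<union>
       {\<lambda>x. basis_vec a (v \<oplus>\<^bsub>V\<^esub> w) x - basis_vec a v x - basis_vec a w x | a v w. v \<in> D \<and> w \<in> D} \<union>
       {\<lambda>x. basis_vec (c *\<^sub>C a) v x - c * basis_vec a v x | c a v. v \<in> D} \<union>
       {\<lambda>x. basis_vec a (c \<odot>\<^bsub>V\<^esub> v) x - c * basis_vec a v x | c a v. v \<in> D} \<union>
       {\<lambda>x. basis_vec (a * b) v x - basis_vec a (rep_op \<rho> b v) x | a b v. b \<in> rep_alg \<rho> \<and> v \<in> D}))"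

text \<open>The algebraic tensor product of \<open>\<A>\<close> and \<open>\<D>(\<rho>)\<close> over \<open>\<A>\<^sub>H\<close> with the form
  \<open>\<langle>\<cdot>,\<cdot>\<rangle>\<^sub>0\<close>.\<close>

definition tensor_space ::
    "('g, 'm) monoid_scheme \<Rightarrow> ('g \<Rightarrow> 'a::complex_star_algebra set) \<Rightarrow> 'g set \<Rightarrow> ('a, 'v) rep
      \<Rightarrow> ('a \<times> 'v \<Rightarrow> complex) set ip_space"
  where "tensor_space G \<A> H \<rho> = quotient_space (free_space G \<A> H \<rho>) (tensor_relations G \<A> H \<rho>)"

definition pure_tensor ::
    "('g, 'm) monoid_scheme \<Rightarrow> ('g \<Rightarrow> 'a::complex_star_algebra set) \<Rightarrow> 'g set \<Rightarrow> ('a, 'v) rep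
      \<Rightarrow> 'a \<Rightarrow> 'v \<Rightarrow> ('a \<times> 'v \<Rightarrow> complex) set"
  where "pure_tensor G \<A> H \<rho> a v =
    tensor_relations G \<A> H \<rho> +>\<^bsub>free_space G \<A> H \<rho>\<^esub> basis_vec a v"

definition inducible ::
    "('g, 'm) monoid_scheme \<Rightarrow> ('g \<Rightarrow> 'a::complex_star_algebra set) \<Rightarrow> 'g set \<Rightarrow> ('a, 'v) rep \<Rightarrow> bool"
  where "inducible G \<A> H \<rho> \<longleftrightarrow>
    (\<forall>\<eta>\<in>carrier (tensor_space G \<A> H \<rho>). ip (tensor_space G \<A> H \<rho>) \<eta> \<eta> \<in> \<real>\<^sub>\<ge>\<^sub>0)"

type_synonym ('a, 'v) ind_vec = "(nat \<Rightarrow> ('a \<times> 'v \<Rightarrow> complex) set set) set"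

definition ind_prespace ::
    "('g, 'm) monoid_scheme \<Rightarrow> ('g \<Rightarrow> 'a::complex_star_algebra set) \<Rightarrow> 'g set \<Rightarrow> ('a, 'v) rep
      \<Rightarrow> ('a \<times> 'v \<Rightarrow> complex) set set ip_space"
  where "ind_prespace G \<A> H \<rho> =
    quotient_space (tensor_space G \<A> H \<rho>) (ip_kernel (tensor_space G \<A> H \<rho>))"

definition ind_space ::
    "('g, 'm) monoid_scheme \<Rightarrow> ('g \<Rightarrow> 'a::complex_star_algebra set) \<Rightarrow> 'g set \<Rightarrow> ('a, 'v) rep
      \<Rightarrow> ('a, 'v) ind_vec ip_space"
  where "ind_space G \<A> H \<rho> = completion (ind_prespace G \<A> H \<rho>)"

text \<open>The vector \<open>[a \<otimes> v]\<close>.\<close>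

definition ind_vector ::
    "('g, 'm) monoid_scheme \<Rightarrow> ('g \<Rightarrow> 'a::complex_star_algebra set) \<Rightarrow> 'g set \<Rightarrow> ('a, 'v) rep
      \<Rightarrow> 'a \<Rightarrow> 'v \<Rightarrow> ('a, 'v) ind_vec"
  where "ind_vector G \<A> H \<rho> a v =
    completion_embed (ind_prespace G \<A> H \<rho>)
      (ip_kernel (tensor_space G \<A> H \<rho>) +>\<^bsub>tensor_space G \<A> H \<rho>\<^esub> pure_tensor G \<A> H \<rho> a v)"

definition ind_rep0 ::
    "('g, 'm) monoid_scheme \<Rightarrow> ('g \<Rightarrow> 'a::complex_star_algebra set) \<Rightarrow> 'g set \<Rightarrow> ('a, 'v) rep
      \<Rightarrow> ('a, ('a, 'v) ind_vec) rep"
  where "ind_rep0 G \<A> H \<rho> =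
    (let D = completion_embed (ind_prespace G \<A> H \<rho>) ` carrier (ind_prespace G \<A> H \<rho>) in
     \<lparr>rep_alg = UNIV, rep_space = ind_space G \<A> H \<rho>, rep_dom = D,
      rep_op = (\<lambda>a. THE T. T \<in> extensional D \<and>
        linear_map (ind_space G \<A> H \<rho>) D (ind_space G \<A> H \<rho>) T \<and>
        (\<forall>b. \<forall>v\<in>rep_dom \<rho>. T (ind_vector G \<A> H \<rho> b v) = ind_vector G \<A> H \<rho> (a * b) v))\<rparr>)"

definition Ind ::
    "('g, 'm) monoid_scheme \<Rightarrow> ('g \<Rightarrow> 'a::complex_star_algebra set) \<Rightarrow> 'g set \<Rightarrow> ('a, 'v) rep
      \<Rightarrow> ('a, ('a, 'v) ind_vec) rep"
  where "Ind G \<A> H \<rho> = rep_closure (ind_rep0 G \<A> H \<rho>)"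

definition ind_projection ::
    "('g, 'm) monoid_scheme \<Rightarrow> ('g \<Rightarrow> 'a::complex_star_algebra set) \<Rightarrow> 'g set \<Rightarrow> ('a, 'v) rep
      \<Rightarrow> 'g set \<Rightarrow> ('a, 'v) ind_vec \<Rightarrow> ('a, 'v) ind_vec"
  where "ind_projection G \<A> H \<rho> t =
    proj_onto (ind_space G \<A> H \<rho>)
      (vtop (ind_space G \<A> H \<rho>) closure_of
        vspan (ind_space G \<A> H \<rho>)
          {ind_vector G \<A> H \<rho> a v | a v. a \<in> graded_part \<A> t \<and> v \<in> rep_dom \<rho>})"


section \<open>Systems of imprimitivity\<close>

definition imprimitivity_system ::
    "('g, 'm) monoid_scheme \<Rightarrow> ('g \<Rightarrow> 'a::complex_star_algebra set) \<Rightarrow> 'g set \<Rightarrow> ('a, 'v) rep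
      \<Rightarrow> ('g set \<Rightarrow> 'v \<Rightarrow> 'v) \<Rightarrow> bool"
  where "imprimitivity_system G \<A> H \<pi> E \<longleftrightarrow>
    (let V = rep_space \<pi> in
      star_representation UNIV \<pi> \<and>
      (\<forall>t\<in>lcosets\<^bsub>G\<^esub> H. projection V (E t)) \<and>
      (\<forall>t1\<in>lcosets\<^bsub>G\<^esub> H. \<forall>t2\<in>lcosets\<^bsub>G\<^esub> H. t1 \<noteq> t2 \<longrightarrow>
        (\<forall>\<phi>\<in>carrier V. E t1 (E t2 \<phi>) = \<zero>\<^bsub>V\<^esub>)) \<and>
      (\<forall>\<phi>\<in>carrier V. limitin (vtop V) (\<lambda>F. \<Oplus>\<^bsub>V\<^esub>t\<in>F. E t \<phi>) \<phi>
        (finite_subsets_at_top (lcosets\<^bsub>G\<^esub> H))) \<and>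
      (\<forall>g\<in>carrier G. \<forall>t\<in>lcosets\<^bsub>G\<^esub> H. \<forall>a\<in>\<A> g. \<forall>\<phi>\<in>rep_dom \<pi>.
        E t \<phi> \<in> rep_dom \<pi> \<and> E (g <#\<^bsub>G\<^esub> t) (rep_op \<pi> a \<phi>) = rep_op \<pi> a (E t \<phi>)))"

definition system_dom :: "('a, 'v) rep \<Rightarrow> ('g set \<Rightarrow> 'v \<Rightarrow> 'v) \<Rightarrow> 'g set \<Rightarrow> 'v set"
  where "system_dom \<pi> E t = E t ` carrier (rep_space \<pi>) \<inter> rep_dom \<pi>"

definition nondegenerate_system ::
    "('g, 'm) monoid_scheme \<Rightarrow> ('g \<Rightarrow> 'a::complex_star_algebra set) \<Rightarrow> 'g set \<Rightarrow> ('a, 'v) rep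
      \<Rightarrow> ('g set \<Rightarrow> 'v \<Rightarrow> 'v) \<Rightarrow> bool"
  where "nondegenerate_system G \<A> H \<pi> E \<longleftrightarrow>
    (\<forall>t\<in>lcosets\<^bsub>G\<^esub> H.
      system_dom \<pi> E t \<subseteq> graph_topology \<pi> closure_of
        vspan (rep_space \<pi>) {rep_op \<pi> a \<phi> | a \<phi>. a \<in> graded_part \<A> t \<and> \<phi> \<in> system_dom \<pi> E H})"

definition well_behaved_system ::
    "('g, 'm) monoid_scheme \<Rightarrow> ('g \<Rightarrow> 'a::complex_star_algebra set) \<Rightarrow> 'g set \<Rightarrow> ('a, 'v) rep
      \<Rightarrow> ('g set \<Rightarrow> 'v \<Rightarrow> 'v) \<Rightarrow> bool"
  where "well_behaved_system G \<A> H \<pi> E \<longleftrightarrow>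
    (\<exists>E\<pi>. well_behaved_with G \<A> (carrier G) \<pi> E\<pi> \<and>
      (\<forall>t\<in>lcosets\<^bsub>G\<^esub> H. \<forall>\<Delta>\<in>sets (char_borel G \<A>). \<forall>\<phi>\<in>carrier (rep_space \<pi>).
        E t (E\<pi> \<Delta> \<phi>) = E\<pi> \<Delta> (E t \<phi>)))"

definition systems_unitarily_equivalent ::
    "('g, 'm) monoid_scheme \<Rightarrow> 'g set \<Rightarrow> ('a, 'v) rep \<Rightarrow> ('g set \<Rightarrow> 'v \<Rightarrow> 'v)
      \<Rightarrow> ('a, 'w) rep \<Rightarrow> ('g set \<Rightarrow> 'w \<Rightarrow> 'w) \<Rightarrow> bool"
  where "systems_unitarily_equivalent G H \<pi> E \<rho> F \<longleftrightarrow>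
    rep_alg \<pi> = rep_alg \<rho> \<and>
    (\<exists>U. unitary (rep_space \<pi>) (rep_space \<rho>) U \<and> U ` rep_dom \<pi> = rep_dom \<rho> \<and>
      (\<forall>a\<in>rep_alg \<pi>. \<forall>\<phi>\<in>rep_dom \<pi>. U (rep_op \<pi> a \<phi>) = rep_op \<rho> a (U \<phi>)) \<and>
      (\<forall>t\<in>lcosets\<^bsub>G\<^esub> H. \<forall>\<phi>\<in>carrier (rep_space \<pi>). U (E t \<phi>) = F t (U \<phi>)))"

end

theory Submission
  imports Defs
begin

text \<open>
  Why the theorem holds. The representation \<open>\<rho>\<close> is the restriction of \<open>\<pi>\<close> to \<open>\<A>\<^sub>H\<close> and to
  \<open>\<D>\<^sub>H = Ran E(H) \<inter> \<D>(\<pi>)\<close>, on the Hilbert space \<open>Ran E(H)\<close>. Covariance of \<open>E\<close> says that \<open>\<pi>(a)\<close> maps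
  \<open>\<D>\<^sub>H\<close> into \<open>Ran E(gH)\<close> when \<open>a\<close> has degree \<open>g\<close>. These ranges are orthogonal for different cosets, so
  \<open>\<langle>\<pi>(a)v, \<pi>(b)w\<rangle> = \<langle>\<pi>(b\<^sup>\<star>a)v, w\<rangle>\<close> only sees the part of \<open>b\<^sup>\<star>a\<close> in \<open>\<A>\<^sub>H\<close> and equals
  \<open>\<langle>\<rho>(p\<^sub>H(b\<^sup>\<star>a))v, w\<rangle>\<close> (lemma \<open>gram_DH\<close>). The form that defines induction is therefore the pullback of
  the inner product of \<open>\<pi>\<close> under \<open>a \<otimes> v \<mapsto> \<pi>(a)v\<close>. In particular \<open>\<rho>\<close> is inducible, and
  \<open>\<pi>(a)v \<mapsto> [a \<otimes> v]\<close> preserves inner products. Two families with the same inner products that are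
  total in Hilbert spaces are related by a unitary map (theorem \<open>unitary_of_gram\<close>).

  Two density arguments identify this unitary map as an equivalence of systems. The partial sums of
  \<open>\<Sum>\<^sub>t E(t)x\<close> converge to \<open>x \<in> \<D>(\<pi>)\<close> in the graph topology, because \<open>\<pi>(a)\<close> with \<open>a\<close> homogeneous only
  translates the index set of such a sum (lemma \<open>partial_sum_limit\<close>). Together with nondegeneracy,
  this makes the span \<open>K\<close> of the vectors \<open>\<pi>(a)v\<close> dense in \<open>\<D>(\<pi>)\<close> in the graph topology (lemma
  \<open>approx_K\<close>). As the restriction of \<open>\<pi>\<close> to \<open>\<A>\<^sub>e\<close> is closed, so is \<open>\<pi>\<close>; hence \<open>\<pi>\<close> is the closure of its
  restriction to \<open>K\<close>, which corresponds to the algebraic tensors (lemma \<open>systems_equivalent\<close>). The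
  representation \<open>\<rho>\<close> is well-behaved because \<open>E(H)\<close> reduces the operators \<open>\<pi>(b)\<close> with \<open>b\<close> of degree
  \<open>e\<close> as well as the spectral measure: closures, adjoints and spectral integrals of the restrictions
  are the restrictions of closures, adjoints and spectral integrals (lemma \<open>well_behaved_\<rho>\<close>).

  For uniqueness, let \<open>\<rho>'\<close> be another such representation and \<open>P\<close> the projection of the induced system
  at the coset \<open>H\<close>. On tensors, \<open>P\<close> is \<open>a \<otimes> u \<mapsto> 1 \<otimes> \<rho>'(p\<^sub>H(a))u\<close>. As \<open>\<rho>'(1)\<close> is the identity (lemma
  \<open>rep_one\<close>), \<open>v \<mapsto> [1 \<otimes> v]\<close> is isometric and intertwines \<open>\<rho>'\<close> with the induced representation. Its
  image consists of all vectors of the induced domain that are fixed by \<open>P\<close>: a net of tensors that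
  converges to such a vector is mapped by \<open>P\<close> to a net in \<open>\<D>(\<rho>')\<close> which is Cauchy in the graph
  topology and so has a limit in \<open>\<D>(\<rho>')\<close>. Transporting back along the equivalence of systems, \<open>\<rho>'\<close> is
  carried to the restriction of \<open>\<pi>\<close> to \<open>\<D>\<^sub>H\<close>, that is, to \<open>\<rho>\<close> (lemma \<open>unique\<close>).
\<close>

section \<open>Spaces with a Hermitian form\<close>

lemma complex_field_simps [simp]:
  "carrier complex_field = UNIV" "x \<otimes>\<^bsub>complex_field\<^esub> y = x * y" "\<one>\<^bsub>complex_field\<^esub> = 1"
  "\<zero>\<^bsub>complex_field\<^esub> = 0" "x \<oplus>\<^bsub>complex_field\<^esub> y = x + y"
  by (simp_all add: complex_field_def)

lemma cring_complex_field: "cring complex_field"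
proof (rule cringI)
  show "abelian_group complex_field"
    by (rule abelian_groupI) (auto simp: add.assoc intro: exI[of _ "- x" for x] add.left_inverse)
  show "comm_monoid complex_field"
    by (rule comm_monoidI) (auto simp: mult_ac)
qed (auto simp: algebra_simps)

text \<open>The form on the tensor product is positive only for inducible representations, so positivity is
  left to a second locale.\<close>

locale hermitian_space =
  fixes V :: "'v ip_space" (structure)
  assumes module: "module complex_field V"
    and ip_add_left: "\<lbrakk>x \<in> carrier V; y \<in> carrier V; z \<in> carrier V\<rbrakk> \<Longrightarrow>
      ip V (x \<oplus> y) z = ip V x z + ip V y z"
    and ip_smult_left: "\<lbrakk>x \<in> carrier V; y \<in> carrier V\<rbrakk> \<Longrightarrow> ip V (c \<odot> x) y = c * ip V x y"
    and ip_commute: "\<lbrakk>x \<in> carrier V; y \<in> carrier V\<rbrakk> \<Longrightarrow> ip V y x = cnj (ip V x y)"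

sublocale hermitian_space \<subseteq> abelian_group V
  using module by (rule module.axioms)

context hermitian_space
begin

lemma scalar_closed [simp, intro]: "x \<in> carrier V \<Longrightarrow> c \<odot> x \<in> carrier V"
  using module.smult_closed[OF module] by simp

lemma scalar_add_left: "x \<in> carrier V \<Longrightarrow> (c + d) \<odot> x = c \<odot> x \<oplus> d \<odot> x"
  using module.smult_l_distr[OF module, of c d x] by simp

lemma scalar_add_right:
  "\<lbrakk>x \<in> carrier V; y \<in> carrier V\<rbrakk> \<Longrightarrow> c \<odot> (x \<oplus> y) = c \<odot> x \<oplus> c \<odot> y"
  using module.smult_r_distr[OF module, of c x y] by simp

lemma scalar_assoc: "x \<in> carrier V \<Longrightarrow> (c * d) \<odot> x = c \<odot> (d \<odot> x)"
  using module.smult_assoc1[OF module, of c d x] by simp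

lemma scalar_one [simp]: "x \<in> carrier V \<Longrightarrow> 1 \<odot> x = x"
  using module.smult_one[OF module, of x] by simp

lemma scalar_zero [simp]: "x \<in> carrier V \<Longrightarrow> 0 \<odot> x = \<zero>"
  using module.smult_l_null[OF module, of x] by simp

lemma scalar_zero_right [simp]: "c \<odot> \<zero> = \<zero>"
  using module.smult_r_null[OF module, of c] by simp

lemma uminus_scalar: "x \<in> carrier V \<Longrightarrow> \<ominus> x = (-1) \<odot> x"
  by (metis scalar_closed scalar_add_left scalar_one scalar_zero add.left_inverse minus_equality)

lemma minus_scalar: "\<lbrakk>x \<in> carrier V; y \<in> carrier V\<rbrakk> \<Longrightarrow> x \<ominus> y = x \<oplus> (-1) \<odot> y"
  by (simp add: a_minus_def uminus_scalar)

lemma ip_add_right: "\<lbrakk>x \<in> carrier V; y \<in> carrier V; z \<in> carrier V\<rbrakk> \<Longrightarrow>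
    ip V z (x \<oplus> y) = ip V z x + ip V z y"
  by (metis a_closed complex_cnj_add ip_add_left ip_commute)

lemma ip_smult_right: "\<lbrakk>x \<in> carrier V; y \<in> carrier V\<rbrakk> \<Longrightarrow> ip V y (c \<odot> x) = cnj c * ip V y x"
  by (metis complex_cnj_mult ip_commute ip_smult_left scalar_closed)

lemma ip_zero_left [simp]: "x \<in> carrier V \<Longrightarrow> ip V \<zero> x = 0"
  by (metis ip_smult_left mult_zero_left scalar_zero zero_closed)

lemma ip_zero_right [simp]: "x \<in> carrier V \<Longrightarrow> ip V x \<zero> = 0"
  by (metis ip_commute ip_zero_left complex_cnj_zero zero_closed)

lemma ip_diff_left: "\<lbrakk>x \<in> carrier V; y \<in> carrier V; z \<in> carrier V\<rbrakk> \<Longrightarrow>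
    ip V (x \<ominus> y) z = ip V x z - ip V y z"
  by (simp add: minus_scalar ip_add_left ip_smult_left)

lemma ip_diff_right: "\<lbrakk>x \<in> carrier V; y \<in> carrier V; z \<in> carrier V\<rbrakk> \<Longrightarrow>
    ip V z (x \<ominus> y) = ip V z x - ip V z y"
  by (simp add: minus_scalar ip_add_right ip_smult_right)

lemmas ip_simps = ip_add_left ip_add_right ip_smult_left ip_smult_right ip_diff_left ip_diff_right

lemma minus_add_cancel: "\<lbrakk>x \<in> carrier V; y \<in> carrier V; z \<in> carrier V\<rbrakk> \<Longrightarrow>
    (x \<ominus> y) \<oplus> (y \<ominus> z) = x \<ominus> z"
  by (simp add: a_minus_def a_ac r_neg2)

lemma add_minus_add: "\<lbrakk>x \<in> carrier V; y \<in> carrier V; x' \<in> carrier V; y' \<in> carrier V\<rbrakk> \<Longrightarrow>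
    (x \<oplus> y) \<ominus> (x' \<oplus> y') = (x \<ominus> x') \<oplus> (y \<ominus> y')"
  by (simp add: a_minus_def a_ac minus_add)

lemma scalar_minus: "\<lbrakk>x \<in> carrier V; y \<in> carrier V\<rbrakk> \<Longrightarrow> c \<odot> x \<ominus> c \<odot> y = c \<odot> (x \<ominus> y)"
  by (simp add: minus_scalar scalar_add_right flip: scalar_assoc)

lemma minus_eq_zero: "\<lbrakk>x \<in> carrier V; y \<in> carrier V; x \<ominus> y = \<zero>\<rbrakk> \<Longrightarrow> x = y"
  by (metis a_minus_def add.inv_closed minus_equality minus_minus)

lemma minus_zero_iff: "\<lbrakk>x \<in> carrier V; y \<in> carrier V\<rbrakk> \<Longrightarrow> x \<ominus> y = \<zero> \<longleftrightarrow> x = y"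
  by (metis minus_eq_zero a_minus_def r_neg)

lemma minus_swap: "\<lbrakk>x \<in> carrier V; y \<in> carrier V\<rbrakk> \<Longrightarrow> y \<ominus> x = (-1) \<odot> (x \<ominus> y)"
  by (simp add: minus_scalar scalar_add_right a_comm flip: scalar_assoc)

lemma minus_zero_right: "x \<in> carrier V \<Longrightarrow> x \<ominus> \<zero> = x"
  by (simp add: minus_scalar)

lemma ip_finsum_left:
  assumes "finite A" "\<And>i. i \<in> A \<Longrightarrow> f i \<in> carrier V" "z \<in> carrier V"
  shows "ip V (finsum V f A) z = (\<Sum>i\<in>A. ip V (f i) z)"
  using assms
proof (induction A)
  case (insert i A)
  have "f \<in> A \<rightarrow> carrier V" "f i \<in> carrier V" using insert by auto
  with insert show ?case by (simp add: ip_add_left)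
qed simp

lemma ip_finsum_right:
  assumes "finite A" "\<And>i. i \<in> A \<Longrightarrow> f i \<in> carrier V" "z \<in> carrier V"
  shows "ip V z (finsum V f A) = (\<Sum>i\<in>A. ip V z (f i))"
  using assms
proof (induction A)
  case (insert i A)
  have "f \<in> A \<rightarrow> carrier V" "f i \<in> carrier V" using insert by auto
  with insert show ?case by (simp add: ip_add_right)
qed simp

lemma submodule_iff: "submodule S complex_field V \<longleftrightarrow>
    S \<subseteq> carrier V \<and> \<zero> \<in> S \<and> (\<forall>x\<in>S. \<forall>y\<in>S. x \<oplus> y \<in> S) \<and> (\<forall>c. \<forall>x\<in>S. c \<odot> x \<in> S)"
  (is "_ \<longleftrightarrow> ?R")
proof
  assume s: "submodule S complex_field V"
  then interpret s: submodule S complex_field V .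
  show ?R
    using module.submoduleE[OF module s] s.smult_closed s.one_closed by auto
next
  assume r: ?R
  show "submodule S complex_field V"
    using r by (intro module.submoduleI[OF module]) (auto simp: uminus_scalar subset_iff)
qed

lemma submodule_carrier: "submodule (carrier V) complex_field V"
  by (auto simp: submodule_iff)

lemma vspan_subset: "X \<subseteq> vspan V X"
  unfolding vspan_def by (rule hull_subset)

lemma vspan_minimal: "\<lbrakk>submodule S complex_field V; X \<subseteq> S\<rbrakk> \<Longrightarrow> vspan V X \<subseteq> S"
  unfolding vspan_def by (rule hull_minimal)

lemma submodule_vspan:
  assumes "X \<subseteq> carrier V" shows "submodule (vspan V X) complex_field V"
proof -
  have "vspan V X \<subseteq> carrier V"
    using vspan_minimal submodule_carrier assms by blast
  then show ?thesis
    by (auto simp: submodule_iff vspan_def hull_def)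
qed

lemma vspan_induct [consumes 2, case_names base zero add smult]:
  assumes "x \<in> vspan V X" and X: "X \<subseteq> carrier V"
    and base: "\<And>x. x \<in> X \<Longrightarrow> P x" and zero: "P \<zero>"
    and add: "\<And>x y. \<lbrakk>x \<in> vspan V X; y \<in> vspan V X; P x; P y\<rbrakk> \<Longrightarrow> P (x \<oplus> y)"
    and smult: "\<And>c x. \<lbrakk>x \<in> vspan V X; P x\<rbrakk> \<Longrightarrow> P (c \<odot> x)"
  shows "P x"
proof -
  have "vspan V X \<subseteq> {x \<in> vspan V X. P x}"
    using base zero add smult submodule_vspan[OF X] vspan_subset[of X]
    by (intro vspan_minimal) (auto simp: submodule_iff subset_iff)
  with assms(1) show ?thesis by auto
qed

lemma vspan_carrier: "X \<subseteq> carrier V \<Longrightarrow> vspan V X \<subseteq> carrier V"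
  using submodule_vspan by (auto simp: submodule_iff)

lemma vspan_add: "\<lbrakk>X \<subseteq> carrier V; x \<in> vspan V X; y \<in> vspan V X\<rbrakk> \<Longrightarrow> x \<oplus> y \<in> vspan V X"
  and vspan_smult: "\<lbrakk>X \<subseteq> carrier V; x \<in> vspan V X\<rbrakk> \<Longrightarrow> c \<odot> x \<in> vspan V X"
  and vspan_zero: "X \<subseteq> carrier V \<Longrightarrow> \<zero> \<in> vspan V X"
  using submodule_vspan by (auto simp: submodule_iff)

lemma linear_map_zero:
  assumes "hermitian_space W" "linear_map V D W T" "submodule D complex_field V"
  shows "T \<zero> = \<zero>\<^bsub>W\<^esub>"
proof -
  interpret W: hermitian_space W by fact
  show ?thesis
    using assms(2-3) unfolding submodule_iff linear_map_def
    by (metis W.scalar_zero scalar_zero zero_closed)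
qed

end

lemma hermitian_space_on_submodule:
  assumes "hermitian_space V" "submodule S complex_field V"
  shows "hermitian_space (V\<lparr>carrier := S\<rparr>)"
proof -
  interpret hermitian_space V by fact
  have "module complex_field (V\<lparr>carrier := S\<rparr>)"
    using submodule.submodule_is_module[OF assms(2) module] .
  moreover have "S \<subseteq> carrier V" using assms(2) by (simp add: submodule_iff)
  ultimately show ?thesis
    by (intro hermitian_space.intro) (auto simp: subset_iff ip_simps intro: ip_commute)
qed


section \<open>Positive forms and their topology\<close>

locale positive_space = hermitian_space +
  assumes ip_nonneg: "x \<in> carrier V \<Longrightarrow> ip V x x \<in> \<real>\<^sub>\<ge>\<^sub>0"
begin

lemma vnorm_nonneg [simp]: "x \<in> carrier V \<Longrightarrow> 0 \<le> vnorm V x"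
  using ip_nonneg by (auto simp: vnorm_def complex_nonneg_Reals_iff)

lemma ip_self: "x \<in> carrier V \<Longrightarrow> ip V x x = of_real ((vnorm V x)\<^sup>2)"
  using ip_nonneg[of x] by (auto simp: vnorm_def complex_nonneg_Reals_iff complex_eq_iff)

text \<open>The form is nonnegative at \<open>x - t\<langle>x,y\<rangle>y\<close> for all real \<open>t\<close>. Take \<open>t = 1/\<langle>y,y\<rangle>\<close>, or \<open>t\<close> large if
  \<open>\<langle>y,y\<rangle> = 0\<close>.\<close>

lemma Cauchy_Schwarz:
  assumes x: "x \<in> carrier V" and y: "y \<in> carrier V"
  shows "cmod (ip V x y) \<le> vnorm V x * vnorm V y"
proof -
  define b where "b = ip V x y"
  define a where "a = (vnorm V x)\<^sup>2"
  define c where "c = (vnorm V y)\<^sup>2"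
  have c: "c \<ge> 0" by (simp add: c_def)
  have main: "0 \<le> a - 2 * t * (cmod b)\<^sup>2 + t\<^sup>2 * (cmod b)\<^sup>2 * c" for t :: real
  proof -
    let ?z = "x \<oplus> (- of_real t * b) \<odot> y"
    have yx: "ip V y x = cnj b" using ip_commute[OF x y] by (simp add: b_def)
    have bb: "of_real (cmod b) * of_real (cmod b) = b * cnj b"
      using complex_norm_square[of b] by (simp add: power2_eq_square)
    have bb': "of_real (cmod b) * (of_real (cmod b) * z) = b * (cnj b * z)" for z
      by (simp flip: mult.assoc add: bb)
    have "ip V ?z ?z = of_real (a - 2 * t * (cmod b)\<^sup>2 + t\<^sup>2 * (cmod b)\<^sup>2 * c)"
      using x y ip_self[OF x] ip_self[OF y]
      by (simp add: ip_simps yx flip: b_def a_def c_def)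
        (simp add: algebra_simps power2_eq_square bb bb')
    moreover have "ip V ?z ?z \<in> \<real>\<^sub>\<ge>\<^sub>0" using x y by (intro ip_nonneg) auto
    ultimately show ?thesis by (simp only: nonneg_Reals_of_real_iff)
  qed
  have "(cmod b)\<^sup>2 \<le> a * c"
  proof (cases "c = 0")
    case True
    then have m: "0 \<le> a - 2 * t * (cmod b)\<^sup>2" for t using main[of t] by simp
    have "(cmod b)\<^sup>2 = 0"
    proof (rule ccontr)
      assume ne: "(cmod b)\<^sup>2 \<noteq> 0"
      from m[of "(a + 1) / (2 * (cmod b)\<^sup>2)"] ne show False
        by (simp add: field_simps)
    qed
    with True show ?thesis by simp
  next
    case False
    with c have "c > 0" by simp
    with main[of "1 / c"] show ?thesis
      by (simp add: field_simps power2_eq_square)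
  qed
  then have "(cmod b)\<^sup>2 \<le> (vnorm V x * vnorm V y)\<^sup>2"
    by (simp add: a_def c_def power_mult_distrib)
  then show ?thesis
    using x y by (simp add: b_def power2_le_iff_abs_le)
qed

lemma vnorm_triangle:
  assumes x: "x \<in> carrier V" and y: "y \<in> carrier V"
  shows "vnorm V (x \<oplus> y) \<le> vnorm V x + vnorm V y"
proof -
  have "complex_of_real ((vnorm V (x \<oplus> y))\<^sup>2) = ip V (x \<oplus> y) (x \<oplus> y)"
    using x y by (simp add: ip_self)
  also have "\<dots> = of_real ((vnorm V x)\<^sup>2) + of_real ((vnorm V y)\<^sup>2) + (ip V x y + cnj (ip V x y))"
    using x y ip_commute[OF x y] ip_self[OF x] ip_self[OF y] by (simp add: ip_simps)
  also have "\<dots> = of_real ((vnorm V x)\<^sup>2 + (vnorm V y)\<^sup>2 + 2 * Re (ip V x y))"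
    by (simp add: complex_add_cnj)
  finally have "(vnorm V (x \<oplus> y))\<^sup>2 = (vnorm V x)\<^sup>2 + (vnorm V y)\<^sup>2 + 2 * Re (ip V x y)"
    using of_real_eq_iff by blast
  moreover have "Re (ip V x y) \<le> vnorm V x * vnorm V y"
    using Cauchy_Schwarz[OF x y] complex_Re_le_cmod order_trans by blast
  ultimately have "(vnorm V (x \<oplus> y))\<^sup>2 \<le> (vnorm V x + vnorm V y)\<^sup>2"
    by (simp add: power2_sum)
  then show ?thesis using x y by (simp add: power2_le_iff_abs_le)
qed

lemma vnorm_smult: "x \<in> carrier V \<Longrightarrow> vnorm V (c \<odot> x) = cmod c * vnorm V x"
proof -
  assume x: "x \<in> carrier V"
  have "complex_of_real ((vnorm V (c \<odot> x))\<^sup>2) = ip V (c \<odot> x) (c \<odot> x)"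
    using x by (simp add: ip_self)
  also have "\<dots> = c * cnj c * of_real ((vnorm V x)\<^sup>2)"
    using x ip_self[OF x] by (simp add: ip_simps)
  also have "\<dots> = of_real ((cmod c * vnorm V x)\<^sup>2)"
    by (simp add: complex_norm_square[symmetric] power_mult_distrib)
  finally have "(vnorm V (c \<odot> x))\<^sup>2 = (cmod c * vnorm V x)\<^sup>2"
    using of_real_eq_iff by blast
  then show ?thesis using x by (simp add: power2_eq_iff_nonneg)
qed

lemma vnorm_zero [simp]: "vnorm V \<zero> = 0"
  by (simp add: vnorm_def)

lemma vnorm_minus_commute:
  "\<lbrakk>x \<in> carrier V; y \<in> carrier V\<rbrakk> \<Longrightarrow> vnorm V (x \<ominus> y) = vnorm V (y \<ominus> x)"
  using minus_swap[of x y] vnorm_smult[of "x \<ominus> y" "-1"] by simp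

lemma vnorm_triangle_minus: "\<lbrakk>x \<in> carrier V; y \<in> carrier V; z \<in> carrier V\<rbrakk> \<Longrightarrow>
    vnorm V (x \<ominus> z) \<le> vnorm V (x \<ominus> y) + vnorm V (y \<ominus> z)"
  using vnorm_triangle[of "x \<ominus> y" "y \<ominus> z"] minus_add_cancel[of x y z] by simp

lemma vnorm_le_minus: "\<lbrakk>x \<in> carrier V; y \<in> carrier V\<rbrakk> \<Longrightarrow>
    vnorm V x \<le> vnorm V (x \<ominus> y) + vnorm V y"
  using vnorm_triangle_minus[of x y \<zero>] by (simp add: minus_zero_right)

lemma ip_eq_0: "\<lbrakk>x \<in> carrier V; y \<in> carrier V; ip V x x = 0\<rbrakk> \<Longrightarrow> ip V x y = 0"
  using Cauchy_Schwarz[of x y] by (simp add: vnorm_def)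

end

locale inner_space = positive_space +
  assumes ip_definite: "\<lbrakk>x \<in> carrier V; ip V x x = 0\<rbrakk> \<Longrightarrow> x = \<zero>"
begin

lemma vnorm_eq_0: "x \<in> carrier V \<Longrightarrow> vnorm V x = 0 \<longleftrightarrow> x = \<zero>"
  using ip_definite ip_self by force

sublocale M: Metric_space "carrier V" "vdist V"
proof
  fix x y z
  show "0 \<le> vdist V x y" by (simp add: vdist_def)
  show "vdist V x y = vdist V y x" by (simp add: vdist_def vnorm_minus_commute)
  assume x: "x \<in> carrier V" and y: "y \<in> carrier V"
  show "vdist V x y = 0 \<longleftrightarrow> x = y"
    using x y by (simp add: vdist_def vnorm_eq_0 minus_zero_iff)
  assume z: "z \<in> carrier V"
  show "vdist V x z \<le> vdist V x y + vdist V y z"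
    using x y z by (simp add: vdist_def vnorm_triangle_minus)
qed

lemma vdist_eq [simp]:
  "\<lbrakk>x \<in> carrier V; y \<in> carrier V\<rbrakk> \<Longrightarrow> vdist V x y = vnorm V (x \<ominus> y)"
  by (simp add: vdist_def)

lemma limit_iff: "limitin (vtop V) f l F \<longleftrightarrow> l \<in> carrier V \<and> eventually (\<lambda>x. f x \<in> carrier V) F \<and>
    ((\<lambda>x. vnorm V (f x \<ominus> l)) \<longlongrightarrow> 0) F" (is "?L \<longleftrightarrow> ?R")
proof -
  have *: "((\<lambda>x. vdist V (f x) l) \<longlongrightarrow> 0) F \<longleftrightarrow> ((\<lambda>x. vnorm V (f x \<ominus> l)) \<longlongrightarrow> 0) F"
    if "l \<in> carrier V" "eventually (\<lambda>x. f x \<in> carrier V) F"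
    by (rule tendsto_cong, rule eventually_mono[OF that(2)]) (use that in simp)
  then show ?thesis unfolding M.limitin_metric_dist_null by blast
qed

lemma limit_carrier: "limitin (vtop V) f l F \<Longrightarrow> l \<in> carrier V"
  by (simp add: limit_iff)

lemma limit_unique: "\<lbrakk>limitin (vtop V) f l F; limitin (vtop V) f m F; F \<noteq> bot\<rbrakk> \<Longrightarrow> l = m"
  by (rule M.limitin_metric_unique)

lemma limit_le:
  assumes "l \<in> carrier V" "eventually (\<lambda>x. f x \<in> carrier V) F"
    and "eventually (\<lambda>x. vnorm V (f x \<ominus> l) \<le> h x) F" "(h \<longlongrightarrow> 0) F"
  shows "limitin (vtop V) f l F"
  unfolding limit_iff
proof (intro conjI assms)
  show "((\<lambda>x. vnorm V (f x \<ominus> l)) \<longlongrightarrow> 0) F"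
    by (rule real_tendsto_sandwich[OF _ assms(3) tendsto_const assms(4)])
      (rule eventually_mono[OF assms(2)], use assms(1) in simp)
qed

lemma limit_add:
  assumes "limitin (vtop V) f l F" "limitin (vtop V) g m F"
  shows "limitin (vtop V) (\<lambda>x. f x \<oplus> g x) (l \<oplus> m) F"
proof (rule limit_le)
  have f: "eventually (\<lambda>x. f x \<in> carrier V) F" and g: "eventually (\<lambda>x. g x \<in> carrier V) F"
    and l: "l \<in> carrier V" and m: "m \<in> carrier V"
    using assms by (auto simp: limit_iff)
  show "l \<oplus> m \<in> carrier V" using l m by simp
  show "eventually (\<lambda>x. f x \<oplus> g x \<in> carrier V) F" using f g by eventually_elim simp
  show "eventually (\<lambda>x. vnorm V ((f x \<oplus> g x) \<ominus> (l \<oplus> m)) \<le> vnorm V (f x \<ominus> l) + vnorm V (g x \<ominus> m)) F"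
    using f g by eventually_elim (simp add: l m add_minus_add vnorm_triangle)
  show "((\<lambda>x. vnorm V (f x \<ominus> l) + vnorm V (g x \<ominus> m)) \<longlongrightarrow> 0) F"
    using tendsto_add[of "\<lambda>x. vnorm V (f x \<ominus> l)" 0 F "\<lambda>x. vnorm V (g x \<ominus> m)" 0] assms
    by (simp add: limit_iff)
qed

lemma limit_smult:
  assumes "limitin (vtop V) f l F"
  shows "limitin (vtop V) (\<lambda>x. c \<odot> f x) (c \<odot> l) F"
proof (rule limit_le)
  have f: "eventually (\<lambda>x. f x \<in> carrier V) F" and l: "l \<in> carrier V"
    using assms by (auto simp: limit_iff)
  show "c \<odot> l \<in> carrier V" using l by simp
  show "eventually (\<lambda>x. c \<odot> f x \<in> carrier V) F" using f by eventually_elim simp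
  show "eventually (\<lambda>x. vnorm V (c \<odot> f x \<ominus> c \<odot> l) \<le> cmod c * vnorm V (f x \<ominus> l)) F"
    using f by eventually_elim (simp add: l scalar_minus vnorm_smult)
  show "((\<lambda>x. cmod c * vnorm V (f x \<ominus> l)) \<longlongrightarrow> 0) F"
    using assms by (intro tendsto_mult_right_zero) (simp add: limit_iff)
qed

lemma limit_ip:
  assumes "limitin (vtop V) f l F" "limitin (vtop V) g m F"
  shows "((\<lambda>x. ip V (f x) (g x)) \<longlongrightarrow> ip V l m) F"
proof -
  have f: "eventually (\<lambda>x. f x \<in> carrier V) F" and g: "eventually (\<lambda>x. g x \<in> carrier V) F"
    and l: "l \<in> carrier V" and m: "m \<in> carrier V"
    and 0: "((\<lambda>x. vnorm V (f x \<ominus> l)) \<longlongrightarrow> 0) F" "((\<lambda>x. vnorm V (g x \<ominus> m)) \<longlongrightarrow> 0) F"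
    using assms by (auto simp: limit_iff)
  let ?b = "\<lambda>x. vnorm V (f x \<ominus> l) * vnorm V (g x \<ominus> m) + vnorm V (f x \<ominus> l) * vnorm V m
    + vnorm V l * vnorm V (g x \<ominus> m)"
  have "(?b \<longlongrightarrow> 0 * 0 + 0 * vnorm V m + vnorm V l * 0) F"
    by (intro tendsto_intros 0)
  then have b0: "(?b \<longlongrightarrow> 0) F" by simp
  have "eventually (\<lambda>x. norm (ip V (f x) (g x) - ip V l m) \<le> ?b x) F"
    using f g
  proof eventually_elim
    case (elim x)
    have "ip V (f x) (g x) - ip V l m =
        ip V (f x \<ominus> l) (g x \<ominus> m) + ip V (f x \<ominus> l) m + ip V l (g x \<ominus> m)"
      using elim l m by (simp add: ip_simps)
    also have "norm \<dots> \<le> cmod (ip V (f x \<ominus> l) (g x \<ominus> m)) + cmod (ip V (f x \<ominus> l) m)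
        + cmod (ip V l (g x \<ominus> m))"
      by (meson norm_triangle_le norm_triangle_ineq add_right_mono order_trans)
    also have "\<dots> \<le> ?b x"
      using elim l m by (intro add_mono Cauchy_Schwarz) auto
    finally show ?case .
  qed
  from Lim_null_comparison[OF this b0] show ?thesis
    by (simp add: LIM_zero_iff)
qed

lemma closure_sequence:
  assumes "x \<in> vtop V closure_of S" "S \<subseteq> carrier V"
  obtains s :: "nat \<Rightarrow> 'a" where "\<And>n. s n \<in> S" "limitin (vtop V) s x sequentially"
proof -
  have x: "x \<in> carrier V" and s: "\<And>r. r > 0 \<Longrightarrow> \<exists>y\<in>S. vdist V x y < r"
    using assms unfolding M.metric_closure_of by auto
  have "\<exists>y\<in>S. vdist V x y < 1 / real (Suc n)" for n
    by (rule s) simp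
  then have "\<exists>s. \<forall>n. s n \<in> S \<and> vdist V x (s n) < 1 / real (Suc n)"
    by (intro choice) blast
  then obtain s where s: "\<And>n. s n \<in> S" "\<And>n. vdist V x (s n) < 1 / real (Suc n)"
    by blast
  have "limitin (vtop V) s x sequentially"
  proof (rule limit_le[OF x])
    show "eventually (\<lambda>n. s n \<in> carrier V) sequentially" using s(1) assms(2) by (intro always_eventually) blast
    show "eventually (\<lambda>n. vnorm V (s n \<ominus> x) \<le> 1 / real (Suc n)) sequentially"
    proof (intro always_eventually allI)
      fix n
      have "s n \<in> carrier V" using s(1) assms(2) by blast
      then show "vnorm V (s n \<ominus> x) \<le> 1 / real (Suc n)"
        using s(2)[of n] x vnorm_minus_commute[of x "s n"] by simp
    qed
    show "(\<lambda>n. 1 / real (Suc n)) \<longlonglongrightarrow> 0"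
      by (rule LIMSEQ_Suc[OF lim_1_over_n])
  qed
  with s(1) that show ?thesis by blast
qed

lemma limit_in_closure:
  assumes "limitin (vtop V) f x F" "eventually (\<lambda>i. f i \<in> S) F" "F \<noteq> bot"
  shows "x \<in> vtop V closure_of S"
  unfolding M.metric_closure_of
proof (clarify, intro conjI allI impI)
  show x: "x \<in> carrier V" using assms by (simp add: limit_carrier)
  fix r :: real assume "r > 0"
  then have "eventually (\<lambda>i. f i \<in> carrier V \<and> vdist V (f i) x < r) F"
    using assms(1) unfolding M.limitin_metric by blast
  then have "eventually (\<lambda>i. f i \<in> S \<and> f i \<in> carrier V \<and> vdist V (f i) x < r) F"
    using assms(2) by eventually_elim simp
  then obtain i where "f i \<in> S" "f i \<in> carrier V" "vdist V (f i) x < r"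
    using assms(3) eventually_happens' by blast
  with x show "\<exists>y\<in>S. y \<in> M.mball x r" by (auto simp: M.commute)
qed

lemma limit_closed_set:
  assumes "closedin (vtop V) S" "limitin (vtop V) f x F" "eventually (\<lambda>i. f i \<in> S) F" "F \<noteq> bot"
  shows "x \<in> S"
  using limit_in_closure[OF assms(2-4)] closure_of_closedin[OF assms(1)] by simp

text \<open>The difference of the two vectors is orthogonal to a total set, hence to itself. Identities
  between vectors of the induced space are proved in this way, since these vectors are known through
  their inner products with tensors.\<close>

lemma eq_of_ip_total:
  assumes X: "X \<subseteq> carrier V" and dense: "vtop V closure_of (vspan V X) = carrier V"
    and x: "x \<in> carrier V" and y: "y \<in> carrier V" and eq: "\<And>z. z \<in> X \<Longrightarrow> ip V x z = ip V y z"
  shows "x = y"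
proof -
  have *: "ip V (x \<ominus> y) z = 0" if "z \<in> vspan V X" for z
    using that X
  proof (induction rule: vspan_induct)
    case (base z) then show ?case using X x y eq by (auto simp: ip_simps)
  next
    case (add u v) then show ?case
      using vspan_carrier[OF X] x y by (auto simp: ip_add_right subset_iff)
  next
    case (smult c u) then show ?case
      using vspan_carrier[OF X] x y by (auto simp: ip_smult_right subset_iff)
  qed (use x y in simp)
  have "x \<ominus> y \<in> vtop V closure_of (vspan V X)" using dense x y by simp
  then obtain s where s: "\<And>n. s n \<in> vspan V X" "limitin (vtop V) s (x \<ominus> y) sequentially"
    using closure_sequence vspan_carrier[OF X] by blast
  have "(\<lambda>n. ip V (x \<ominus> y) (s n)) \<longlonglongrightarrow> ip V (x \<ominus> y) (x \<ominus> y)"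
    using s(2) x y by (intro limit_ip) auto
  moreover have "(\<lambda>n. ip V (x \<ominus> y) (s n)) = (\<lambda>_. 0)" using * s(1) by auto
  ultimately have "ip V (x \<ominus> y) (x \<ominus> y) = 0" by (simp add: LIMSEQ_const_iff)
  then show ?thesis using ip_definite minus_eq_zero x y by simp
qed

lemma submodule_closure:
  assumes "submodule S complex_field V"
  shows "submodule (vtop V closure_of S) complex_field V"
proof -
  have S: "S \<subseteq> carrier V" "\<zero> \<in> S" "\<And>x y. \<lbrakk>x \<in> S; y \<in> S\<rbrakk> \<Longrightarrow> x \<oplus> y \<in> S" "\<And>c x. x \<in> S \<Longrightarrow> c \<odot> x \<in> S"
    using assms by (auto simp: submodule_iff)
  show ?thesis unfolding submodule_iff
  proof (intro conjI ballI allI)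
    show "vtop V closure_of S \<subseteq> carrier V"
      using closure_of_subset_topspace[of "vtop V" S] by simp
    show "\<zero> \<in> vtop V closure_of S"
      using S closure_of_subset[of S "vtop V"] by auto
    fix x assume "x \<in> vtop V closure_of S"
    then obtain s where s: "\<And>n. s n \<in> S" "limitin (vtop V) s x sequentially"
      using closure_sequence S by metis
    show "c \<odot> x \<in> vtop V closure_of S" for c
      by (rule limit_in_closure[OF limit_smult[OF s(2)]]) (use s S in auto)
    fix y assume "y \<in> vtop V closure_of S"
    then obtain t where t: "\<And>n. t n \<in> S" "limitin (vtop V) t y sequentially"
      using closure_sequence S by metis
    show "x \<oplus> y \<in> vtop V closure_of S"
      by (rule limit_in_closure[OF limit_add[OF s(2) t(2)]]) (use s t S in auto)
  qed
qed

end

locale hilbert = inner_space +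
  assumes complete: "M.mcomplete"

lemma hilbert_space_iff: "hilbert_space V \<longleftrightarrow> hilbert V"
proof
  assume h: "hilbert_space V"
  then interpret hermitian_space V
    unfolding hilbert_space_def by (intro hermitian_space.intro) blast+
  interpret positive_space V
    using h unfolding hilbert_space_def by unfold_locales blast
  interpret inner_space V
    using h unfolding hilbert_space_def by unfold_locales blast
  show "hilbert V"
    using h unfolding hilbert_space_def by unfold_locales blast
next
  assume "hilbert V"
  then interpret hilbert V .
  show "hilbert_space V"
    unfolding hilbert_space_def
    by (intro conjI ballI allI impI)
      ((rule module ip_nonneg ip_definite complete ip_commute ip_add_left ip_smult_left; assumption?)+)
qed

section \<open>Quotients and completions\<close>

text \<open>Every axiom of the image follows from the same axiom for representatives. Quotients are
  treated as images under the quotient map.\<close>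

lemma hermitian_space_image:
  fixes W :: "'w ip_space"
  assumes "hermitian_space V" and car: "carrier W = f ` carrier V"
    and add: "\<And>x y. \<lbrakk>x \<in> carrier V; y \<in> carrier V\<rbrakk> \<Longrightarrow> f (x \<oplus>\<^bsub>V\<^esub> y) = f x \<oplus>\<^bsub>W\<^esub> f y"
    and smult: "\<And>c x. x \<in> carrier V \<Longrightarrow> f (c \<odot>\<^bsub>V\<^esub> x) = c \<odot>\<^bsub>W\<^esub> f x"
    and zero: "\<zero>\<^bsub>W\<^esub> = f \<zero>\<^bsub>V\<^esub>"
    and ip: "\<And>x y. \<lbrakk>x \<in> carrier V; y \<in> carrier V\<rbrakk> \<Longrightarrow> ip W (f x) (f y) = ip V x y"
  shows "hermitian_space W"
proof -
  interpret V: hermitian_space V by fact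
  have ag: "abelian_group W"
  proof (rule abelian_groupI)
    fix x y assume "x \<in> carrier W" "y \<in> carrier W"
    then obtain u v where uv: "x = f u" "y = f v" "u \<in> carrier V" "v \<in> carrier V"
      by (auto simp: car)
    show "x \<oplus>\<^bsub>W\<^esub> y \<in> carrier W" using uv by (simp add: car flip: add)
    show "x \<oplus>\<^bsub>W\<^esub> y = y \<oplus>\<^bsub>W\<^esub> x" using uv by (simp add: V.a_comm flip: add)
    show "\<zero>\<^bsub>W\<^esub> \<oplus>\<^bsub>W\<^esub> x = x" using uv by (simp add: zero flip: add)
    have "f (\<ominus>\<^bsub>V\<^esub> u) \<in> carrier W" "f (\<ominus>\<^bsub>V\<^esub> u) \<oplus>\<^bsub>W\<^esub> x = \<zero>\<^bsub>W\<^esub>"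
      using uv by (simp_all add: zero car V.l_neg flip: add)
    then show "\<exists>y\<in>carrier W. y \<oplus>\<^bsub>W\<^esub> x = \<zero>\<^bsub>W\<^esub>" by blast
    fix z assume "z \<in> carrier W"
    then obtain w where w: "z = f w" "w \<in> carrier V" by (auto simp: car)
    show "x \<oplus>\<^bsub>W\<^esub> y \<oplus>\<^bsub>W\<^esub> z = x \<oplus>\<^bsub>W\<^esub> (y \<oplus>\<^bsub>W\<^esub> z)" using uv w by (simp add: V.a_assoc flip: add)
  qed (simp add: zero car)
  have "module complex_field W"
  proof (rule moduleI[OF cring_complex_field ag])
    fix c d x assume "x \<in> carrier W"
    then obtain u where u: "x = f u" "u \<in> carrier V" by (auto simp: car)
    show "c \<odot>\<^bsub>W\<^esub> x \<in> carrier W" using u by (simp add: car flip: smult)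
    show "(c \<oplus>\<^bsub>complex_field\<^esub> d) \<odot>\<^bsub>W\<^esub> x = c \<odot>\<^bsub>W\<^esub> x \<oplus>\<^bsub>W\<^esub> d \<odot>\<^bsub>W\<^esub> x"
      using u by (simp add: V.scalar_add_left flip: smult add)
    show "(c \<otimes>\<^bsub>complex_field\<^esub> d) \<odot>\<^bsub>W\<^esub> x = c \<odot>\<^bsub>W\<^esub> (d \<odot>\<^bsub>W\<^esub> x)"
      using u by (simp add: V.scalar_assoc flip: smult)
    show "\<one>\<^bsub>complex_field\<^esub> \<odot>\<^bsub>W\<^esub> x = x" using u by (simp flip: smult)
    fix y assume "y \<in> carrier W"
    then obtain v where v: "y = f v" "v \<in> carrier V" by (auto simp: car)
    show "c \<odot>\<^bsub>W\<^esub> (x \<oplus>\<^bsub>W\<^esub> y) = c \<odot>\<^bsub>W\<^esub> x \<oplus>\<^bsub>W\<^esub> c \<odot>\<^bsub>W\<^esub> y"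
      using u v by (simp add: V.scalar_add_right flip: smult add)
  qed
  then show ?thesis
  proof (rule hermitian_space.intro)
    fix x y assume "x \<in> carrier W" "y \<in> carrier W"
    then obtain u v where uv: "x = f u" "y = f v" "u \<in> carrier V" "v \<in> carrier V"
      by (auto simp: car)
    show "ip W (c \<odot>\<^bsub>W\<^esub> x) y = c * ip W x y" for c
      using uv by (simp add: ip V.ip_simps flip: smult)
    show "ip W y x = cnj (ip W x y)"
      using uv V.ip_commute[of u v] by (simp add: ip)
    fix z assume "z \<in> carrier W"
    then obtain w where w: "z = f w" "w \<in> carrier V" by (auto simp: car)
    show "ip W (x \<oplus>\<^bsub>W\<^esub> y) z = ip W x z + ip W y z"
      using uv w by (simp add: ip V.ip_simps flip: add)
  qed
qed

text \<open>Since \<open>N\<close> lies in the radical, the form descends to the quotient by \<open>N\<close>; \<open>N\<close> may be smaller than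
  the radical, as for the relations of a tensor product.\<close>

locale form_quotient = hermitian_space +
  fixes N
  assumes submodule_N: "submodule N complex_field V"
    and radical: "\<lbrakk>n \<in> N; x \<in> carrier V\<rbrakk> \<Longrightarrow> ip V n x = 0"
begin

lemma N_facts: "n \<in> N \<Longrightarrow> n \<in> carrier V" "\<zero> \<in> N" "\<lbrakk>m \<in> N; n \<in> N\<rbrakk> \<Longrightarrow> m \<oplus> n \<in> N"
    "n \<in> N \<Longrightarrow> c \<odot> n \<in> N"
  using submodule_N by (auto simp: submodule_iff)

sublocale N: abelian_subgroup N V
proof (rule abelian_subgroupI3)
  show "additive_subgroup N V"
    using submodule_N by (intro additive_subgroup.intro) (rule submodule.axioms)
  show "abelian_group V" ..
qed

lemma coset_eq: "N +> x = {n \<oplus> x | n. n \<in> N}"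
  by (auto simp: a_r_coset_def')

lemma coset_self: "x \<in> carrier V \<Longrightarrow> x \<in> N +> x"
  unfolding coset_eq mem_Collect_eq using N_facts(2) l_zero[of x] by (intro exI[of _ "\<zero>"]) simp

lemma coset_eqI: "\<lbrakk>x \<in> carrier V; y \<in> N +> x\<rbrakk> \<Longrightarrow> N +> y = N +> x"
  by (rule N.a_repr_independence'[symmetric])

lemma quotient_carrier: "carrier (quotient_space V N) = (\<lambda>x. N +> x) ` carrier V"
  by (auto simp: quotient_space_def A_RCOSETS_def')

lemma quotient_add: "\<lbrakk>x \<in> carrier V; y \<in> carrier V\<rbrakk> \<Longrightarrow>
    N +> (x \<oplus> y) = (N +> x) \<oplus>\<^bsub>quotient_space V N\<^esub> (N +> y)"
  by (simp add: quotient_space_def N.a_rcos_sum)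

lemma quotient_smult:
  assumes x: "x \<in> carrier V"
  shows "N +> (c \<odot> x) = c \<odot>\<^bsub>quotient_space V N\<^esub> (N +> x)"
proof -
  have *: "N +> (c \<odot> y) = N +> (c \<odot> x)" if y: "y \<in> N +> x" for y
  proof (rule coset_eqI)
    obtain n where "n \<in> N" "y = n \<oplus> x" using y by (auto simp: coset_eq)
    then have "c \<odot> n \<in> N" "c \<odot> y = c \<odot> n \<oplus> c \<odot> x"
      using x by (auto simp: N_facts scalar_add_right)
    then show "c \<odot> y \<in> N +> (c \<odot> x)" by (auto simp: coset_eq)
  qed (use x in simp)
  have "N +> x \<noteq> {}" using coset_self[OF x] by blast
  then have "(\<Union>y\<in>N +> x. N +> (c \<odot> y)) = N +> (c \<odot> x)"
    by (rule SUP_eq_const) (rule *)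
  then show ?thesis by (simp add: quotient_space_def)
qed

lemma quotient_ip:
  assumes x: "x \<in> carrier V" and y: "y \<in> carrier V"
  shows "ip (quotient_space V N) (N +> x) (N +> y) = ip V x y"
proof -
  have "ip V u v = ip V x y" if uv: "u \<in> N +> x" "v \<in> N +> y" for u v
  proof -
    obtain m n where "m \<in> N" "u = m \<oplus> x" "n \<in> N" "v = n \<oplus> y"
      using uv by (auto simp: coset_eq)
    moreover have "ip V z n = 0" if "z \<in> carrier V" "n \<in> N" for z n
      using radical[OF that(2,1)] ip_commute[of n z] that by (simp add: N_facts)
    ultimately show ?thesis
      using x y by (simp add: ip_simps N_facts radical)
  qed
  then have "{ip V u v | u v. u \<in> N +> x \<and> v \<in> N +> y} = {ip V x y}"
    using coset_self[OF x] coset_self[OF y] by blast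
  then show ?thesis by (simp add: quotient_space_def)
qed

lemma coset_zero: "N +> \<zero> = N"
proof -
  have "(\<lambda>n. n \<oplus> \<zero>) ` N = (\<lambda>n. n) ` N" using N_facts(1) by (intro image_cong refl) simp
  moreover have "{n \<oplus> \<zero> | n. n \<in> N} = (\<lambda>n. n \<oplus> \<zero>) ` N" by blast
  ultimately show ?thesis by (simp only: coset_eq image_ident)
qed

lemma quotient_zero: "\<zero>\<^bsub>quotient_space V N\<^esub> = N +> \<zero>"
  by (simp add: quotient_space_def coset_zero)

lemma hermitian_quotient: "hermitian_space (quotient_space V N)"
  by (rule hermitian_space_image[where f = "\<lambda>x. N +> x", OF _ quotient_carrier
        quotient_add quotient_smult quotient_zero quotient_ip]) unfold_locales

end

context positive_space
begin

text \<open>By the Cauchy-Schwarz inequality, null vectors are orthogonal to all vectors.\<close>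

lemma form_quotient_kernel: "form_quotient V (ip_kernel V)"
proof (intro form_quotient.intro form_quotient_axioms.intro)
  show "hermitian_space V" ..
  have 0: "ip V x y = 0" if "x \<in> ip_kernel V" "y \<in> carrier V" for x y
    using ip_eq_0[of x y] that by (simp add: ip_kernel_def)
  show "ip V n x = 0" if "n \<in> ip_kernel V" "x \<in> carrier V" for n x using that by (rule 0)
  show "submodule (ip_kernel V) complex_field V"
    unfolding submodule_iff
  proof (intro conjI ballI allI)
    fix x y assume "x \<in> ip_kernel V" "y \<in> ip_kernel V"
    then show "x \<oplus> y \<in> ip_kernel V"
      using 0[of x y] 0[of y x] by (simp add: ip_kernel_def ip_simps)
  qed (auto simp: ip_kernel_def ip_simps)
qed

lemma inner_space_quotient: "inner_space (quotient_space V (ip_kernel V))"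
proof -
  interpret q: form_quotient V "ip_kernel V" by (rule form_quotient_kernel)
  interpret Q: hermitian_space "quotient_space V (ip_kernel V)" by (rule q.hermitian_quotient)
  show ?thesis
  proof
    fix X assume "X \<in> carrier (quotient_space V (ip_kernel V))"
    then obtain x where x: "X = ip_kernel V +> x" "x \<in> carrier V"
      by (auto simp: q.quotient_carrier)
    show "ip (quotient_space V (ip_kernel V)) X X \<in> \<real>\<^sub>\<ge>\<^sub>0"
      using x by (simp add: q.quotient_ip ip_nonneg)
    assume "ip (quotient_space V (ip_kernel V)) X X = 0"
    then have "ip V x x = 0" using x(2) by (simp only: x(1) q.quotient_ip)
    then have "x \<in> ip_kernel V" using x(2) by (simp only: ip_kernel_def mem_Collect_eq)
    then have "ip_kernel V +> x = ip_kernel V +> \<zero>"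
      by (intro q.coset_eqI zero_closed) (simp only: q.coset_zero)
    then show "X = \<zero>\<^bsub>quotient_space V (ip_kernel V)\<^esub>"
      using x(1) by (simp only: q.quotient_zero)
  qed
qed

text \<open>Polarization reduces the convergence of inner products to that of norms.\<close>

lemma polarization:
  assumes "x \<in> carrier V" "y \<in> carrier V"
  shows "4 * ip V x y = of_real ((vnorm V (x \<oplus> y))\<^sup>2) - of_real ((vnorm V (x \<oplus> (-1) \<odot> y))\<^sup>2)
    + \<i> * of_real ((vnorm V (x \<oplus> \<i> \<odot> y))\<^sup>2) - \<i> * of_real ((vnorm V (x \<oplus> (-\<i>) \<odot> y))\<^sup>2)"
proof -
  have "complex_of_real ((vnorm V (x \<oplus> c \<odot> y))\<^sup>2) =
      ip V x x + cnj c * ip V x y + c * ip V y x + c * cnj c * ip V y y" for c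
  proof -
    have "complex_of_real ((vnorm V (x \<oplus> c \<odot> y))\<^sup>2) = ip V (x \<oplus> c \<odot> y) (x \<oplus> c \<odot> y)"
      using assms by (simp add: ip_self)
    then show ?thesis using assms by (simp add: ip_simps algebra_simps)
  qed
  note E = this
  have "x \<oplus> y = x \<oplus> 1 \<odot> y" using assms by simp
  then show ?thesis by (simp only: E) (simp add: algebra_simps)
qed

end

context inner_space
begin

lemma closure_iff:
  assumes "X \<subseteq> carrier V"
  shows "z \<in> vtop V closure_of X \<longleftrightarrow> z \<in> carrier V \<and> (\<forall>r>0. \<exists>y\<in>X. vnorm V (z \<ominus> y) < r)"
proof -
  have "y \<in> M.mball z r \<longleftrightarrow> vnorm V (z \<ominus> y) < r" if "z \<in> carrier V" "y \<in> X" for y r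
    using that assms by auto
  then show ?thesis unfolding M.metric_closure_of by blast
qed

abbreviation MC where "MC \<equiv> M.MCauchy"

lemma MCauchy_iff: "MC s \<longleftrightarrow> (\<forall>n. s n \<in> carrier V) \<and>
    (\<forall>e>0. \<exists>N. \<forall>n\<ge>N. \<forall>m\<ge>N. vnorm V (s n \<ominus> s m) < e)"
proof -
  have "(\<forall>n. s n \<in> carrier V) \<Longrightarrow> vdist V (s n) (s m) = vnorm V (s n \<ominus> s m)" for n m by simp
  then show ?thesis unfolding M.MCauchy_def image_subset_iff by (metis UNIV_I)
qed

lemma MC_closed: "MC s \<Longrightarrow> s n \<in> carrier V"
  by (simp add: MCauchy_iff)

lemma MC_add:
  assumes "MC s" "MC t" shows "MC (\<lambda>n. s n \<oplus> t n)"
  unfolding MCauchy_iff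
proof (intro conjI allI impI)
  show "s n \<oplus> t n \<in> carrier V" for n using assms by (simp add: MC_closed)
  fix e :: real assume "e > 0"
  then have "e / 2 > 0" by simp
  then obtain N N' where N: "\<And>n m. \<lbrakk>n \<ge> N; m \<ge> N\<rbrakk> \<Longrightarrow> vnorm V (s n \<ominus> s m) < e / 2"
      "\<And>n m. \<lbrakk>n \<ge> N'; m \<ge> N'\<rbrakk> \<Longrightarrow> vnorm V (t n \<ominus> t m) < e / 2"
    using assms unfolding MCauchy_iff by meson
  have "vnorm V ((s n \<oplus> t n) \<ominus> (s m \<oplus> t m)) < e" if "n \<ge> max N N'" "m \<ge> max N N'" for n m
  proof -
    have "vnorm V ((s n \<oplus> t n) \<ominus> (s m \<oplus> t m)) \<le> vnorm V (s n \<ominus> s m) + vnorm V (t n \<ominus> t m)"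
      using assms by (simp add: MC_closed add_minus_add vnorm_triangle)
    also have "\<dots> < e / 2 + e / 2" using N that by (intro add_strict_mono) auto
    finally show ?thesis by simp
  qed
  then show "\<exists>N. \<forall>n\<ge>N. \<forall>m\<ge>N. vnorm V ((s n \<oplus> t n) \<ominus> (s m \<oplus> t m)) < e" by blast
qed

lemma MC_smult:
  assumes "MC s" shows "MC (\<lambda>n. c \<odot> s n)"
  unfolding MCauchy_iff
proof (intro conjI allI impI)
  show "c \<odot> s n \<in> carrier V" for n using assms by (simp add: MC_closed)
  fix e :: real assume "e > 0"
  then have "e / (cmod c + 1) > 0" by (simp add: add_nonneg_pos)
  then obtain N where N: "\<And>n m. \<lbrakk>n \<ge> N; m \<ge> N\<rbrakk> \<Longrightarrow> vnorm V (s n \<ominus> s m) < e / (cmod c + 1)"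
    using assms unfolding MCauchy_iff by meson
  have "vnorm V (c \<odot> s n \<ominus> c \<odot> s m) < e" if "n \<ge> N" "m \<ge> N" for n m
  proof -
    have "vnorm V (c \<odot> s n \<ominus> c \<odot> s m) = cmod c * vnorm V (s n \<ominus> s m)"
      using assms by (simp add: MC_closed scalar_minus vnorm_smult)
    also have "\<dots> \<le> (cmod c + 1) * vnorm V (s n \<ominus> s m)"
      using assms by (intro mult_right_mono) (auto simp: MC_closed)
    also have "\<dots> < e"
      using N[OF that] by (simp add: pos_less_divide_eq add_nonneg_pos mult.commute)
    finally show ?thesis .
  qed
  then show "\<exists>N. \<forall>n\<ge>N. \<forall>m\<ge>N. vnorm V (c \<odot> s n \<ominus> c \<odot> s m) < e" by blast
qed

lemma MC_norm_convergent:
  assumes "MC s" shows "convergent (\<lambda>n. vnorm V (s n))"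
proof -
  have "Cauchy (\<lambda>n. vnorm V (s n))"
  proof (rule metric_CauchyI)
    fix e :: real assume "e > 0"
    then obtain N where N: "\<And>n m. \<lbrakk>n \<ge> N; m \<ge> N\<rbrakk> \<Longrightarrow> vnorm V (s n \<ominus> s m) < e"
      using assms unfolding MCauchy_iff by meson
    have "dist (vnorm V (s n)) (vnorm V (s m)) < e" if "n \<ge> N" "m \<ge> N" for n m
      using vnorm_le_minus[of "s n" "s m"] vnorm_le_minus[of "s m" "s n"] N[OF that]
        vnorm_minus_commute[of "s n" "s m"] assms
      by (simp add: MC_closed dist_real_def)
    then show "\<exists>N. \<forall>m\<ge>N. \<forall>n\<ge>N. dist (vnorm V (s m)) (vnorm V (s n)) < e" by blast
  qed
  then show ?thesis by (simp add: Cauchy_convergent_iff)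
qed

lemma MC_ip_convergent:
  assumes "MC s" "MC t"
  shows "(\<lambda>n. ip V (s n) (t n)) \<longlonglongrightarrow> lim (\<lambda>n. ip V (s n) (t n))"
proof -
  have c: "\<exists>l. (\<lambda>n. vnorm V (s n \<oplus> c \<odot> t n)) \<longlonglongrightarrow> l" for c
    using MC_norm_convergent[OF MC_add[OF assms(1) MC_smult[OF assms(2)]]]
    unfolding convergent_def .
  obtain l where l: "\<And>c. (\<lambda>n. vnorm V (s n \<oplus> c \<odot> t n)) \<longlonglongrightarrow> l c"
    using c by metis
  have l1: "(\<lambda>n. vnorm V (s n \<oplus> t n)) \<longlonglongrightarrow> l 1"
    using l[of 1] assms by (simp add: MC_closed)
  have p: "ip V (s n) (t n) = (of_real ((vnorm V (s n \<oplus> t n))\<^sup>2)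
      - of_real ((vnorm V (s n \<oplus> (-1) \<odot> t n))\<^sup>2) + \<i> * of_real ((vnorm V (s n \<oplus> \<i> \<odot> t n))\<^sup>2)
      - \<i> * of_real ((vnorm V (s n \<oplus> (-\<i>) \<odot> t n))\<^sup>2)) / 4" for n
    using polarization[of "s n" "t n"] assms
    by (metis MC_closed nonzero_mult_div_cancel_left zero_neq_numeral)
  have "(\<lambda>n. ip V (s n) (t n)) \<longlonglongrightarrow> (of_real ((l 1)\<^sup>2) - of_real ((l (-1))\<^sup>2)
      + \<i> * of_real ((l \<i>)\<^sup>2) - \<i> * of_real ((l (-\<i>))\<^sup>2)) / 4"
    unfolding p by (intro tendsto_intros l l1) simp
  then show ?thesis by (simp add: limI)
qed

lemma cauchy_space_simps: "carrier (cauchy_space V) = Collect MC"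
  "s \<oplus>\<^bsub>cauchy_space V\<^esub> t = (\<lambda>n. s n \<oplus> t n)" "\<zero>\<^bsub>cauchy_space V\<^esub> = (\<lambda>_. \<zero>)"
  "c \<odot>\<^bsub>cauchy_space V\<^esub> s = (\<lambda>n. c \<odot> s n)" "ip (cauchy_space V) s t = lim (\<lambda>n. ip V (s n) (t n))"
  by (simp_all add: cauchy_space_def)

lemma positive_cauchy_space: "positive_space (cauchy_space V)"
proof -
  have ag: "abelian_group (cauchy_space V)"
  proof (rule abelian_groupI)
    fix s assume s: "s \<in> carrier (cauchy_space V)"
    have "(\<lambda>n. (-1) \<odot> s n) \<oplus>\<^bsub>cauchy_space V\<^esub> s = \<zero>\<^bsub>cauchy_space V\<^esub>"
    proof -
      have "(-1) \<odot> s n \<oplus> s n = \<zero>" for n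
        using s l_neg[of "s n"] by (simp add: uminus_scalar cauchy_space_simps MC_closed)
      then show ?thesis by (simp add: cauchy_space_simps)
    qed
    then show "\<exists>t\<in>carrier (cauchy_space V). t \<oplus>\<^bsub>cauchy_space V\<^esub> s = \<zero>\<^bsub>cauchy_space V\<^esub>"
      using s MC_smult by (auto simp: cauchy_space_simps)
  qed (auto simp: cauchy_space_simps MC_add MC_closed a_ac)
  have m: "module complex_field (cauchy_space V)"
    by (rule moduleI[OF cring_complex_field ag])
      (auto simp: cauchy_space_simps MC_smult MC_closed scalar_add_left scalar_add_right scalar_assoc)
  interpret C: hermitian_space "cauchy_space V"
  proof (rule hermitian_space.intro[OF m]; (unfold cauchy_space_simps)?; (unfold mem_Collect_eq)?)
    fix s t assume s: "MC s" and t: "MC t"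
    note st = MC_ip_convergent[OF s t]
    have "(\<lambda>n. c * ip V (s n) (t n)) \<longlonglongrightarrow> c * lim (\<lambda>n. ip V (s n) (t n))" for c
      by (intro tendsto_intros st)
    then show "lim (\<lambda>n. ip V (c \<odot> s n) (t n)) = c * lim (\<lambda>n. ip V (s n) (t n))" for c
      using s t by (simp add: limI ip_simps MC_closed)
    have "(\<lambda>n. cnj (ip V (s n) (t n))) \<longlonglongrightarrow> cnj (lim (\<lambda>n. ip V (s n) (t n)))"
      by (intro tendsto_intros st)
    moreover have "ip V (t n) (s n) = cnj (ip V (s n) (t n))" for n
      using s t by (intro ip_commute) (auto simp: MC_closed)
    ultimately show "lim (\<lambda>n. ip V (t n) (s n)) = cnj (lim (\<lambda>n. ip V (s n) (t n)))"
      by (simp add: limI)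
    fix u assume u: "MC u"
    have "(\<lambda>n. ip V (s n) (u n) + ip V (t n) (u n)) \<longlonglongrightarrow>
        lim (\<lambda>n. ip V (s n) (u n)) + lim (\<lambda>n. ip V (t n) (u n))"
      by (intro tendsto_intros MC_ip_convergent s t u)
    then show "lim (\<lambda>n. ip V (s n \<oplus> t n) (u n)) =
        lim (\<lambda>n. ip V (s n) (u n)) + lim (\<lambda>n. ip V (t n) (u n))"
      using s t u by (simp add: limI ip_simps MC_closed)
  qed
  show ?thesis
  proof (unfold_locales, unfold cauchy_space_simps mem_Collect_eq)
    fix s assume s: "MC s"
    have "(\<lambda>n. ip V (s n) (s n)) \<longlonglongrightarrow> lim (\<lambda>n. ip V (s n) (s n))"
      using MC_ip_convergent s by blast
    then show "lim (\<lambda>n. ip V (s n) (s n)) \<in> \<real>\<^sub>\<ge>\<^sub>0"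
      by (rule closed_sequentially[OF closed_nonneg_Reals_complex, rotated])
        (use s in \<open>simp add: ip_nonneg MC_closed\<close>)
  qed
qed

text \<open>The class of a Cauchy sequence \<open>s\<close> is the limit of the constant sequences \<open>s n\<close>, which gives
  density. For completeness, replace the \<open>n\<close>th term of a Cauchy sequence of classes by a constant
  sequence at distance less than \<open>1/(n+1)\<close>; the sequence of these constants is Cauchy, and its class
  is the limit.\<close>

lemma completion_facts:
  shows "hilbert (completion V)"
    and "\<And>x. x \<in> carrier V \<Longrightarrow> completion_embed V x \<in> carrier (completion V)"
    and "\<And>x y. \<lbrakk>x \<in> carrier V; y \<in> carrier V\<rbrakk> \<Longrightarrow> completion_embed V (x \<oplus> y) =
      completion_embed V x \<oplus>\<^bsub>completion V\<^esub> completion_embed V y"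
    and "\<And>c x. x \<in> carrier V \<Longrightarrow>
      completion_embed V (c \<odot> x) = c \<odot>\<^bsub>completion V\<^esub> completion_embed V x"
    and "\<And>x y. \<lbrakk>x \<in> carrier V; y \<in> carrier V\<rbrakk> \<Longrightarrow>
      ip (completion V) (completion_embed V x) (completion_embed V y) = ip V x y"
    and "vtop (completion V) closure_of (completion_embed V ` carrier V) = carrier (completion V)"
    and "completion_embed V \<zero> = \<zero>\<^bsub>completion V\<^esub>"
proof -
  let ?C = "cauchy_space V"
  let ?W = "completion V"
  let ?e = "completion_embed V"
  interpret C: positive_space ?C by (rule positive_cauchy_space)
  interpret q: form_quotient ?C "ip_kernel ?C" by (rule C.form_quotient_kernel)
  define Q where "Q s = ip_kernel ?C +>\<^bsub>?C\<^esub> s" for s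
  have W: "?W = quotient_space ?C (ip_kernel ?C)" by (simp add: completion_def)
  interpret W: inner_space ?W unfolding W by (rule C.inner_space_quotient)
  have Qc: "carrier ?W = Q ` Collect MC"
    by (simp add: W q.quotient_carrier cauchy_space_simps Q_def)
  have Qadd: "\<lbrakk>MC s; MC t\<rbrakk> \<Longrightarrow> Q (\<lambda>n. s n \<oplus> t n) = Q s \<oplus>\<^bsub>?W\<^esub> Q t" for s t
    using q.quotient_add[of s t] by (simp add: W Q_def cauchy_space_simps)
  have Qsm: "MC s \<Longrightarrow> Q (\<lambda>n. c \<odot> s n) = c \<odot>\<^bsub>?W\<^esub> Q s" for c s
    using q.quotient_smult[of s c] by (simp add: W Q_def cauchy_space_simps)
  have Qip: "\<lbrakk>MC s; MC t\<rbrakk> \<Longrightarrow> ip ?W (Q s) (Q t) = lim (\<lambda>n. ip V (s n) (t n))" for s t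
    using q.quotient_ip[of s t] by (simp add: W Q_def cauchy_space_simps)
  have e: "?e x = Q (\<lambda>_. x)" for x by (simp add: completion_embed_def Q_def)
  have const: "x \<in> carrier V \<Longrightarrow> MC (\<lambda>_. x)" for x by simp
  show car: "?e x \<in> carrier ?W" if "x \<in> carrier V" for x
    unfolding e Qc using const[OF that] by blast
  show add: "?e (x \<oplus> y) = ?e x \<oplus>\<^bsub>?W\<^esub> ?e y" if "x \<in> carrier V" "y \<in> carrier V" for x y
    unfolding e using Qadd[OF const const] that by simp
  show sm: "?e (c \<odot> x) = c \<odot>\<^bsub>?W\<^esub> ?e x" if "x \<in> carrier V" for c x
    unfolding e using Qsm[OF const] that by simp
  show ip: "ip ?W (?e x) (?e y) = ip V x y" if "x \<in> carrier V" "y \<in> carrier V" for x y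
    unfolding e using Qip[OF const const] that by (simp add: limI)
  show "?e \<zero> = \<zero>\<^bsub>?W\<^esub>"
    unfolding e by (simp add: W q.quotient_zero Q_def cauchy_space_simps)
  have Qminus: "Q (\<lambda>n. s n \<ominus> t n) = Q s \<ominus>\<^bsub>?W\<^esub> Q t" if "MC s" "MC t" for s t
  proof -
    have "Q s \<in> carrier ?W" "Q t \<in> carrier ?W" using Qc that by auto
    then have "Q s \<ominus>\<^bsub>?W\<^esub> Q t = Q (\<lambda>n. s n \<oplus> (-1) \<odot> t n)"
      using that by (simp add: W.minus_scalar Qadd Qsm MC_smult)
    also have "(\<lambda>n. s n \<oplus> (-1) \<odot> t n) = (\<lambda>n. s n \<ominus> t n)"
      using that by (simp add: minus_scalar MC_closed)
    finally show ?thesis by simp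
  qed
  have Qnorm: "(\<lambda>n. vnorm V (s n)) \<longlonglongrightarrow> vnorm ?W (Q s)" if s: "MC s" for s
    unfolding vnorm_def Qip[OF s s]
    by (intro tendsto_intros MC_ip_convergent s)
  have approx: "limitin (vtop ?W) (\<lambda>n. ?e (s n)) (Q s) sequentially" if s: "MC s" for s
    unfolding W.limit_iff
  proof (intro conjI)
    show QW: "Q s \<in> carrier ?W" using Qc s by auto
    show "eventually (\<lambda>n. ?e (s n) \<in> carrier ?W) sequentially"
      by (intro always_eventually allI car MC_closed s)
    show "(\<lambda>n. vnorm ?W (?e (s n) \<ominus>\<^bsub>?W\<^esub> Q s)) \<longlonglongrightarrow> 0"
    proof (rule LIMSEQ_I)
      fix r :: real assume "r > 0"
      then have "r / 2 > 0" by simp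
      then obtain N where N: "\<And>n m. \<lbrakk>n \<ge> N; m \<ge> N\<rbrakk> \<Longrightarrow> vnorm V (s n \<ominus> s m) < r / 2"
        using s unfolding MCauchy_iff by meson
      have "norm (vnorm ?W (?e (s n) \<ominus>\<^bsub>?W\<^esub> Q s) - 0) < r" if n: "n \<ge> N" for n
      proof -
        have c: "MC (\<lambda>_. s n)" using s by (simp add: MC_closed)
        have "(\<lambda>m. s n \<ominus> s m) = (\<lambda>m. s n \<oplus> (-1) \<odot> s m)"
          using s by (simp add: minus_scalar MC_closed)
        then have "MC (\<lambda>m. s n \<ominus> s m)" using MC_add[OF c MC_smult[OF s]] by simp
        from Qnorm[OF this] have "(\<lambda>m. vnorm V (s n \<ominus> s m)) \<longlonglongrightarrow> vnorm ?W (?e (s n) \<ominus>\<^bsub>?W\<^esub> Q s)"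
          using Qminus[OF c s] by (simp add: e)
        moreover have "\<forall>m\<ge>N. vnorm V (s n \<ominus> s m) \<le> r / 2" using N n less_imp_le by blast
        ultimately have "vnorm ?W (?e (s n) \<ominus>\<^bsub>?W\<^esub> Q s) \<le> r / 2"
          by (meson LIMSEQ_le_const2)
        then show ?thesis
          using \<open>r > 0\<close> QW car[OF MC_closed[OF s]] by simp
      qed
      then show "\<exists>N. \<forall>n\<ge>N. norm (vnorm ?W (?e (s n) \<ominus>\<^bsub>?W\<^esub> Q s) - 0) < r" by blast
    qed
  qed
  show dense: "vtop ?W closure_of (?e ` carrier V) = carrier ?W"
  proof
    show "vtop ?W closure_of (?e ` carrier V) \<subseteq> carrier ?W"
      using closure_of_subset_topspace[of "vtop ?W" "?e ` carrier V"] by simp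
    show "carrier ?W \<subseteq> vtop ?W closure_of (?e ` carrier V)"
    proof
      fix X assume "X \<in> carrier ?W"
      then obtain s where s: "MC s" "X = Q s" using Qc by auto
      show "X \<in> vtop ?W closure_of (?e ` carrier V)"
        by (rule W.limit_in_closure[OF approx[OF s(1), folded s(2)]])
          (use s(1) in \<open>auto simp: MC_closed\<close>)
    qed
  qed
  have minus: "?e x \<ominus>\<^bsub>?W\<^esub> ?e y = ?e (x \<ominus> y)" if "x \<in> carrier V" "y \<in> carrier V" for x y
    using that car by (simp add: minus_scalar W.minus_scalar add sm)
  have norm: "vnorm ?W (?e x) = vnorm V x" if "x \<in> carrier V" for x
    using that by (simp add: vnorm_def ip)
  have "W.M.mcomplete"
    unfolding W.M.mcomplete_def
  proof (intro allI impI)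
    fix X assume X: "W.M.MCauchy X"
    have Xc: "X n \<in> carrier ?W" for n using X by (simp add: W.MC_closed)
    have "\<exists>x. x \<in> carrier V \<and> vnorm ?W (?e x \<ominus>\<^bsub>?W\<^esub> X n) < 1 / real (Suc n)" for n
    proof -
      have "X n \<in> vtop ?W closure_of (?e ` carrier V)" using dense Xc by simp
      then have "\<forall>r>0. \<exists>y\<in>?e ` carrier V. vnorm ?W (X n \<ominus>\<^bsub>?W\<^esub> y) < r"
        using car by (subst (asm) W.closure_iff) auto
      then have "\<exists>y\<in>?e ` carrier V. vnorm ?W (X n \<ominus>\<^bsub>?W\<^esub> y) < 1 / real (Suc n)"
        by (rule allE[of _ "1 / real (Suc n)"]) simp
      then obtain x where "x \<in> carrier V" "vnorm ?W (X n \<ominus>\<^bsub>?W\<^esub> ?e x) < 1 / real (Suc n)"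
        by blast
      then show ?thesis
        using Xc car[of x] W.vnorm_minus_commute[of "X n" "?e x"] by auto
    qed
    then obtain x where x: "\<And>n. x n \<in> carrier V"
        "\<And>n. vnorm ?W (?e (x n) \<ominus>\<^bsub>?W\<^esub> X n) < 1 / real (Suc n)" by metis
    have "MC x"
      unfolding MCauchy_iff
    proof (intro conjI allI impI x(1))
      fix r :: real assume "r > 0"
      then have r3: "r / 3 > 0" by simp
      then obtain N1 where N1: "\<And>n m. \<lbrakk>n \<ge> N1; m \<ge> N1\<rbrakk> \<Longrightarrow> vnorm ?W (X n \<ominus>\<^bsub>?W\<^esub> X m) < r / 3"
        using X unfolding W.MCauchy_iff by meson
      obtain N2 where N2: "1 / real (Suc N2) < r / 3" using nat_approx_posE[OF r3] by blast
      have "vnorm V (x n \<ominus> x m) < r" if n: "n \<ge> max N1 N2" and m: "m \<ge> max N1 N2" for n m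
      proof -
        have 1: "vnorm ?W (?e (x k) \<ominus>\<^bsub>?W\<^esub> X k) < r / 3" if "k \<ge> N2" for k
        proof -
          have "1 / real (Suc k) \<le> 1 / real (Suc N2)" using that by (simp add: frac_le)
          with x(2)[of k] N2 show ?thesis by linarith
        qed
        have "vnorm V (x n \<ominus> x m) = vnorm ?W (?e (x n) \<ominus>\<^bsub>?W\<^esub> ?e (x m))"
          using x(1) by (simp add: minus norm)
        also have "\<dots> \<le> vnorm ?W (?e (x n) \<ominus>\<^bsub>?W\<^esub> X n) + vnorm ?W (X n \<ominus>\<^bsub>?W\<^esub> ?e (x m))"
          using x(1) Xc car by (intro W.vnorm_triangle_minus) auto
        also have "vnorm ?W (X n \<ominus>\<^bsub>?W\<^esub> ?e (x m)) \<le>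
            vnorm ?W (X n \<ominus>\<^bsub>?W\<^esub> X m) + vnorm ?W (X m \<ominus>\<^bsub>?W\<^esub> ?e (x m))"
          using x(1) Xc car by (intro W.vnorm_triangle_minus) auto
        also have "vnorm ?W (X m \<ominus>\<^bsub>?W\<^esub> ?e (x m)) = vnorm ?W (?e (x m) \<ominus>\<^bsub>?W\<^esub> X m)"
          using x(1) Xc car by (intro W.vnorm_minus_commute) auto
        finally show ?thesis using 1[of n] 1[of m] N1[of n m] n m by simp
      qed
      then show "\<exists>N. \<forall>n\<ge>N. \<forall>m\<ge>N. vnorm V (x n \<ominus> x m) < r" by blast
    qed
    note lim = approx[OF this]
    have "limitin (vtop ?W) X (Q x) sequentially"
    proof (rule W.limit_le)
      show Qx: "Q x \<in> carrier ?W" using lim by (rule W.limit_carrier)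
      show "eventually (\<lambda>n. X n \<in> carrier ?W) sequentially" using Xc by simp
      have "vnorm ?W (X n \<ominus>\<^bsub>?W\<^esub> Q x) \<le> 1 / real (Suc n) + vnorm ?W (?e (x n) \<ominus>\<^bsub>?W\<^esub> Q x)" for n
        using W.vnorm_triangle_minus[of "X n" "?e (x n)" "Q x"] x(2)[of n] Qx Xc car[OF x(1)]
          W.vnorm_minus_commute[of "X n" "?e (x n)"] by simp
      then show "eventually (\<lambda>n. vnorm ?W (X n \<ominus>\<^bsub>?W\<^esub> Q x) \<le>
          1 / real (Suc n) + vnorm ?W (?e (x n) \<ominus>\<^bsub>?W\<^esub> Q x)) sequentially" by simp
      have "(\<lambda>n. 1 / real (Suc n) + vnorm ?W (?e (x n) \<ominus>\<^bsub>?W\<^esub> Q x)) \<longlonglongrightarrow> 0 + 0"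
        using lim by (intro tendsto_add LIMSEQ_Suc[OF lim_1_over_n]) (simp add: W.limit_iff)
      then show "(\<lambda>n. 1 / real (Suc n) + vnorm ?W (?e (x n) \<ominus>\<^bsub>?W\<^esub> Q x)) \<longlonglongrightarrow> 0" by simp
    qed
    then show "\<exists>x. limitin (vtop ?W) X x sequentially" by blast
  qed
  then show "hilbert ?W" by unfold_locales
qed

end


section \<open>Closed subspaces\<close>

lemma subspace_record_simps [simp]:
  "ip (V\<lparr>carrier := S\<rparr>) = ip V" "smult (V\<lparr>carrier := S\<rparr>) = smult V"
  "add (V\<lparr>carrier := S\<rparr>) = add V" "zero (V\<lparr>carrier := S\<rparr>) = zero V"
  "vnorm (V\<lparr>carrier := S\<rparr>) = vnorm V"
  by (simp_all add: vnorm_def fun_eq_iff)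

context inner_space
begin

lemma inner_space_subspace:
  assumes "submodule S complex_field V"
  shows "inner_space (V\<lparr>carrier := S\<rparr>)"
proof -
  interpret S: hermitian_space "V\<lparr>carrier := S\<rparr>"
    by (rule hermitian_space_on_submodule[OF _ assms]) unfold_locales
  show ?thesis
    using assms ip_nonneg ip_definite by unfold_locales (auto simp: submodule_iff)
qed

lemma subspace_minus:
  assumes "submodule S complex_field V" "x \<in> S" "y \<in> S"
  shows "x \<ominus>\<^bsub>V\<lparr>carrier := S\<rparr>\<^esub> y = x \<ominus> y"
proof -
  interpret S: hermitian_space "V\<lparr>carrier := S\<rparr>"
    by (rule hermitian_space_on_submodule[OF _ assms(1)]) unfold_locales
  show ?thesis
    using assms S.minus_scalar[of x y] by (auto simp: submodule_iff minus_scalar subset_iff)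
qed

lemma limit_subspace:
  assumes S: "submodule S complex_field V"
  shows "limitin (vtop (V\<lparr>carrier := S\<rparr>)) f l F \<longleftrightarrow>
    l \<in> S \<and> eventually (\<lambda>x. f x \<in> S) F \<and> limitin (vtop V) f l F"
proof -
  interpret S: inner_space "V\<lparr>carrier := S\<rparr>" by (rule inner_space_subspace[OF S])
  have sub: "x \<in> S \<Longrightarrow> x \<in> carrier V" for x using S by (auto simp: submodule_iff)
  have "((\<lambda>x. vnorm V (f x \<ominus>\<^bsub>V\<lparr>carrier := S\<rparr>\<^esub> l)) \<longlongrightarrow> 0) F \<longleftrightarrow>
      ((\<lambda>x. vnorm V (f x \<ominus> l)) \<longlongrightarrow> 0) F" if "l \<in> S" "eventually (\<lambda>x. f x \<in> S) F"
    by (rule tendsto_cong, rule eventually_mono[OF that(2)]) (simp add: subspace_minus[OF S] that)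
  then show ?thesis
    unfolding S.limit_iff limit_iff by (auto simp: sub elim: eventually_mono)
qed

lemma finsum_subspace:
  assumes S: "submodule S complex_field V" and "finite A" "\<And>i. i \<in> A \<Longrightarrow> f i \<in> S"
  shows "finsum (V\<lparr>carrier := S\<rparr>) f A = finsum V f A \<and> finsum V f A \<in> S"
proof -
  interpret S: inner_space "V\<lparr>carrier := S\<rparr>" by (rule inner_space_subspace[OF S])
  have sub: "x \<in> S \<Longrightarrow> x \<in> carrier V" for x using S by (auto simp: submodule_iff)
  show ?thesis using assms(2,3)
  proof (induction A)
    case empty then show ?case using S S.finsum_empty by (simp add: submodule_iff)
  next
    case (insert i A)
    have "f \<in> A \<rightarrow> S" "f i \<in> S" using insert by auto
    moreover from this have "f \<in> A \<rightarrow> carrier V" "f i \<in> carrier V" using sub by auto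
    ultimately show ?case
      using insert S S.finsum_insert[of A i f] by (simp add: submodule_iff)
  qed
qed

lemma closure_subspace:
  assumes S: "submodule S complex_field V" and "X \<subseteq> S"
  shows "vtop (V\<lparr>carrier := S\<rparr>) closure_of X = vtop V closure_of X \<inter> S"
proof -
  interpret S: inner_space "V\<lparr>carrier := S\<rparr>" by (rule inner_space_subspace[OF S])
  have sub: "x \<in> S \<Longrightarrow> x \<in> carrier V" for x using S by (auto simp: submodule_iff)
  show ?thesis
  proof (rule Set.set_eqI)
    fix z
    have 1: "z \<in> vtop (V\<lparr>carrier := S\<rparr>) closure_of X \<longleftrightarrow>
        z \<in> S \<and> (\<forall>r>0. \<exists>y\<in>X. vnorm V (z \<ominus>\<^bsub>V\<lparr>carrier := S\<rparr>\<^esub> y) < r)"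
      using S.closure_iff[of X z] assms(2) by simp
    have 2: "z \<in> vtop V closure_of X \<longleftrightarrow> z \<in> carrier V \<and> (\<forall>r>0. \<exists>y\<in>X. vnorm V (z \<ominus> y) < r)"
      using closure_iff[of X z] assms(2) sub by blast
    have 3: "(\<exists>y\<in>X. vnorm V (z \<ominus>\<^bsub>V\<lparr>carrier := S\<rparr>\<^esub> y) < r) \<longleftrightarrow> (\<exists>y\<in>X. vnorm V (z \<ominus> y) < r)"
      if "z \<in> S" for r
      using that assms(2) by (intro bex_cong refl) (simp add: subspace_minus[OF S] subset_iff)
    show "z \<in> vtop (V\<lparr>carrier := S\<rparr>) closure_of X \<longleftrightarrow> z \<in> vtop V closure_of X \<inter> S"
      unfolding Int_iff 1 2 using 3 sub by blast
  qed
qed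

end

lemma (in hilbert) hilbert_subspace:
  assumes S: "submodule S complex_field V" and closed: "closedin (vtop V) S"
  shows "hilbert (V\<lparr>carrier := S\<rparr>)"
proof -
  interpret S: inner_space "V\<lparr>carrier := S\<rparr>" by (rule inner_space_subspace[OF S])
  have sub: "x \<in> S \<Longrightarrow> x \<in> carrier V" for x using S by (auto simp: submodule_iff)
  have "S.M.mcomplete"
    unfolding S.M.mcomplete_def
  proof (intro allI impI)
    fix s assume s: "S.M.MCauchy s"
    then have sS: "s n \<in> S" for n using S.MC_closed by simp
    have "MC s" using s sS sub unfolding S.MCauchy_iff MCauchy_iff by (simp add: subspace_minus[OF S])
    then obtain x where x: "limitin (vtop V) s x sequentially"
      using complete unfolding M.mcomplete_def by blast
    have "x \<in> S" by (rule limit_closed_set[OF closed x]) (use sS in auto)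
    then show "\<exists>x. limitin (vtop (V\<lparr>carrier := S\<rparr>)) s x sequentially"
      using x sS by (intro exI[of _ x]) (subst limit_subspace[OF S], simp)
  qed
  then show ?thesis by unfold_locales
qed

section \<open>Unitary maps\<close>

text \<open>The linear hull of the pairs \<open>(x i, y i)\<close>: a linear relation, which is isometric when both
  families have the same Gram matrix.\<close>

inductive_set linked :: "'v ip_space \<Rightarrow> 'w ip_space \<Rightarrow> ('i \<Rightarrow> 'v) \<Rightarrow> ('i \<Rightarrow> 'w) \<Rightarrow> 'i set \<Rightarrow> ('v \<times> 'w) set"
  for V W x y I where
  base: "i \<in> I \<Longrightarrow> (x i, y i) \<in> linked V W x y I"
| zero: "(\<zero>\<^bsub>V\<^esub>, \<zero>\<^bsub>W\<^esub>) \<in> linked V W x y I"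
| add: "\<lbrakk>(u, w) \<in> linked V W x y I; (u', w') \<in> linked V W x y I\<rbrakk> \<Longrightarrow>
    (u \<oplus>\<^bsub>V\<^esub> u', w \<oplus>\<^bsub>W\<^esub> w') \<in> linked V W x y I"
| smult: "(u, w) \<in> linked V W x y I \<Longrightarrow> (c \<odot>\<^bsub>V\<^esub> u, c \<odot>\<^bsub>W\<^esub> w) \<in> linked V W x y I"

lemma linked_sym: "(u, w) \<in> linked V W x y I \<Longrightarrow> (w, u) \<in> linked W V y x I"
  by (induction rule: linked.induct) (auto intro: linked.intros)

locale gram_families = V: hilbert V + W: hilbert W
  for V :: "'v ip_space" and W :: "'w ip_space" +
  fixes x :: "'i \<Rightarrow> 'v" and y :: "'i \<Rightarrow> 'w" and I
  assumes x_closed: "i \<in> I \<Longrightarrow> x i \<in> carrier V" and y_closed: "i \<in> I \<Longrightarrow> y i \<in> carrier W"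
    and gram: "\<lbrakk>i \<in> I; j \<in> I\<rbrakk> \<Longrightarrow> ip V (x i) (x j) = ip W (y i) (y j)"
    and x_total: "vtop V closure_of (vspan V (x ` I)) = carrier V"
begin

abbreviation L where "L \<equiv> linked V W x y I"

lemma L_closed: "(u, w) \<in> L \<Longrightarrow> u \<in> carrier V \<and> w \<in> carrier W"
  by (induction rule: linked.induct) (auto simp: x_closed y_closed)

lemma L_ip_base: "(u, w) \<in> L \<Longrightarrow> i \<in> I \<Longrightarrow> ip V u (x i) = ip W w (y i)"
proof (induction rule: linked.induct)
  case (add u w u' w')
  then show ?case using L_closed x_closed[of i] y_closed[of i] by (simp add: V.ip_simps W.ip_simps)
next
  case (smult u w c)
  then show ?case using L_closed x_closed[of i] y_closed[of i] by (simp add: V.ip_simps W.ip_simps)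
qed (auto simp: gram x_closed y_closed)

lemma L_ip: "(u', w') \<in> L \<Longrightarrow> (u, w) \<in> L \<Longrightarrow> ip V u u' = ip W w w'"
proof (induction rule: linked.induct)
  case (add u1 w1 u2 w2)
  then show ?case using L_closed[of u1 w1] L_closed[of u2 w2] L_closed[of u w]
    by (simp add: V.ip_simps W.ip_simps)
next
  case (smult u1 w1 c)
  then show ?case using L_closed[of u1 w1] L_closed[of u w] by (simp add: V.ip_simps W.ip_simps)
qed (auto simp: L_ip_base dest: L_closed)

lemma L_minus: "(u', w') \<in> L \<Longrightarrow> (u, w) \<in> L \<Longrightarrow> (u \<ominus>\<^bsub>V\<^esub> u', w \<ominus>\<^bsub>W\<^esub> w') \<in> L"
  using L_closed[of u w] L_closed[of u' w'] linked.add linked.smult[of u' w' V W x y I "-1"]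
  by (simp add: V.minus_scalar W.minus_scalar)

lemma L_norm: "(u, w) \<in> L \<Longrightarrow> vnorm V u = vnorm W w"
  using L_ip[of u w u w] by (simp add: vnorm_def)

lemma L_dom: assumes "u \<in> vspan V (x ` I)" shows "\<exists>w. (u, w) \<in> L"
proof -
  have "x ` I \<subseteq> carrier V" using x_closed by blast
  from assms this show ?thesis
  proof (induction rule: V.vspan_induct)
    case (base u)
    then obtain i where i: "u = x i" "i \<in> I" by blast
    show ?case unfolding i(1) by (rule exI, rule linked.base, rule i(2))
  next
    case zero
    show ?case by (rule exI, rule linked.zero)
  next
    case (add u v)
    from add(3,4) show ?case by (elim exE) (rule exI, rule linked.add)
  next
    case (smult c u)
    from smult(2) show ?case by (elim exE) (rule exI, rule linked.smult)
  qed
qed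

text \<open>The closure of the linear relation \<open>L\<close>; it is the graph of an isometric map.\<close>

definition R :: "'v \<Rightarrow> 'w \<Rightarrow> bool" where
  "R u w \<longleftrightarrow> (\<exists>s t. (\<forall>n::nat. (s n, t n) \<in> L) \<and> limitin (vtop V) s u sequentially \<and>
    limitin (vtop W) t w sequentially)"

lemma R_closed: "R u w \<Longrightarrow> u \<in> carrier V \<and> w \<in> carrier W"
  by (auto simp: R_def dest: V.limit_carrier W.limit_carrier)

lemma R_of_L: "(u, w) \<in> L \<Longrightarrow> R u w"
  unfolding R_def using L_closed[of u w] by (intro exI[of _ "\<lambda>_. u"] exI[of _ "\<lambda>_. w"]) simp

text \<open>A sequence of combinations of the \<open>x i\<close> that converges to \<open>u\<close> is Cauchy, hence so is the linked
  sequence in \<open>W\<close>, which converges because \<open>W\<close> is complete.\<close>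

lemma R_total:
  assumes u: "u \<in> carrier V" shows "\<exists>w. R u w"
proof -
  have "x ` I \<subseteq> carrier V" using x_closed by blast
  from V.vspan_carrier[OF this] obtain s where s: "\<And>n. s n \<in> vspan V (x ` I)"
      "limitin (vtop V) s u sequentially"
    using V.closure_sequence[of u "vspan V (x ` I)"] u x_total by auto
  then have "\<forall>n. \<exists>w. (s n, w) \<in> L" using L_dom by blast
  then obtain t where t: "\<And>n. (s n, t n) \<in> L" by metis
  have "range s \<subseteq> carrier V" using t L_closed by blast
  then have "V.M.MCauchy s" using s(2) V.M.convergent_imp_MCauchy by blast
  moreover have "vnorm V (s n \<ominus>\<^bsub>V\<^esub> s m) = vnorm W (t n \<ominus>\<^bsub>W\<^esub> t m)" for n m
    by (intro L_norm L_minus t)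
  ultimately have "W.M.MCauchy t"
    using t L_closed unfolding V.MCauchy_iff W.MCauchy_iff by metis
  then obtain w where "limitin (vtop W) t w sequentially"
    using W.complete unfolding W.M.mcomplete_def by blast
  then show ?thesis using s(2) t unfolding R_def by blast
qed

lemma R_ip:
  assumes "R u w" "R u' w'" shows "ip V u u' = ip W w w'"
proof -
  obtain s t s' t' where st: "\<And>n::nat. (s n, t n) \<in> L" "limitin (vtop V) s u sequentially"
      "limitin (vtop W) t w sequentially" "\<And>n::nat. (s' n, t' n) \<in> L"
      "limitin (vtop V) s' u' sequentially" "limitin (vtop W) t' w' sequentially"
    using assms unfolding R_def by blast
  have "(\<lambda>n. ip V (s n) (s' n)) \<longlonglongrightarrow> ip V u u'" by (intro V.limit_ip st)
  moreover have "(\<lambda>n. ip V (s n) (s' n)) = (\<lambda>n. ip W (t n) (t' n))"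
    using L_ip[OF st(4) st(1)] by blast
  ultimately have "(\<lambda>n. ip W (t n) (t' n)) \<longlonglongrightarrow> ip V u u'" by simp
  moreover have "(\<lambda>n. ip W (t n) (t' n)) \<longlonglongrightarrow> ip W w w'" by (intro W.limit_ip st)
  ultimately show ?thesis by (rule LIMSEQ_unique)
qed

lemma R_unique: assumes "R u w" "R u w'" shows "w = w'"
proof -
  have w: "w \<in> carrier W" "w' \<in> carrier W" using assms R_closed by auto
  have "ip W (w \<ominus>\<^bsub>W\<^esub> w') (w \<ominus>\<^bsub>W\<^esub> w') = 0"
    using w R_ip[OF assms(1) assms(1)] R_ip[OF assms(1) assms(2)] R_ip[OF assms(2) assms(1)]
      R_ip[OF assms(2) assms(2)] by (simp add: W.ip_simps)
  then show ?thesis using w W.ip_definite W.minus_eq_zero by simp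
qed

lemma R_add: assumes "R u w" "R u' w'" shows "R (u \<oplus>\<^bsub>V\<^esub> u') (w \<oplus>\<^bsub>W\<^esub> w')"
proof -
  obtain s t s' t' where st: "\<And>n::nat. (s n, t n) \<in> L" "limitin (vtop V) s u sequentially"
      "limitin (vtop W) t w sequentially" "\<And>n::nat. (s' n, t' n) \<in> L"
      "limitin (vtop V) s' u' sequentially" "limitin (vtop W) t' w' sequentially"
    using assms unfolding R_def by blast
  show ?thesis unfolding R_def
    by (intro exI[of _ "\<lambda>n. s n \<oplus>\<^bsub>V\<^esub> s' n"] exI[of _ "\<lambda>n. t n \<oplus>\<^bsub>W\<^esub> t' n"] conjI allI
        linked.add V.limit_add W.limit_add st)
qed

lemma R_smult: assumes "R u w" shows "R (c \<odot>\<^bsub>V\<^esub> u) (c \<odot>\<^bsub>W\<^esub> w)"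
proof -
  obtain s t where st: "\<And>n::nat. (s n, t n) \<in> L" "limitin (vtop V) s u sequentially"
      "limitin (vtop W) t w sequentially"
    using assms unfolding R_def by blast
  show ?thesis unfolding R_def
    by (intro exI[of _ "\<lambda>n. c \<odot>\<^bsub>V\<^esub> s n"] exI[of _ "\<lambda>n. c \<odot>\<^bsub>W\<^esub> t n"] conjI allI
        linked.smult V.limit_smult W.limit_smult st)
qed

end

text \<open>The closed linear relation spanned by the pairs \<open>(x i, y i)\<close> preserves inner products, so it is
  single-valued, and it is everywhere defined because the \<open>x i\<close> are total. Both properties hold for
  its converse by symmetry.\<close>

theorem unitary_of_gram:
  fixes x :: "'i \<Rightarrow> 'v" and y :: "'i \<Rightarrow> 'w"
  assumes V: "hilbert V" and W: "hilbert W"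
    and x: "\<And>i. i \<in> I \<Longrightarrow> x i \<in> carrier V" and y: "\<And>i. i \<in> I \<Longrightarrow> y i \<in> carrier W"
    and gram: "\<And>i j. \<lbrakk>i \<in> I; j \<in> I\<rbrakk> \<Longrightarrow> ip V (x i) (x j) = ip W (y i) (y j)"
    and xt: "vtop V closure_of (vspan V (x ` I)) = carrier V"
    and yt: "vtop W closure_of (vspan W (y ` I)) = carrier W"
  shows "\<exists>U. unitary V W U \<and> (\<forall>i\<in>I. U (x i) = y i)"
proof -
  interpret V: hilbert V by fact
  interpret W: hilbert W by fact
  interpret g: gram_families V W x y I by unfold_locales (use x y gram xt in auto)
  interpret h: gram_families W V y x I by unfold_locales (use x y gram yt in auto)
  have sym: "h.R w u \<longleftrightarrow> g.R u w" for u w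
    unfolding h.R_def g.R_def using linked_sym by metis
  define U where "U u = (THE w. g.R u w)" for u
  have U: "g.R u (U u)" if u: "u \<in> carrier V" for u
  proof -
    obtain w where w: "g.R u w" using g.R_total[OF u] by blast
    show ?thesis unfolding U_def by (rule theI[of _ w]) (use w g.R_unique in blast)+
  qed
  have Ueq: "U u = w" if "g.R u w" for u w
    using that U[of u] g.R_unique g.R_closed by blast
  have "linear_map V (carrier V) W U"
    unfolding linear_map_def
  proof (intro conjI ballI allI)
    fix u assume u: "u \<in> carrier V"
    show "U u \<in> carrier W" using g.R_closed[OF U[OF u]] by simp
    show "U (c \<odot>\<^bsub>V\<^esub> u) = c \<odot>\<^bsub>W\<^esub> U u" for c by (rule Ueq[OF g.R_smult[OF U[OF u]]])
    fix v assume v: "v \<in> carrier V"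
    show "U (u \<oplus>\<^bsub>V\<^esub> v) = U u \<oplus>\<^bsub>W\<^esub> U v" by (rule Ueq[OF g.R_add[OF U[OF u] U[OF v]]])
  qed
  moreover have ip: "ip W (U u) (U v) = ip V u v" if "u \<in> carrier V" "v \<in> carrier V" for u v
    using g.R_ip[OF U U] that by simp
  moreover have "bij_betw U (carrier V) (carrier W)"
    unfolding bij_betw_def
  proof
    show "inj_on U (carrier V)"
    proof (rule inj_onI)
      fix u v assume "u \<in> carrier V" "v \<in> carrier V" "U u = U v"
      then have "g.R u (U u)" "g.R v (U u)" using U[of u] U[of v] by simp_all
      then show "u = v" using h.R_unique[of "U u" u v] by (simp only: sym)
    qed
    show "U ` carrier V = carrier W"
    proof
      show "U ` carrier V \<subseteq> carrier W" using g.R_closed[OF U] by (intro image_subsetI) simp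
      show "carrier W \<subseteq> U ` carrier V"
      proof
        fix w assume "w \<in> carrier W"
        then obtain u where "h.R w u" using h.R_total by blast
        then have u: "g.R u w" by (simp only: sym)
        have "u \<in> carrier V" "U u = w" using g.R_closed[OF u] Ueq[OF u] by simp_all
        then show "w \<in> U ` carrier V" by blast
      qed
    qed
  qed
  moreover have "U (x i) = y i" if "i \<in> I" for i
    by (intro Ueq g.R_of_L linked.base that)
  ultimately show ?thesis unfolding unitary_def by blast
qed

locale unitary_map = V: inner_space V + W: inner_space W
  for V :: "'v ip_space" and W :: "'w ip_space" +
  fixes U
  assumes unitary: "unitary V W U"
begin

lemma closed [simp]: "x \<in> carrier V \<Longrightarrow> U x \<in> carrier W"
  and add: "\<lbrakk>x \<in> carrier V; y \<in> carrier V\<rbrakk> \<Longrightarrow> U (x \<oplus>\<^bsub>V\<^esub> y) = U x \<oplus>\<^bsub>W\<^esub> U y"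
  and smult: "x \<in> carrier V \<Longrightarrow> U (c \<odot>\<^bsub>V\<^esub> x) = c \<odot>\<^bsub>W\<^esub> U x"
  and ip: "\<lbrakk>x \<in> carrier V; y \<in> carrier V\<rbrakk> \<Longrightarrow> ip W (U x) (U y) = ip V x y"
  and bij: "bij_betw U (carrier V) (carrier W)"
  using unitary unfolding unitary_def linear_map_def by blast+

lemma inj: "\<lbrakk>x \<in> carrier V; y \<in> carrier V; U x = U y\<rbrakk> \<Longrightarrow> x = y"
  using bij by (meson bij_betw_def inj_onD)

lemma surj: "y \<in> carrier W \<Longrightarrow> \<exists>x\<in>carrier V. U x = y"
  using bij by (metis bij_betw_def imageE)

lemma norm: "x \<in> carrier V \<Longrightarrow> vnorm W (U x) = vnorm V x"
  by (simp add: vnorm_def ip)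

lemma minus: "\<lbrakk>x \<in> carrier V; y \<in> carrier V\<rbrakk> \<Longrightarrow> U (x \<ominus>\<^bsub>V\<^esub> y) = U x \<ominus>\<^bsub>W\<^esub> U y"
  by (simp add: V.minus_scalar W.minus_scalar add smult)

lemma zero: "U \<zero>\<^bsub>V\<^esub> = \<zero>\<^bsub>W\<^esub>"
  using smult[of "\<zero>\<^bsub>V\<^esub>" 0] by simp

lemma limit_iff:
  assumes "l \<in> carrier V" "eventually (\<lambda>x. f x \<in> carrier V) F"
  shows "limitin (vtop W) (\<lambda>x. U (f x)) (U l) F \<longleftrightarrow> limitin (vtop V) f l F"
proof -
  have "((\<lambda>x. vnorm W (U (f x) \<ominus>\<^bsub>W\<^esub> U l)) \<longlongrightarrow> 0) F \<longleftrightarrow> ((\<lambda>x. vnorm V (f x \<ominus>\<^bsub>V\<^esub> l)) \<longlongrightarrow> 0) F"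
    by (rule tendsto_cong, rule eventually_mono[OF assms(2)])
      (simp add: assms(1) norm flip: minus)
  moreover have "eventually (\<lambda>x. U (f x) \<in> carrier W) F"
    by (rule eventually_mono[OF assms(2)]) simp
  ultimately show ?thesis unfolding V.limit_iff W.limit_iff using assms by auto
qed

lemma limit: "limitin (vtop V) f l F \<Longrightarrow> limitin (vtop W) (\<lambda>x. U (f x)) (U l) F"
  using limit_iff[of l f F] by (simp add: V.limit_iff)

lemma inverse:
  obtains U' where "unitary W V U'" "\<And>x. x \<in> carrier V \<Longrightarrow> U' (U x) = x"
    "\<And>y. y \<in> carrier W \<Longrightarrow> U (U' y) = y"
proof -
  define U' where "U' = inv_into (carrier V) U"
  have 1: "U' (U x) = x" if "x \<in> carrier V" for x
    using bij that unfolding U'_def by (meson bij_betw_def inv_into_f_f)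
  have 2: "U (U' y) = y" "U' y \<in> carrier V" if "y \<in> carrier W" for y
    using surj[OF that] 1 by auto
  have "linear_map W (carrier W) V U'"
    unfolding linear_map_def
  proof (intro conjI ballI allI)
    fix x assume x: "x \<in> carrier W"
    then show "U' x \<in> carrier V" by (rule 2)
    show "U' (c \<odot>\<^bsub>W\<^esub> x) = c \<odot>\<^bsub>V\<^esub> U' x" for c
      using x by (intro inj) (simp_all add: 2 smult)
    fix y assume y: "y \<in> carrier W"
    show "U' (x \<oplus>\<^bsub>W\<^esub> y) = U' x \<oplus>\<^bsub>V\<^esub> U' y"
      using x y by (intro inj) (simp_all add: 2 add)
  qed
  moreover have "bij_betw U' (carrier W) (carrier V)"
    unfolding U'_def using bij by (rule bij_betw_inv_into)
  moreover have "ip V (U' x) (U' y) = ip W x y" if "x \<in> carrier W" "y \<in> carrier W" for x y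
    using ip[of "U' x" "U' y"] that by (simp add: 2)
  ultimately have "unitary W V U'" unfolding unitary_def by blast
  then show ?thesis using that 1 2 by blast
qed

end


section \<open>Graph topologies and closures of representations\<close>

text \<open>The part of the structure of a representation on which graph norms depend. It applies also to
  restrictions to subalgebras and to the operators on algebraic tensors.\<close>

locale operator_family = V: inner_space "rep_space \<pi>"
  for \<pi> :: "('a, 'v) rep" +
  assumes dom: "submodule (rep_dom \<pi>) complex_field (rep_space \<pi>)"
    and op: "a \<in> rep_alg \<pi> \<Longrightarrow> linear_map (rep_space \<pi>) (rep_dom \<pi>) (rep_space \<pi>) (rep_op \<pi> a)"
begin

abbreviation "V \<equiv> rep_space \<pi>"
abbreviation "D \<equiv> rep_dom \<pi>"
abbreviation "gn \<equiv> graph_norm \<pi>"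

lemma D_closed [simp]: "x \<in> D \<Longrightarrow> x \<in> carrier V"
  and D_zero [simp]: "\<zero>\<^bsub>V\<^esub> \<in> D"
  and D_add [simp]: "\<lbrakk>x \<in> D; y \<in> D\<rbrakk> \<Longrightarrow> x \<oplus>\<^bsub>V\<^esub> y \<in> D"
  and D_smult [simp]: "x \<in> D \<Longrightarrow> c \<odot>\<^bsub>V\<^esub> x \<in> D"
  using dom by (auto simp: V.submodule_iff)

lemma D_minus [simp]: "\<lbrakk>x \<in> D; y \<in> D\<rbrakk> \<Longrightarrow> x \<ominus>\<^bsub>V\<^esub> y \<in> D"
  by (simp add: V.minus_scalar)

lemma op_closed [simp]: "\<lbrakk>a \<in> rep_alg \<pi>; x \<in> D\<rbrakk> \<Longrightarrow> rep_op \<pi> a x \<in> carrier V"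
  and op_add: "\<lbrakk>a \<in> rep_alg \<pi>; x \<in> D; y \<in> D\<rbrakk> \<Longrightarrow>
    rep_op \<pi> a (x \<oplus>\<^bsub>V\<^esub> y) = rep_op \<pi> a x \<oplus>\<^bsub>V\<^esub> rep_op \<pi> a y"
  and op_smult: "\<lbrakk>a \<in> rep_alg \<pi>; x \<in> D\<rbrakk> \<Longrightarrow> rep_op \<pi> a (c \<odot>\<^bsub>V\<^esub> x) = c \<odot>\<^bsub>V\<^esub> rep_op \<pi> a x"
  using op[of a] by (auto simp: linear_map_def)

lemma op_minus: "\<lbrakk>a \<in> rep_alg \<pi>; x \<in> D; y \<in> D\<rbrakk> \<Longrightarrow>
    rep_op \<pi> a (x \<ominus>\<^bsub>V\<^esub> y) = rep_op \<pi> a x \<ominus>\<^bsub>V\<^esub> rep_op \<pi> a y"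
  by (simp add: V.minus_scalar op_add op_smult)

lemma op_zero: "a \<in> rep_alg \<pi> \<Longrightarrow> rep_op \<pi> a \<zero>\<^bsub>V\<^esub> = \<zero>\<^bsub>V\<^esub>"
  using op_smult[of a "\<zero>\<^bsub>V\<^esub>" 0] by simp

lemma gn_eq: "\<lbrakk>a \<in> rep_alg \<pi>; x \<in> D; y \<in> D\<rbrakk> \<Longrightarrow>
    gn a (x \<ominus>\<^bsub>V\<^esub> y) = vnorm V (x \<ominus>\<^bsub>V\<^esub> y) + vnorm V (rep_op \<pi> a x \<ominus>\<^bsub>V\<^esub> rep_op \<pi> a y)"
  by (simp add: graph_norm_def op_minus)

lemma gn_triangle: "\<lbrakk>a \<in> rep_alg \<pi>; x \<in> D; y \<in> D; z \<in> D\<rbrakk> \<Longrightarrow>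
    gn a (x \<ominus>\<^bsub>V\<^esub> z) \<le> gn a (x \<ominus>\<^bsub>V\<^esub> y) + gn a (y \<ominus>\<^bsub>V\<^esub> z)"
  using V.vnorm_triangle_minus[of x y z] V.vnorm_triangle_minus[of "rep_op \<pi> a x" "rep_op \<pi> a y" "rep_op \<pi> a z"]
  by (simp add: gn_eq)

lemma gn_commute: "\<lbrakk>a \<in> rep_alg \<pi>; x \<in> D; y \<in> D\<rbrakk> \<Longrightarrow> gn a (x \<ominus>\<^bsub>V\<^esub> y) = gn a (y \<ominus>\<^bsub>V\<^esub> x)"
  using V.vnorm_minus_commute[of x y] V.vnorm_minus_commute[of "rep_op \<pi> a x" "rep_op \<pi> a y"]
  by (simp add: gn_eq)

lemma gn_self: "\<lbrakk>a \<in> rep_alg \<pi>; x \<in> D\<rbrakk> \<Longrightarrow> gn a (x \<ominus>\<^bsub>V\<^esub> x) = 0"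
  using gn_eq[of a x x] V.minus_zero_iff[of x x] V.minus_zero_iff[of "rep_op \<pi> a x" "rep_op \<pi> a x"]
  by simp

lemma gn_ge_norm: "\<lbrakk>a \<in> rep_alg \<pi>; x \<in> D; y \<in> D\<rbrakk> \<Longrightarrow> vnorm V (x \<ominus>\<^bsub>V\<^esub> y) \<le> gn a (x \<ominus>\<^bsub>V\<^esub> y)"
  by (simp add: gn_eq)

lemma openin_graph_ball: "\<lbrakk>a \<in> rep_alg \<pi>; x \<in> D; \<epsilon> > 0\<rbrakk> \<Longrightarrow>
    openin (graph_topology \<pi>) {y \<in> D. gn a (y \<ominus>\<^bsub>V\<^esub> x) < \<epsilon>}"
  unfolding graph_topology_def by (rule topology_generated_by_Basis) blast

text \<open>By the triangle inequality, a subbasic set that contains \<open>x\<close> contains a ball around \<open>x\<close> for the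
  same graph norm.\<close>

lemma limit_graph_iff:
  assumes ne: "rep_alg \<pi> \<noteq> {}"
  shows "limitin (graph_topology \<pi>) f x F \<longleftrightarrow> x \<in> D \<and> eventually (\<lambda>i. f i \<in> D) F \<and>
    (\<forall>a\<in>rep_alg \<pi>. \<forall>\<epsilon>>0. eventually (\<lambda>i. gn a (f i \<ominus>\<^bsub>V\<^esub> x) < \<epsilon>) F)" (is "?L \<longleftrightarrow> ?R")
proof
  assume l: ?L
  have "topspace (graph_topology \<pi>) \<subseteq> D"
    unfolding graph_topology_def topology_generated_by_topspace by blast
  then have x: "x \<in> D" using limitin_topspace[OF l] by blast
  have ev: "eventually (\<lambda>i. f i \<in> {y \<in> D. gn a (y \<ominus>\<^bsub>V\<^esub> x) < \<epsilon>}) F"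
    if "a \<in> rep_alg \<pi>" "\<epsilon> > 0" for a \<epsilon>
    by (rule limitinD[OF l openin_graph_ball]) (use that x in \<open>auto simp: gn_self\<close>)
  obtain a where a: "a \<in> rep_alg \<pi>" using ne by blast
  show ?R
  proof (intro conjI ballI allI impI x)
    show "eventually (\<lambda>i. f i \<in> D) F"
      by (rule eventually_mono[OF ev[OF a zero_less_one]]) simp
    show "eventually (\<lambda>i. gn b (f i \<ominus>\<^bsub>V\<^esub> x) < \<epsilon>) F" if "b \<in> rep_alg \<pi>" "\<epsilon> > 0" for b \<epsilon>
      by (rule eventually_mono[OF ev[OF that]]) simp
  qed
next
  assume r: ?R
  have ev: "eventually (\<lambda>i. f i \<in> S) F" if "generate_topology_on
      {{y \<in> D. gn a (y \<ominus>\<^bsub>V\<^esub> x) < \<epsilon>} | a x \<epsilon>. a \<in> rep_alg \<pi> \<and> x \<in> D \<and> \<epsilon> > 0} S" "x \<in> S" for S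
    using that
  proof (induction rule: generate_topology_on.induct)
    case (Int A B)
    then show ?case by (simp add: eventually_conj)
  next
    case (UN K)
    then obtain k where "k \<in> K" "x \<in> k" by blast
    with UN.IH[of k] have "eventually (\<lambda>i. f i \<in> k) F" by blast
    then show ?case by (rule eventually_mono) (use \<open>k \<in> K\<close> in blast)
  next
    case (Basis s)
    then obtain a z \<epsilon> where s: "s = {y \<in> D. gn a (y \<ominus>\<^bsub>V\<^esub> z) < \<epsilon>}" "a \<in> rep_alg \<pi>" "z \<in> D" by blast
    then have "\<epsilon> - gn a (x \<ominus>\<^bsub>V\<^esub> z) > 0" using Basis by simp
    then have "eventually (\<lambda>i. gn a (f i \<ominus>\<^bsub>V\<^esub> x) < \<epsilon> - gn a (x \<ominus>\<^bsub>V\<^esub> z)) F" using r s by blast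
    moreover have "eventually (\<lambda>i. f i \<in> D) F" using r by blast
    ultimately show ?case
    proof eventually_elim
      case (elim i)
      then show ?case using s r gn_triangle[of a "f i" x z] by simp
    qed
  qed simp
  have top: "topspace (graph_topology \<pi>) = D"
  proof
    show "topspace (graph_topology \<pi>) \<subseteq> D"
      unfolding graph_topology_def topology_generated_by_topspace by blast
    show "D \<subseteq> topspace (graph_topology \<pi>)"
    proof
      fix z assume z: "z \<in> D"
      obtain a where a: "a \<in> rep_alg \<pi>" using ne by blast
      have "z \<in> {y \<in> D. gn a (y \<ominus>\<^bsub>V\<^esub> z) < 1}" using a z by (simp add: gn_self)
      with openin_graph_ball[OF a z zero_less_one] show "z \<in> topspace (graph_topology \<pi>)"
        using openin_subset by blast
    qed
  qed
  show ?L
    unfolding limitin_def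
  proof (intro conjI allI impI)
    show "x \<in> topspace (graph_topology \<pi>)" using r top by simp
    fix S assume "openin (graph_topology \<pi>) S \<and> x \<in> S"
    then show "eventually (\<lambda>i. f i \<in> S) F"
      using ev unfolding graph_topology_def openin_topology_generated_by_iff by blast
  qed
qed

lemma limit_graph_imp_limit:
  assumes "rep_alg \<pi> \<noteq> {}" "limitin (graph_topology \<pi>) f x F"
  shows "limitin (vtop V) f x F"
proof -
  obtain a where a: "a \<in> rep_alg \<pi>" using assms by blast
  have x: "x \<in> D" and f: "eventually (\<lambda>i. f i \<in> D) F"
    and gn: "\<And>\<epsilon>. \<epsilon> > 0 \<Longrightarrow> eventually (\<lambda>i. gn a (f i \<ominus>\<^bsub>V\<^esub> x) < \<epsilon>) F"
    using assms a by (auto simp: limit_graph_iff)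
  show ?thesis
    unfolding V.M.limitin_metric
  proof (intro conjI allI impI)
    show "x \<in> carrier V" using x by simp
    fix \<epsilon> :: real assume "\<epsilon> > 0"
    from gn[OF this] f show "eventually (\<lambda>i. f i \<in> carrier V \<and> vdist V (f i) x < \<epsilon>) F"
      by eventually_elim (use a x gn_ge_norm[OF a _ x] in fastforce)
  qed
qed

text \<open>For \<open>K \<subseteq> D\<close> and \<open>x \<in> D\<close> this is membership of \<open>x\<close> in the closure of \<open>K\<close> in the graph topology,
  whose basic neighbourhoods are given by finitely many graph norms.\<close>

definition approx :: "'v set \<Rightarrow> 'v \<Rightarrow> bool" where
  "approx K x \<longleftrightarrow> (\<forall>A \<epsilon>. finite A \<and> A \<subseteq> rep_alg \<pi> \<and> \<epsilon> > 0 \<longrightarrow>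
    (\<exists>y\<in>K. \<forall>a\<in>A. gn a (y \<ominus>\<^bsub>V\<^esub> x) < \<epsilon>))"

lemma approxD: "\<lbrakk>approx K x; finite A; A \<subseteq> rep_alg \<pi>; \<epsilon> > 0\<rbrakk> \<Longrightarrow> \<exists>y\<in>K. \<forall>a\<in>A. gn a (y \<ominus>\<^bsub>V\<^esub> x) < \<epsilon>"
  unfolding approx_def by blast

lemma approx_of_closure:
  assumes ne: "rep_alg \<pi> \<noteq> {}" and x: "x \<in> graph_topology \<pi> closure_of K" "x \<in> D"
  shows "approx K x"
  unfolding approx_def
proof (intro allI impI)
  fix A and \<epsilon> :: real assume A: "finite A \<and> A \<subseteq> rep_alg \<pi> \<and> \<epsilon> > 0"
  obtain a where a: "a \<in> rep_alg \<pi>" using ne by blast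
  let ?B = "\<Inter>b\<in>insert a A. {y \<in> D. gn b (y \<ominus>\<^bsub>V\<^esub> x) < \<epsilon>}"
  have "openin (graph_topology \<pi>) ?B"
    using A a x(2) by (intro openin_Inter) (auto intro: openin_graph_ball)
  moreover have "x \<in> ?B" using A a x(2) by (auto simp: gn_self)
  ultimately obtain y where "y \<in> K" "y \<in> ?B" using x(1) unfolding in_closure_of by blast
  then show "\<exists>y\<in>K. \<forall>a\<in>A. gn a (y \<ominus>\<^bsub>V\<^esub> x) < \<epsilon>" by auto
qed

lemma approx_add:
  assumes K: "submodule K complex_field V" "K \<subseteq> D" and x: "approx K x" "x \<in> D" and y: "approx K y" "y \<in> D"
  shows "approx K (x \<oplus>\<^bsub>V\<^esub> y)"
  unfolding approx_def
proof (intro allI impI)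
  fix A and \<epsilon> :: real assume A: "finite A \<and> A \<subseteq> rep_alg \<pi> \<and> \<epsilon> > 0"
  then obtain u v where uv: "u \<in> K" "\<And>a. a \<in> A \<Longrightarrow> gn a (u \<ominus>\<^bsub>V\<^esub> x) < \<epsilon> / 2"
      "v \<in> K" "\<And>a. a \<in> A \<Longrightarrow> gn a (v \<ominus>\<^bsub>V\<^esub> y) < \<epsilon> / 2"
    using approxD[OF x(1), of A "\<epsilon> / 2"] approxD[OF y(1), of A "\<epsilon> / 2"] by auto
  have D: "u \<in> D" "v \<in> D" using uv K by auto
  have "gn a ((u \<oplus>\<^bsub>V\<^esub> v) \<ominus>\<^bsub>V\<^esub> (x \<oplus>\<^bsub>V\<^esub> y)) < \<epsilon>" if a: "a \<in> A" for a
  proof -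
    have aa: "a \<in> rep_alg \<pi>" using A a by blast
    have "gn a ((u \<oplus>\<^bsub>V\<^esub> v) \<ominus>\<^bsub>V\<^esub> (x \<oplus>\<^bsub>V\<^esub> y)) = vnorm V ((u \<oplus>\<^bsub>V\<^esub> v) \<ominus>\<^bsub>V\<^esub> (x \<oplus>\<^bsub>V\<^esub> y)) +
        vnorm V (rep_op \<pi> a (u \<oplus>\<^bsub>V\<^esub> v) \<ominus>\<^bsub>V\<^esub> rep_op \<pi> a (x \<oplus>\<^bsub>V\<^esub> y))"
      by (rule gn_eq) (use aa D x(2) y(2) in auto)
    also have "\<dots> \<le> gn a (u \<ominus>\<^bsub>V\<^esub> x) + gn a (v \<ominus>\<^bsub>V\<^esub> y)"
      using aa D x(2) y(2) V.vnorm_triangle[of "u \<ominus>\<^bsub>V\<^esub> x" "v \<ominus>\<^bsub>V\<^esub> y"]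
        V.vnorm_triangle[of "rep_op \<pi> a u \<ominus>\<^bsub>V\<^esub> rep_op \<pi> a x" "rep_op \<pi> a v \<ominus>\<^bsub>V\<^esub> rep_op \<pi> a y"]
      by (simp add: gn_eq op_add V.add_minus_add)
    finally show ?thesis using uv(2)[OF a] uv(4)[OF a] by simp
  qed
  moreover have "u \<oplus>\<^bsub>V\<^esub> v \<in> K" using uv K(1) by (simp add: V.submodule_iff)
  ultimately show "\<exists>z\<in>K. \<forall>a\<in>A. gn a (z \<ominus>\<^bsub>V\<^esub> (x \<oplus>\<^bsub>V\<^esub> y)) < \<epsilon>" by blast
qed

lemma approx_zero: assumes "submodule K complex_field V" shows "approx K \<zero>\<^bsub>V\<^esub>"
  unfolding approx_def
proof (intro allI impI bexI)
  fix A and \<epsilon> :: real assume A: "finite A \<and> A \<subseteq> rep_alg \<pi> \<and> \<epsilon> > 0"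
  then show "\<forall>a\<in>A. gn a (\<zero>\<^bsub>V\<^esub> \<ominus>\<^bsub>V\<^esub> \<zero>\<^bsub>V\<^esub>) < \<epsilon>" by (auto simp: gn_self)
qed (use assms in \<open>simp add: V.submodule_iff\<close>)

lemma approx_trans:
  assumes K: "K \<subseteq> D" and M: "M \<subseteq> D" and x: "approx M x" "x \<in> D" and MK: "\<And>y. y \<in> M \<Longrightarrow> approx K y"
  shows "approx K x"
  unfolding approx_def
proof (intro allI impI)
  fix A and \<epsilon> :: real assume A: "finite A \<and> A \<subseteq> rep_alg \<pi> \<and> \<epsilon> > 0"
  then obtain y where y: "y \<in> M" "\<And>a. a \<in> A \<Longrightarrow> gn a (y \<ominus>\<^bsub>V\<^esub> x) < \<epsilon> / 2"
    using approxD[OF x(1), of A "\<epsilon> / 2"] by auto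
  obtain z where z: "z \<in> K" "\<And>a. a \<in> A \<Longrightarrow> gn a (z \<ominus>\<^bsub>V\<^esub> y) < \<epsilon> / 2"
    using A approxD[OF MK[OF y(1)], of A "\<epsilon> / 2"] by auto
  have "gn a (z \<ominus>\<^bsub>V\<^esub> x) < \<epsilon>" if a: "a \<in> A" for a
  proof -
    have "gn a (z \<ominus>\<^bsub>V\<^esub> x) \<le> gn a (z \<ominus>\<^bsub>V\<^esub> y) + gn a (y \<ominus>\<^bsub>V\<^esub> x)"
      using A a y(1) z(1) K M x(2) by (intro gn_triangle) auto
    then show ?thesis using y(2)[OF a] z(2)[OF a] by simp
  qed
  with z(1) show "\<exists>z\<in>K. \<forall>a\<in>A. gn a (z \<ominus>\<^bsub>V\<^esub> x) < \<epsilon>" by blast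
qed

lemma graph_cauchy_of_limit:
  assumes F: "F \<noteq> bot" and x: "x \<in> D" and f: "eventually (\<lambda>y. y \<in> D) F"
    and lim: "\<And>a \<epsilon>. \<lbrakk>a \<in> rep_alg \<pi>; \<epsilon> > 0\<rbrakk> \<Longrightarrow> eventually (\<lambda>y. gn a (y \<ominus>\<^bsub>V\<^esub> x) < \<epsilon>) F"
  shows "graph_cauchy \<pi> F"
  unfolding graph_cauchy_def
proof (intro conjI F f ballI allI impI)
  fix a and \<epsilon> :: real assume a: "a \<in> rep_alg \<pi>" and "\<epsilon> > 0"
  then have "eventually (\<lambda>y. gn a (y \<ominus>\<^bsub>V\<^esub> x) < \<epsilon> / 2) F" by (intro lim) auto
  with f have "eventually (\<lambda>y. y \<in> D \<and> gn a (y \<ominus>\<^bsub>V\<^esub> x) < \<epsilon> / 2) F" by (rule eventually_conj)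
  moreover have "gn a (y \<ominus>\<^bsub>V\<^esub> z) < \<epsilon>"
    if "y \<in> D \<and> gn a (y \<ominus>\<^bsub>V\<^esub> x) < \<epsilon> / 2" "z \<in> D \<and> gn a (z \<ominus>\<^bsub>V\<^esub> x) < \<epsilon> / 2" for y z
    using that gn_triangle[OF a _ x, of y z] gn_commute[OF a, of x z] x by simp
  ultimately show "\<exists>P. eventually P F \<and> (\<forall>y z. P y \<and> P z \<longrightarrow> gn a (y \<ominus>\<^bsub>V\<^esub> z) < \<epsilon>)" by blast
qed

text \<open>The filter is indexed by the finite sets of graph norms together with the precision.\<close>

lemma filter_of_approx:
  assumes K: "K \<subseteq> D" and x: "approx K x" "x \<in> D" and ne: "rep_alg \<pi> \<noteq> {}"
  obtains F where "F \<noteq> bot" "eventually (\<lambda>y. y \<in> K) F"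
    "\<And>a \<epsilon>. \<lbrakk>a \<in> rep_alg \<pi>; \<epsilon> > 0\<rbrakk> \<Longrightarrow> eventually (\<lambda>y. gn a (y \<ominus>\<^bsub>V\<^esub> x) < \<epsilon>) F"
    "graph_cauchy \<pi> F" "limitin (graph_topology \<pi>) (\<lambda>y. y) x F"
proof -
  define I where "I = finite_subsets_at_top (rep_alg \<pi>) \<times>\<^sub>F sequentially"
  define g where "g = (\<lambda>(A, n::nat). SOME y. y \<in> K \<and> (\<forall>a\<in>A. gn a (y \<ominus>\<^bsub>V\<^esub> x) < 1 / real (Suc n)))"
  have g: "g (A, n) \<in> K \<and> (\<forall>a\<in>A. gn a (g (A, n) \<ominus>\<^bsub>V\<^esub> x) < 1 / real (Suc n))"
    if "finite A" "A \<subseteq> rep_alg \<pi>" for A n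
    unfolding g_def prod.case
    by (rule someI_ex) (use approxD[OF x(1) that, of "1 / real (Suc n)"] in auto)
  have evA: "eventually (\<lambda>A. finite A \<and> A \<subseteq> rep_alg \<pi> \<and> B \<subseteq> A) (finite_subsets_at_top (rep_alg \<pi>))"
    if "finite B" "B \<subseteq> rep_alg \<pi>" for B
    unfolding eventually_finite_subsets_at_top using that by blast
  have Ine: "I \<noteq> bot" unfolding I_def by (simp add: prod_filter_eq_bot)
  define F where "F = filtermap g I"
  have "F \<noteq> bot" using Ine by (simp add: F_def filtermap_bot_iff)
  moreover have FK: "eventually (\<lambda>y. y \<in> K) F"
    unfolding F_def eventually_filtermap I_def eventually_prod_filter
    using evA[of "{}"] g
    by (intro exI[of _ "\<lambda>A. finite A \<and> A \<subseteq> rep_alg \<pi> \<and> {} \<subseteq> A"] exI[of _ "\<lambda>_. True"]) auto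
  moreover have lim: "eventually (\<lambda>y. gn a (y \<ominus>\<^bsub>V\<^esub> x) < \<epsilon>) F" if "a \<in> rep_alg \<pi>" "\<epsilon> > 0" for a \<epsilon>
  proof -
    obtain N where N: "1 / real (Suc N) < \<epsilon>" using nat_approx_posE[OF \<open>\<epsilon> > 0\<close>] by blast
    have "gn a (g (A, n) \<ominus>\<^bsub>V\<^esub> x) < \<epsilon>"
      if "finite A \<and> A \<subseteq> rep_alg \<pi> \<and> {a} \<subseteq> A" "n \<ge> N" for A n
    proof -
      have "1 / real (Suc n) \<le> 1 / real (Suc N)" using that by (simp add: frac_le)
      then show ?thesis using g[of A n] that N by fastforce
    qed
    then show ?thesis
      unfolding F_def eventually_filtermap I_def eventually_prod_filter
      using evA[of "{a}"] that eventually_ge_at_top[of N]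
      by (intro exI[of _ "\<lambda>A. finite A \<and> A \<subseteq> rep_alg \<pi> \<and> {a} \<subseteq> A"] exI[of _ "\<lambda>n. n \<ge> N"]) auto
  qed
  moreover have FD: "eventually (\<lambda>y. y \<in> D) F" using FK by (rule eventually_mono) (use K in blast)
  ultimately show ?thesis
    using that graph_cauchy_of_limit[of F x] limit_graph_iff[OF ne, of "\<lambda>y. y" x F] x(2) by blast
qed

end

text \<open>Used for the unitary map between \<open>K\<close> and the algebraic tensors, for its inverse, for inclusions, and
  for the projection of the induced system at \<open>H\<close>.\<close>

lemma graph_cauchy_filtermap:
  assumes F: "graph_cauchy \<sigma> F" and alg: "rep_alg \<pi> \<subseteq> rep_alg \<sigma>"
    and dom: "\<And>x. x \<in> rep_dom \<sigma> \<Longrightarrow> f x \<in> rep_dom \<pi>"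
    and le: "\<And>a x y. \<lbrakk>a \<in> rep_alg \<pi>; x \<in> rep_dom \<sigma>; y \<in> rep_dom \<sigma>\<rbrakk> \<Longrightarrow>
      graph_norm \<pi> a (f x \<ominus>\<^bsub>rep_space \<pi>\<^esub> f y) \<le> graph_norm \<sigma> a (x \<ominus>\<^bsub>rep_space \<sigma>\<^esub> y)"
  shows "graph_cauchy \<pi> (filtermap f F)"
  unfolding graph_cauchy_def
proof (intro conjI ballI allI impI)
  have D: "eventually (\<lambda>x. x \<in> rep_dom \<sigma>) F" using F by (simp add: graph_cauchy_def)
  show "filtermap f F \<noteq> bot" using F by (simp add: graph_cauchy_def filtermap_bot_iff)
  show "eventually (\<lambda>y. y \<in> rep_dom \<pi>) (filtermap f F)"
    unfolding eventually_filtermap using D by (rule eventually_mono) (rule dom)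
  fix a and \<epsilon> :: real assume a: "a \<in> rep_alg \<pi>" and "\<epsilon> > 0"
  then obtain P where P: "eventually P F"
      "\<And>x y. \<lbrakk>P x; P y\<rbrakk> \<Longrightarrow> graph_norm \<sigma> a (x \<ominus>\<^bsub>rep_space \<sigma>\<^esub> y) < \<epsilon>"
    using F alg unfolding graph_cauchy_def by blast
  let ?Q = "\<lambda>z. \<exists>x. P x \<and> x \<in> rep_dom \<sigma> \<and> z = f x"
  have "eventually ?Q (filtermap f F)"
    unfolding eventually_filtermap using eventually_conj[OF P(1) D] by (rule eventually_mono) blast
  moreover have "graph_norm \<pi> a (u \<ominus>\<^bsub>rep_space \<pi>\<^esub> v) < \<epsilon>" if "?Q u" "?Q v" for u v
    using that P(2) le[OF a] by (meson le_less_trans)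
  ultimately show "\<exists>P. eventually P (filtermap f F) \<and>
      (\<forall>u v. P u \<and> P v \<longrightarrow> graph_norm \<pi> a (u \<ominus>\<^bsub>rep_space \<pi>\<^esub> v) < \<epsilon>)" by blast
qed

locale adjointable_family = operator_family +
  assumes dense: "vtop (rep_space \<pi>) closure_of (rep_dom \<pi>) = carrier (rep_space \<pi>)"
    and adjoint: "a \<in> rep_alg \<pi> \<Longrightarrow> \<exists>b\<in>rep_alg \<pi>. \<forall>x\<in>rep_dom \<pi>. \<forall>y\<in>rep_dom \<pi>.
      ip (rep_space \<pi>) (rep_op \<pi> a x) y = ip (rep_space \<pi>) x (rep_op \<pi> b y)"
begin

lemma eq_of_ip_D: "\<lbrakk>x \<in> carrier V; y \<in> carrier V; \<And>z. z \<in> D \<Longrightarrow> ip V x z = ip V y z\<rbrakk> \<Longrightarrow> x = y"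
proof (rule V.eq_of_ip_total[of D])
  have "vspan V D = D" using V.vspan_minimal[OF dom, of D] V.vspan_subset[of D] by blast
  then show "vtop V closure_of (vspan V D) = carrier V" using dense by simp
qed auto

text \<open>This is closability: the inner products of the limit with vectors \<open>z\<close> of the domain are those of
  \<open>x\<close> with the images of \<open>z\<close> under the adjoint operator, and the domain is dense.\<close>

lemma limit_op_unique:
  assumes F: "graph_cauchy \<pi> F" "limitin (vtop V) (\<lambda>x. x) x F" "limitin (vtop V) (rep_op \<pi> a) y F"
    and F': "graph_cauchy \<pi> F'" "limitin (vtop V) (\<lambda>x. x) x F'" "limitin (vtop V) (rep_op \<pi> a) y' F'"
    and a: "a \<in> rep_alg \<pi>"
  shows "y = y'"
proof -
  obtain b where b: "b \<in> rep_alg \<pi>"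
      "\<And>u z. \<lbrakk>u \<in> D; z \<in> D\<rbrakk> \<Longrightarrow> ip V (rep_op \<pi> a u) z = ip V u (rep_op \<pi> b z)"
    using adjoint[OF a] by blast
  have *: "ip V y z = ip V x (rep_op \<pi> b z)"
    if F: "graph_cauchy \<pi> F" "limitin (vtop V) (\<lambda>x. x) x F" "limitin (vtop V) (rep_op \<pi> a) y F"
      and z: "z \<in> D" for F y z
  proof -
    have ev: "eventually (\<lambda>u. u \<in> D) F" and ne: "F \<noteq> bot" using F(1) by (auto simp: graph_cauchy_def)
    have 1: "((\<lambda>u. ip V (rep_op \<pi> a u) z) \<longlongrightarrow> ip V y z) F"
      using z by (intro V.limit_ip F) auto
    have 2: "((\<lambda>u. ip V u (rep_op \<pi> b z)) \<longlongrightarrow> ip V x (rep_op \<pi> b z)) F"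
      using z b(1) by (intro V.limit_ip F) auto
    have "eventually (\<lambda>u. ip V (rep_op \<pi> a u) z = ip V u (rep_op \<pi> b z)) F"
      using ev by (rule eventually_mono) (use b(2) z in blast)
    with 1 have "((\<lambda>u. ip V u (rep_op \<pi> b z)) \<longlongrightarrow> ip V y z) F"
      by (rule Lim_transform_eventually)
    then show ?thesis using 2 by (rule tendsto_unique[OF ne])
  qed
  show ?thesis
    by (rule eq_of_ip_D) (use F(3) F'(3) V.limit_carrier *[OF F] *[OF F'] in auto)
qed

lemma rep_closure_simps:
  "rep_alg (rep_closure \<pi>) = rep_alg \<pi>" "rep_space (rep_closure \<pi>) = V"
  "rep_dom (rep_closure \<pi>) = {x. \<exists>F. graph_cauchy \<pi> F \<and> limitin (vtop V) (\<lambda>x. x) x F}"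
  by (simp_all add: rep_closure_def Let_def)

lemma rep_closure_op:
  assumes "graph_cauchy \<pi> F" "limitin (vtop V) (\<lambda>x. x) x F" "limitin (vtop V) (rep_op \<pi> a) y F"
    and a: "a \<in> rep_alg \<pi>"
  shows "rep_op (rep_closure \<pi>) a x = y"
  unfolding rep_closure_def Let_def rep.select_convs
  by (rule the_equality) (use assms limit_op_unique[OF _ _ _ assms] in blast)+

lemma rep_closure_extends:
  assumes x: "x \<in> D"
  shows "x \<in> rep_dom (rep_closure \<pi>)"
    and "a \<in> rep_alg \<pi> \<Longrightarrow> rep_op (rep_closure \<pi>) a x = rep_op \<pi> a x"
proof -
  have c: "graph_cauchy \<pi> (principal {x})"
    by (rule graph_cauchy_of_limit[OF _ x]) (use x in \<open>auto simp: eventually_principal gn_self principal_eq_bot_iff\<close>)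
  have l: "limitin (vtop V) f (f x) (principal {x})" if "f x \<in> carrier V" for f
    using that by (intro limitin_eventually) (auto simp: eventually_principal)
  show "x \<in> rep_dom (rep_closure \<pi>)" using c l[of "\<lambda>x. x"] x unfolding rep_closure_simps by auto
  show "rep_op (rep_closure \<pi>) a x = rep_op \<pi> a x" if "a \<in> rep_alg \<pi>"
    using rep_closure_op[OF c l[of "\<lambda>x. x"] l that] that x by auto
qed

end

locale star_rep =
  fixes S :: "'a::complex_star_algebra set" and \<pi> :: "('a, 'v) rep"
  assumes rep: "star_representation S \<pi>" and star_closed: "a \<in> S \<Longrightarrow> a\<^sup>\<star> \<in> S"
begin

lemma alg: "rep_alg \<pi> = S"
  and hilbert: "hilbert (rep_space \<pi>)"
  and submodule_dom: "submodule (rep_dom \<pi>) complex_field (rep_space \<pi>)"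
  and dense_dom: "vtop (rep_space \<pi>) closure_of rep_dom \<pi> = carrier (rep_space \<pi>)"
  and linear: "a \<in> S \<Longrightarrow> linear_map (rep_space \<pi>) (rep_dom \<pi>) (rep_space \<pi>) (rep_op \<pi> a)"
  and dom_invariant: "\<lbrakk>a \<in> S; x \<in> rep_dom \<pi>\<rbrakk> \<Longrightarrow> rep_op \<pi> a x \<in> rep_dom \<pi>"
  and rep_add: "\<lbrakk>a \<in> S; b \<in> S; x \<in> rep_dom \<pi>\<rbrakk> \<Longrightarrow>
    rep_op \<pi> (a + b) x = rep_op \<pi> a x \<oplus>\<^bsub>rep_space \<pi>\<^esub> rep_op \<pi> b x"
  and rep_scale: "\<lbrakk>a \<in> S; x \<in> rep_dom \<pi>\<rbrakk> \<Longrightarrow> rep_op \<pi> (c *\<^sub>C a) x = c \<odot>\<^bsub>rep_space \<pi>\<^esub> rep_op \<pi> a x"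
  and rep_mult: "\<lbrakk>a \<in> S; b \<in> S; x \<in> rep_dom \<pi>\<rbrakk> \<Longrightarrow> rep_op \<pi> (a * b) x = rep_op \<pi> a (rep_op \<pi> b x)"
  and rep_star: "\<lbrakk>a \<in> S; x \<in> rep_dom \<pi>; y \<in> rep_dom \<pi>\<rbrakk> \<Longrightarrow>
    ip (rep_space \<pi>) (rep_op \<pi> a x) y = ip (rep_space \<pi>) x (rep_op \<pi> (a\<^sup>\<star>) y)"
  using rep unfolding star_representation_def Let_def hilbert_space_iff by blast+

end

sublocale star_rep \<subseteq> V: hilbert "rep_space \<pi>"
  by (rule hilbert)

sublocale star_rep \<subseteq> adjointable_family \<pi>
proof (intro adjointable_family.intro operator_family.intro)
  show "inner_space (rep_space \<pi>)" ..
  show "operator_family_axioms \<pi>"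
    by (rule operator_family_axioms.intro) (use submodule_dom linear in \<open>simp_all add: alg\<close>)
  show "adjointable_family_axioms \<pi>"
  proof (rule adjointable_family_axioms.intro)
    show "vtop (rep_space \<pi>) closure_of rep_dom \<pi> = carrier (rep_space \<pi>)" by (rule dense_dom)
    fix a assume "a \<in> rep_alg \<pi>"
    then have "a \<in> S" by (simp add: alg)
    then show "\<exists>b\<in>rep_alg \<pi>. \<forall>x\<in>rep_dom \<pi>. \<forall>y\<in>rep_dom \<pi>.
        ip (rep_space \<pi>) (rep_op \<pi> a x) y = ip (rep_space \<pi>) x (rep_op \<pi> b y)"
      using rep_star star_closed by (intro bexI[of _ "a\<^sup>\<star>"]) (auto simp: alg)
  qed
qed


section \<open>Graded algebras\<close>

interpretation scaleC: Modules.module "scaleC :: complex \<Rightarrow> 'a::complex_star_algebra \<Rightarrow> 'a"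
  by unfold_locales (simp_all add: scaleC_add_right scaleC_add_left scaleC_scaleC scaleC_one)

lemma star_zero [simp]: "(0 :: 'a::complex_star_algebra)\<^sup>\<star> = 0"
  using star_add[of 0 0] by simp

lemma star_one: "(1 :: 'a::complex_star_algebra)\<^sup>\<star> = 1"
proof -
  have "(1::'a)\<^sup>\<star> = (1::'a)\<^sup>\<star> * ((1::'a)\<^sup>\<star>)\<^sup>\<star>" by (simp add: star_star)
  also have "\<dots> = ((1::'a)\<^sup>\<star> * 1)\<^sup>\<star>" by (rule star_mult[symmetric])
  also have "\<dots> = 1" by (simp add: star_star)
  finally show ?thesis .
qed

locale graded_algebra =
  fixes G :: "('g, 'm) monoid_scheme" and \<A> :: "'g \<Rightarrow> 'a::complex_star_algebra set"
  assumes graded: "graded_star_algebra G \<A>"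
begin

sublocale G: group G
  using graded by (simp add: graded_star_algebra_def)

lemma homogeneous_subspace: "g \<in> carrier G \<Longrightarrow> csubspace (\<A> g)"
  and decomposition: "\<exists>!f. homogeneous_decomposition G \<A> a f"
  and homogeneous_mult: "\<lbrakk>g \<in> carrier G; h \<in> carrier G; a \<in> \<A> g; b \<in> \<A> h\<rbrakk> \<Longrightarrow> a * b \<in> \<A> (g \<otimes>\<^bsub>G\<^esub> h)"
  and homogeneous_star: "\<lbrakk>g \<in> carrier G; a \<in> \<A> g\<rbrakk> \<Longrightarrow> a\<^sup>\<star> \<in> \<A> (inv\<^bsub>G\<^esub> g)"
  using graded unfolding graded_star_algebra_def by blast+

lemma homogeneous_zero: "g \<in> carrier G \<Longrightarrow> 0 \<in> \<A> g"
  using homogeneous_subspace scaleC.subspace_0 by blast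

abbreviation comp where "comp \<equiv> component G \<A>"
abbreviation proj where "proj \<equiv> graded_proj G \<A>"

lemma comp_decomposition: "homogeneous_decomposition G \<A> a (comp a)"
  unfolding component_def by (rule theI'[OF decomposition])

lemma comp_eqI: "homogeneous_decomposition G \<A> a f \<Longrightarrow> comp a = f"
  using decomposition comp_decomposition by blast

lemma comp_support: "finite {g. comp a g \<noteq> 0}" "comp a g \<noteq> 0 \<Longrightarrow> g \<in> carrier G"
  "g \<in> carrier G \<Longrightarrow> comp a g \<in> \<A> g" "a = (\<Sum>g | comp a g \<noteq> 0. comp a g)"
  using comp_decomposition[of a] unfolding homogeneous_decomposition_def by blast+

lemma comp_outside: "g \<notin> carrier G \<Longrightarrow> comp a g = 0"
  using comp_support(2)[of a g] by blast

lemma sum_support: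
  fixes f :: "'g \<Rightarrow> 'a"
  assumes "finite S" "{g. f g \<noteq> 0} \<subseteq> S" shows "(\<Sum>g | f g \<noteq> 0. f g) = (\<Sum>g\<in>S. f g)"
  by (rule sum.mono_neutral_left) (use assms in auto)

lemma comp_add: "comp (a + b) = (\<lambda>g. comp a g + comp b g)"
proof (rule comp_eqI)
  let ?S = "{g. comp a g \<noteq> 0} \<union> {g. comp b g \<noteq> 0}"
  have S: "finite ?S" using comp_support by simp
  have "a + b = (\<Sum>g\<in>?S. comp a g) + (\<Sum>g\<in>?S. comp b g)"
    using sum_support[OF S, of "comp a"] sum_support[OF S, of "comp b"]
      comp_support(4)[of a] comp_support(4)[of b] by auto
  also have "\<dots> = (\<Sum>g\<in>?S. comp a g + comp b g)" by (simp add: sum.distrib)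
  also have "\<dots> = (\<Sum>g | comp a g + comp b g \<noteq> 0. comp a g + comp b g)"
    by (rule sum_support[OF S, symmetric]) auto
  finally have eq: "a + b = (\<Sum>g | comp a g + comp b g \<noteq> 0. comp a g + comp b g)" .
  show "homogeneous_decomposition G \<A> (a + b) (\<lambda>g. comp a g + comp b g)"
    unfolding homogeneous_decomposition_def
  proof (intro conjI ballI allI impI eq)
    show "comp a g + comp b g \<in> \<A> g" if "g \<in> carrier G" for g
      using that by (intro scaleC.subspace_add homogeneous_subspace comp_support(3))
    show "comp a g + comp b g = 0" if "g \<notin> carrier G" for g
      using that by (simp add: comp_outside)
    show "finite {g. comp a g + comp b g \<noteq> 0}" by (rule finite_subset[OF _ S]) auto
  qed
qed

lemma comp_scale: "comp (c *\<^sub>C a) = (\<lambda>g. c *\<^sub>C comp a g)"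
proof (rule comp_eqI)
  have S: "finite {g. comp a g \<noteq> 0}" using comp_support by simp
  have sub: "{g. c *\<^sub>C comp a g \<noteq> 0} \<subseteq> {g. comp a g \<noteq> 0}" by auto
  have "c *\<^sub>C a = c *\<^sub>C (\<Sum>g | comp a g \<noteq> 0. comp a g)" using comp_support(4)[of a] by simp
  also have "\<dots> = (\<Sum>g | comp a g \<noteq> 0. c *\<^sub>C comp a g)" by (rule scaleC.scale_sum_right)
  also have "\<dots> = (\<Sum>g | c *\<^sub>C comp a g \<noteq> 0. c *\<^sub>C comp a g)"
    by (rule sum_support[OF S sub, symmetric])
  finally have eq: "c *\<^sub>C a = (\<Sum>g | c *\<^sub>C comp a g \<noteq> 0. c *\<^sub>C comp a g)" .
  show "homogeneous_decomposition G \<A> (c *\<^sub>C a) (\<lambda>g. c *\<^sub>C comp a g)"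
    unfolding homogeneous_decomposition_def
  proof (intro conjI ballI allI impI eq)
    show "c *\<^sub>C comp a g \<in> \<A> g" if "g \<in> carrier G" for g
      using that by (intro scaleC.subspace_scale homogeneous_subspace comp_support(3))
    show "c *\<^sub>C comp a g = 0" if "g \<notin> carrier G" for g
      using that by (simp add: comp_outside)
    show "finite {g. c *\<^sub>C comp a g \<noteq> 0}" by (rule finite_subset[OF sub S])
  qed
qed

lemma comp_homogeneous: "\<lbrakk>g \<in> carrier G; a \<in> \<A> g\<rbrakk> \<Longrightarrow> comp a = (\<lambda>h. if h = g then a else 0)"
proof (rule comp_eqI)
  assume g: "g \<in> carrier G" "a \<in> \<A> g"
  have S: "{h. (if h = g then a else 0) \<noteq> 0} \<subseteq> {g}" by auto
  have "finite {h. (if h = g then a else 0) \<noteq> 0}" by (rule finite_subset[OF S]) simp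
  moreover have "(\<Sum>h | (if h = g then a else 0) \<noteq> 0. if h = g then a else 0) = a"
    using sum_support[OF _ S] by simp
  ultimately show "homogeneous_decomposition G \<A> a (\<lambda>h. if h = g then a else 0)"
    unfolding homogeneous_decomposition_def using g homogeneous_zero by auto
qed

lemma proj_eq: "\<lbrakk>finite S; {g. comp a g \<noteq> 0} \<subseteq> S\<rbrakk> \<Longrightarrow> proj X a = (\<Sum>g\<in>S \<inter> X. comp a g)"
  unfolding graded_proj_def by (rule sum.mono_neutral_left) auto

lemma proj_add: "proj X (a + b) = proj X a + proj X b"
proof -
  let ?S = "{g. comp a g \<noteq> 0} \<union> {g. comp b g \<noteq> 0}"
  have S: "finite ?S" using comp_support by simp
  have "proj X (a + b) = (\<Sum>g\<in>?S \<inter> X. comp (a + b) g)"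
    by (rule proj_eq[OF S]) (auto simp: comp_add)
  also have "\<dots> = (\<Sum>g\<in>?S \<inter> X. comp a g) + (\<Sum>g\<in>?S \<inter> X. comp b g)"
    by (simp add: comp_add sum.distrib)
  also have "\<dots> = proj X a + proj X b"
    using proj_eq[OF S, of a X] proj_eq[OF S, of b X] by simp
  finally show ?thesis .
qed

lemma proj_scale: "proj X (c *\<^sub>C a) = c *\<^sub>C proj X a"
proof -
  let ?S = "{g. comp a g \<noteq> 0}"
  have S: "finite ?S" using comp_support by simp
  have "proj X (c *\<^sub>C a) = (\<Sum>g\<in>?S \<inter> X. comp (c *\<^sub>C a) g)"
    by (rule proj_eq[OF S]) (auto simp: comp_scale)
  also have "\<dots> = c *\<^sub>C (\<Sum>g\<in>?S \<inter> X. comp a g)"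
    by (simp add: comp_scale scaleC.scale_sum_right)
  also have "\<dots> = c *\<^sub>C proj X a" using proj_eq[OF S, of a X] by simp
  finally show ?thesis .
qed

lemma proj_homogeneous: "\<lbrakk>g \<in> carrier G; a \<in> \<A> g\<rbrakk> \<Longrightarrow> proj X a = (if g \<in> X then a else 0)"
proof -
  assume g: "g \<in> carrier G" "a \<in> \<A> g"
  have "proj X a = (\<Sum>h\<in>{g} \<inter> X. comp a h)"
    by (rule proj_eq) (auto simp: comp_homogeneous[OF g])
  then show ?thesis by (simp add: comp_homogeneous[OF g])
qed

lemma proj_zero [simp]: "proj X 0 = 0"
  using proj_scale[of X 0 0] by simp

lemma homogeneous_induct [case_names zero add scale homogeneous]:
  assumes zero: "P 0" and add: "\<And>a b. \<lbrakk>P a; P b\<rbrakk> \<Longrightarrow> P (a + b)"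
    and scale: "\<And>c a. P a \<Longrightarrow> P (c *\<^sub>C a)" and hom: "\<And>g a. \<lbrakk>g \<in> carrier G; a \<in> \<A> g\<rbrakk> \<Longrightarrow> P a"
  shows "P a"
proof -
  have "P (\<Sum>g\<in>S. comp a g)" if "finite S" "S \<subseteq> {g. comp a g \<noteq> 0}" for S
    using that
  proof (induction S)
    case (insert g S)
    then have "P (comp a g)" using hom comp_support by blast
    with insert add show ?case by simp
  qed (simp add: zero)
  then show ?thesis using comp_support(1,4)[of a] by (metis order_refl)
qed

lemma graded_part_induct [consumes 1, case_names zero add scale homogeneous]:
  assumes "a \<in> graded_part \<A> X" and zero: "P 0" and add: "\<And>a b. \<lbrakk>P a; P b\<rbrakk> \<Longrightarrow> P (a + b)"
    and scale: "\<And>c a. P a \<Longrightarrow> P (c *\<^sub>C a)" and hom: "\<And>g a. \<lbrakk>g \<in> X; a \<in> \<A> g\<rbrakk> \<Longrightarrow> P a"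
  shows "P a"
proof -
  have "csubspace {a. P a}" unfolding scaleC.subspace_def using zero add scale by simp
  then have "graded_part \<A> X \<subseteq> {a. P a}"
    unfolding graded_part_def by (rule scaleC.span_minimal[rotated]) (use hom in blast)
  with assms(1) show ?thesis by blast
qed

lemma graded_part_add: "\<lbrakk>a \<in> graded_part \<A> X; b \<in> graded_part \<A> X\<rbrakk> \<Longrightarrow> a + b \<in> graded_part \<A> X"
  and graded_part_scale: "a \<in> graded_part \<A> X \<Longrightarrow> c *\<^sub>C a \<in> graded_part \<A> X"
  and graded_part_zero: "0 \<in> graded_part \<A> X"
  and graded_part_homogeneous: "\<lbrakk>g \<in> X; b \<in> \<A> g\<rbrakk> \<Longrightarrow> b \<in> graded_part \<A> X"
  unfolding graded_part_def
  by (auto intro: scaleC.span_add scaleC.span_scale scaleC.span_zero scaleC.span_base)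

lemma proj_in_part: "X \<subseteq> carrier G \<Longrightarrow> proj X a \<in> graded_part \<A> X"
  by (induction a rule: homogeneous_induct)
    (auto simp: proj_add proj_scale proj_homogeneous
      intro: graded_part_add graded_part_scale graded_part_zero graded_part_homogeneous)

lemma proj_fixes_part: "\<lbrakk>X \<subseteq> carrier G; a \<in> graded_part \<A> X\<rbrakk> \<Longrightarrow> proj X a = a"
  by (rotate_tac 1, induction a rule: graded_part_induct)
    (auto simp: proj_add proj_scale proj_homogeneous)

text \<open>Multiplication by \<open>b\<close> shifts degrees by \<open>h\<close>.\<close>

lemma proj_mult_left:
  assumes h: "h \<in> carrier G" and b: "b \<in> \<A> h"
    and XY: "\<And>g. g \<in> carrier G \<Longrightarrow> h \<otimes>\<^bsub>G\<^esub> g \<in> X \<longleftrightarrow> g \<in> Y"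
  shows "proj X (b * a) = b * proj Y a"
proof (induction a rule: homogeneous_induct)
  case (homogeneous g a)
  then show ?case
    using proj_homogeneous[OF _ homogeneous_mult[OF h _ b], of g a X] h XY proj_homogeneous[of g a Y]
    by simp
qed (simp_all add: proj_add proj_scale distrib_left mult_scaleC_right)

lemma proj_mult_right:
  assumes h: "h \<in> carrier G" and b: "b \<in> \<A> h"
    and XY: "\<And>g. g \<in> carrier G \<Longrightarrow> g \<otimes>\<^bsub>G\<^esub> h \<in> X \<longleftrightarrow> g \<in> Y"
  shows "proj X (a * b) = proj Y a * b"
proof (induction a rule: homogeneous_induct)
  case (homogeneous g a)
  then show ?case
    using proj_homogeneous[OF _ homogeneous_mult[OF _ h _ b], of g a X] h XY proj_homogeneous[of g a Y]
    by simp
qed (simp_all add: proj_add proj_scale distrib_right mult_scaleC_left)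

text \<open>The component \<open>e\<close> of \<open>1\<close> of degree \<open>\<one>\<close> is a right unit: compare the components of degree \<open>h\<close> in
  \<open>b = b 1\<close> for \<open>b\<close> of degree \<open>h\<close>.\<close>

lemma one_homogeneous: "1 \<in> \<A> \<one>\<^bsub>G\<^esub>"
proof -
  let ?e = "proj {\<one>\<^bsub>G\<^esub>} 1"
  have "b * ?e = b" for b
  proof (induction b rule: homogeneous_induct)
    case (homogeneous h b)
    have "proj {h} (b * 1) = b * ?e"
      by (rule proj_mult_left) (use homogeneous in auto)
    then show ?case using homogeneous by (simp add: proj_homogeneous)
  qed (simp_all add: distrib_right mult_scaleC_left)
  from this[of 1] have "?e = 1" by simp
  have "graded_part \<A> {\<one>\<^bsub>G\<^esub>} \<subseteq> \<A> \<one>\<^bsub>G\<^esub>"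
    unfolding graded_part_def using scaleC.span_minimal[OF _ homogeneous_subspace] by simp
  then show ?thesis using proj_in_part[of "{\<one>\<^bsub>G\<^esub>}" 1] \<open>?e = 1\<close> by auto
qed

end

locale graded_subgroup = graded_algebra +
  fixes H
  assumes subgroup_H: "subgroup H G"
begin

lemma H_carrier: "h \<in> H \<Longrightarrow> h \<in> carrier G"
  using subgroup.subset[OF subgroup_H] by blast

lemma H_subset: "H \<subseteq> carrier G"
  by (rule subgroup.subset[OF subgroup_H])

lemma H_one: "\<one>\<^bsub>G\<^esub> \<in> H"
  and H_mult: "\<lbrakk>g \<in> H; h \<in> H\<rbrakk> \<Longrightarrow> g \<otimes>\<^bsub>G\<^esub> h \<in> H"
  and H_inv: "h \<in> H \<Longrightarrow> inv\<^bsub>G\<^esub> h \<in> H"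
  using subgroup_H by (auto simp: subgroup.one_closed subgroup.m_closed subgroup.m_inv_closed)

lemma H_cancel_left: "\<lbrakk>h \<in> H; g \<in> carrier G\<rbrakk> \<Longrightarrow> h \<otimes>\<^bsub>G\<^esub> g \<in> H \<longleftrightarrow> g \<in> H"
  using H_mult[of "inv\<^bsub>G\<^esub> h" "h \<otimes>\<^bsub>G\<^esub> g"] H_mult[of h g] H_inv[of h] H_carrier[of h]
  by (auto simp: G.m_assoc[symmetric])

lemma H_cancel_right: "\<lbrakk>h \<in> H; g \<in> carrier G\<rbrakk> \<Longrightarrow> g \<otimes>\<^bsub>G\<^esub> h \<in> H \<longleftrightarrow> g \<in> H"
  using H_mult[of "g \<otimes>\<^bsub>G\<^esub> h" "inv\<^bsub>G\<^esub> h"] H_mult[of g h] H_inv[of h] H_carrier[of h]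
  by (auto simp: G.m_assoc)

abbreviation "A_H \<equiv> graded_part \<A> H"
abbreviation "p \<equiv> proj H"

lemma p_in: "p a \<in> A_H"
  by (rule proj_in_part[OF H_subset])

lemma p_fix: "a \<in> A_H \<Longrightarrow> p a = a"
  by (rule proj_fixes_part[OF H_subset])

text \<open>The projection \<open>p\<close> is a map of \<open>\<A>\<^sub>H\<close>-bimodules, since translation by an element of \<open>H\<close>
  preserves \<open>H\<close> and its complement.\<close>

lemma p_mult_left: "b \<in> A_H \<Longrightarrow> p (b * a) = b * p a"
proof (induction b rule: graded_part_induct)
  case (homogeneous h b)
  then show ?case by (intro proj_mult_left) (auto simp: H_carrier H_cancel_left)
qed (simp_all add: proj_add proj_scale distrib_right mult_scaleC_left)

lemma p_mult_right: "b \<in> A_H \<Longrightarrow> p (a * b) = p a * b"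
proof (induction b rule: graded_part_induct)
  case (homogeneous h b)
  then show ?case by (intro proj_mult_right) (auto simp: H_carrier H_cancel_right)
qed (simp_all add: proj_add proj_scale distrib_left mult_scaleC_right)

lemma p_star: "p (a\<^sup>\<star>) = (p a)\<^sup>\<star>"
proof (induction a rule: homogeneous_induct)
  case (homogeneous g a)
  have "inv\<^bsub>G\<^esub> g \<in> H \<longleftrightarrow> g \<in> H" using H_inv[of g] H_inv[of "inv\<^bsub>G\<^esub> g"] homogeneous by auto
  then show ?case
    using proj_homogeneous[OF _ homogeneous_star[OF homogeneous], of H] proj_homogeneous[OF homogeneous, of H]
      homogeneous by simp
qed (simp_all add: proj_add proj_scale star_add star_scaleC)

lemma A_H_star: "a \<in> A_H \<Longrightarrow> a\<^sup>\<star> \<in> A_H"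
  using p_star[of a] p_in[of "a\<^sup>\<star>"] p_fix[of a] by simp

lemma A_H_one: "1 \<in> A_H"
  by (rule graded_part_homogeneous[OF H_one one_homogeneous])

lemma A_H_unit_part: "b \<in> \<A> \<one>\<^bsub>G\<^esub> \<Longrightarrow> b \<in> A_H"
  by (rule graded_part_homogeneous[OF H_one])

end


section \<open>The space of the induced representation\<close>

locale induction = graded_subgroup G \<A> H
  for G :: "('g, 'm) monoid_scheme" and \<A> :: "'g \<Rightarrow> 'a::complex_star_algebra set" and H +
  fixes \<rho> :: "('a, 'v) rep"
  assumes rho: "star_representation (graded_part \<A> H) \<rho>"

sublocale induction \<subseteq> \<rho>: star_rep "graded_part \<A> H" \<rho>
  using rho A_H_star by unfold_locales

context induction
begin

abbreviation "F \<equiv> free_space G \<A> H \<rho>"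

text \<open>The form of \<^const>\<open>free_space\<close> on basis vectors.\<close>

definition basis_form :: "'a \<times> 'v \<Rightarrow> 'a \<times> 'v \<Rightarrow> complex"
  where "basis_form x y = ip \<rho>.V (rep_op \<rho> (p ((fst y)\<^sup>\<star> * fst x)) (snd x)) (snd y)"

abbreviation supp :: "('a \<times> 'v \<Rightarrow> complex) \<Rightarrow> ('a \<times> 'v) set"
  where "supp f \<equiv> {x. f x \<noteq> 0}"

lemma F_simps: "carrier F = {f. finite (supp f) \<and> supp f \<subseteq> UNIV \<times> \<rho>.D}"
  "f \<oplus>\<^bsub>F\<^esub> h = (\<lambda>x. f x + h x)" "\<zero>\<^bsub>F\<^esub> = (\<lambda>_. 0)" "c \<odot>\<^bsub>F\<^esub> f = (\<lambda>x. c * f x)"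
  "ip F f h = (\<Sum>x\<in>supp f. \<Sum>y\<in>supp h. f x * cnj (h y) * basis_form x y)"
  by (simp_all add: free_space_def basis_form_def case_prod_unfold)

text \<open>Sums over arbitrary finite sets that contain the supports can be added termwise.\<close>

lemma F_ip_eq:
  assumes S: "finite S" "supp f \<subseteq> S" and T: "finite T" "supp h \<subseteq> T"
  shows "ip F f h = (\<Sum>x\<in>S. \<Sum>y\<in>T. f x * cnj (h y) * basis_form x y)"
proof -
  have "ip F f h = (\<Sum>x\<in>supp f. \<Sum>y\<in>T. f x * cnj (h y) * basis_form x y)"
    unfolding F_simps by (intro sum.cong refl sum.mono_neutral_left) (use T in auto)
  also have "\<dots> = (\<Sum>x\<in>S. \<Sum>y\<in>T. f x * cnj (h y) * basis_form x y)"
    by (rule sum.mono_neutral_left) (use S in auto)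
  finally show ?thesis .
qed

lemma basis_form_commute:
  assumes "snd x \<in> \<rho>.D" "snd y \<in> \<rho>.D" shows "basis_form y x = cnj (basis_form x y)"
proof -
  have "(p ((fst x)\<^sup>\<star> * fst y))\<^sup>\<star> = p ((fst y)\<^sup>\<star> * fst x)"
    by (simp add: star_mult star_star flip: p_star)
  then have "basis_form y x = ip \<rho>.V (snd y) (rep_op \<rho> (p ((fst y)\<^sup>\<star> * fst x)) (snd x))"
    unfolding basis_form_def using assms \<rho>.rep_star[OF p_in] by simp
  also have "\<dots> = cnj (basis_form x y)"
    unfolding basis_form_def by (rule \<rho>.V.ip_commute) (use assms p_in in \<open>auto simp: \<rho>.alg\<close>)
  finally show ?thesis .
qed

lemma F_module: "module complex_field F"
proof (rule moduleI[OF cring_complex_field])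
  have fin: "finite (supp (\<lambda>x. f x + h x))" "finite (supp (\<lambda>x. c * f x))"
    if "finite (supp f)" "finite (supp h)" for f h :: "'a \<times> 'v \<Rightarrow> complex" and c
    by (rule finite_subset[of _ "supp f \<union> supp h"]; use that in auto)+
  show "abelian_group F"
  proof (rule abelian_groupI)
    fix f assume f: "f \<in> carrier F"
    show "\<exists>h\<in>carrier F. h \<oplus>\<^bsub>F\<^esub> f = \<zero>\<^bsub>F\<^esub>"
      by (rule bexI[of _ "\<lambda>x. - f x"]) (use f in \<open>auto simp: F_simps\<close>)
    fix h assume h: "h \<in> carrier F"
    show "f \<oplus>\<^bsub>F\<^esub> h \<in> carrier F"
      using f h fin(1)[of f h] by (auto simp: F_simps subset_iff) (metis add_0)
  qed (auto simp: F_simps add_ac)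
  show "c \<odot>\<^bsub>F\<^esub> f \<in> carrier F" if "f \<in> carrier F" for c f
    using that fin(2)[of f f c] by (auto simp: F_simps subset_iff)
qed (auto simp: F_simps algebra_simps)

sublocale F: hermitian_space F
proof (rule hermitian_space.intro[OF F_module])
  fix f h assume f: "f \<in> carrier F" and h: "h \<in> carrier F"
  have S: "finite (supp f)" "finite (supp h)" using f h by (auto simp: F_simps)
  show "ip F (c \<odot>\<^bsub>F\<^esub> f) h = c * ip F f h" for c
  proof -
    have "ip F (c \<odot>\<^bsub>F\<^esub> f) h = (\<Sum>x\<in>supp f. \<Sum>y\<in>supp h. (c * f x) * cnj (h y) * basis_form x y)"
      by (subst F_ip_eq[of "supp f" _ "supp h"]) (use S in \<open>auto simp: F_simps(4)\<close>)
    then show ?thesis by (simp add: F_simps(5) sum_distrib_left mult.assoc)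
  qed
  show "ip F h f = cnj (ip F f h)"
  proof -
    have "basis_form y x = cnj (basis_form x y)" if "x \<in> supp f" "y \<in> supp h" for x y
      using f h that by (intro basis_form_commute) (auto simp: F_simps dest!: subsetD)
    then have "(\<Sum>x\<in>supp f. \<Sum>y\<in>supp h. cnj (f x) * h y * cnj (basis_form x y)) =
        (\<Sum>x\<in>supp f. \<Sum>y\<in>supp h. h y * cnj (f x) * basis_form y x)"
      by (intro sum.cong refl) simp
    moreover have "ip F h f = (\<Sum>x\<in>supp f. \<Sum>y\<in>supp h. h y * cnj (f x) * basis_form y x)"
      unfolding F_simps(5) by (rule sum.swap)
    moreover have "cnj (ip F f h) = (\<Sum>x\<in>supp f. \<Sum>y\<in>supp h. cnj (f x) * h y * cnj (basis_form x y))"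
      by (simp add: F_simps(5) cnj_sum)
    ultimately show ?thesis by simp
  qed
  fix l assume l: "l \<in> carrier F"
  let ?S = "supp f \<union> supp h"
  have T: "finite (supp l)" using l by (simp add: F_simps)
  have "ip F (f \<oplus>\<^bsub>F\<^esub> h) l = (\<Sum>x\<in>?S. \<Sum>y\<in>supp l. (f x + h x) * cnj (l y) * basis_form x y)"
    by (subst F_ip_eq[of ?S _ "supp l"]) (use S T in \<open>auto simp: F_simps(2)\<close>)
  also have "\<dots> = (\<Sum>x\<in>?S. \<Sum>y\<in>supp l. f x * cnj (l y) * basis_form x y) +
      (\<Sum>x\<in>?S. \<Sum>y\<in>supp l. h x * cnj (l y) * basis_form x y)"
    by (simp add: distrib_right sum.distrib)
  also have "\<dots> = ip F f l + ip F h l"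
    using S T by (subst (1 2) F_ip_eq[of ?S _ "supp l"]) auto
  finally show "ip F (f \<oplus>\<^bsub>F\<^esub> h) l = ip F f l + ip F h l" .
qed

lemma basis_closed: "v \<in> \<rho>.D \<Longrightarrow> basis_vec a v \<in> carrier F"
  unfolding F_simps basis_vec_def
  by (auto intro: finite_subset[of _ "{(a, v)}"] split: if_splits)

lemma basis_ip: "\<lbrakk>v \<in> \<rho>.D; w \<in> \<rho>.D\<rbrakk> \<Longrightarrow>
    ip F (basis_vec a v) (basis_vec b w) = ip \<rho>.V (rep_op \<rho> (p (b\<^sup>\<star> * a)) v) w"
  by (subst F_ip_eq[of "{(a, v)}" _ "{(b, w)}"]) (auto simp: basis_vec_def basis_form_def split: if_splits)

abbreviation "basis \<equiv> {basis_vec a v | a v. v \<in> \<rho>.D}"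

lemma F_span: "vspan F basis = carrier F"
proof
  have sub: "basis \<subseteq> carrier F" using basis_closed by blast
  show "vspan F basis \<subseteq> carrier F" by (rule F.vspan_carrier[OF sub])
  have "f \<in> vspan F basis" if "finite S" "f \<in> carrier F" "supp f = S" for S f
    using that
  proof (induction S arbitrary: f)
    case empty
    then have "f = \<zero>\<^bsub>F\<^esub>" by (auto simp: F_simps)
    then show ?case using F.vspan_zero[OF sub] by simp
  next
    case (insert x S)
    obtain a v where x: "x = (a, v)" by fastforce
    then have v: "v \<in> \<rho>.D" using insert.prems by (auto simp: F_simps)
    let ?f = "f(x := 0)"
    have s: "supp ?f = S" using insert by auto
    then have "?f \<in> carrier F" using insert by (auto simp: F_simps)
    with s have "?f \<in> vspan F basis" using insert.IH by blast
    moreover have "basis_vec a v \<in> vspan F basis"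
      using v F.vspan_subset[of basis] by blast
    ultimately have "?f \<oplus>\<^bsub>F\<^esub> f x \<odot>\<^bsub>F\<^esub> basis_vec a v \<in> vspan F basis"
      by (intro F.vspan_add F.vspan_smult sub)
    moreover have "?f \<oplus>\<^bsub>F\<^esub> f x \<odot>\<^bsub>F\<^esub> basis_vec a v = f"
      by (rule ext) (simp add: F_simps basis_vec_def x)
    ultimately show ?case by simp
  qed
  then show "carrier F \<subseteq> vspan F basis" by (auto simp: F_simps)
qed

lemma F_radicalI:
  assumes r: "r \<in> carrier F" and 0: "\<And>b w. w \<in> \<rho>.D \<Longrightarrow> ip F r (basis_vec b w) = 0" and f: "f \<in> carrier F"
  shows "ip F r f = 0"
proof -
  have sub: "basis \<subseteq> carrier F" using basis_closed by blast
  have "f \<in> vspan F basis" using f F_span by simp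
  from this sub show ?thesis
  proof (induction rule: F.vspan_induct)
    case (base x) then show ?case using 0 by auto
  next
    case zero then show ?case using r by simp
  next
    case (add x y) then show ?case using r F.ip_add_right[of x y r] F_span by simp
  next
    case (smult c x) then show ?case using r F.ip_smult_right[of x r c] F_span by simp
  qed
qed

abbreviation "N \<equiv> tensor_relations G \<A> H \<rho>"

text \<open>The generating set in the definition of \<^const>\<open>tensor_relations\<close>.\<close>

definition generators where "generators =
  {\<lambda>x. basis_vec (a + b) v x - basis_vec a v x - basis_vec b v x | a b v. v \<in> \<rho>.D} \<union>
  {\<lambda>x. basis_vec a (v \<oplus>\<^bsub>\<rho>.V\<^esub> w) x - basis_vec a v x - basis_vec a w x | a v w. v \<in> \<rho>.D \<and> w \<in> \<rho>.D} \<union>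
  {\<lambda>x. basis_vec (c *\<^sub>C a) v x - c * basis_vec a v x | c a v. v \<in> \<rho>.D} \<union>
  {\<lambda>x. basis_vec a (c \<odot>\<^bsub>\<rho>.V\<^esub> v) x - c * basis_vec a v x | c a v. v \<in> \<rho>.D} \<union>
  {\<lambda>x. basis_vec (a * b) v x - basis_vec a (rep_op \<rho> b v) x | a b v. b \<in> rep_alg \<rho> \<and> v \<in> \<rho>.D}"

text \<open>The balancing relation is in the radical because \<open>p(c\<^sup>\<star>ab) = p(c\<^sup>\<star>a)b\<close> for \<open>b \<in> \<A>\<^sub>H\<close>; the others
  are there because the form on basis vectors is biadditive and homogeneous.\<close>

lemma generator_radical:
  assumes "r \<in> generators"
  shows "r \<in> carrier F \<and> (\<forall>b. \<forall>w\<in>\<rho>.D. ip F r (basis_vec b w) = 0)"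
proof -
  have diff: "(\<lambda>x. f x - c * h x) = f \<oplus>\<^bsub>F\<^esub> (- c) \<odot>\<^bsub>F\<^esub> h" for f h :: "'a \<times> 'v \<Rightarrow> complex" and c
    by (simp add: F_simps)
  have diff3: "(\<lambda>x. f x - h x - l x) = f \<oplus>\<^bsub>F\<^esub> ((-1) \<odot>\<^bsub>F\<^esub> h \<oplus>\<^bsub>F\<^esub> (-1) \<odot>\<^bsub>F\<^esub> l)"
    for f h l :: "'a \<times> 'v \<Rightarrow> complex"
    by (simp add: F_simps fun_eq_iff)
  have diff1: "(\<lambda>x. f x - h x) = f \<oplus>\<^bsub>F\<^esub> (-1) \<odot>\<^bsub>F\<^esub> h" for f h :: "'a \<times> 'v \<Rightarrow> complex"
    by (simp add: F_simps)
  note [simp] = basis_closed basis_ip F.ip_add_left F.ip_smult_left \<rho>.alg \<rho>.dom_invariant p_in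
  note alg = distrib_left distrib_right proj_add proj_scale mult_scaleC_left mult_scaleC_right
    \<rho>.rep_add \<rho>.rep_scale \<rho>.op_add \<rho>.op_smult \<rho>.V.ip_add_left \<rho>.V.ip_smult_left
  from assms consider
    (1) a b v where "r = (\<lambda>x. basis_vec (a + b) v x - basis_vec a v x - basis_vec b v x)" "v \<in> \<rho>.D"
  | (2) a v w where "r = (\<lambda>x. basis_vec a (v \<oplus>\<^bsub>\<rho>.V\<^esub> w) x - basis_vec a v x - basis_vec a w x)"
      "v \<in> \<rho>.D" "w \<in> \<rho>.D"
  | (3) c a v where "r = (\<lambda>x. basis_vec (c *\<^sub>C a) v x - c * basis_vec a v x)" "v \<in> \<rho>.D"
  | (4) c a v where "r = (\<lambda>x. basis_vec a (c \<odot>\<^bsub>\<rho>.V\<^esub> v) x - c * basis_vec a v x)" "v \<in> \<rho>.D"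
  | (5) a b v where "r = (\<lambda>x. basis_vec (a * b) v x - basis_vec a (rep_op \<rho> b v) x)"
      "b \<in> rep_alg \<rho>" "v \<in> \<rho>.D"
    unfolding generators_def by blast
  then show ?thesis
  proof cases
    case 1 then show ?thesis unfolding 1(1) diff3 by (auto simp: alg)
  next
    case 2 then show ?thesis unfolding 2(1) diff3 by (auto simp: alg)
  next
    case 3 then show ?thesis unfolding 3(1) diff by (auto simp: alg)
  next
    case 4 then show ?thesis unfolding 4(1) diff by (auto simp: alg)
  next
    case 5
    then have "p (c\<^sup>\<star> * (a * b)) = p (c\<^sup>\<star> * a) * b" for c
      by (simp add: p_mult_right flip: mult.assoc)
    with 5 show ?thesis unfolding 5(1) diff1 by (auto simp: \<rho>.rep_mult)
  qed
qed

sublocale N: form_quotient F N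
proof (intro form_quotient.intro form_quotient_axioms.intro)
  show "hermitian_space F" ..
  have gen: "generators \<subseteq> carrier F" using generator_radical by blast
  have N: "N = vspan F generators"
    by (simp add: tensor_relations_def Let_def generators_def)
  show "submodule N complex_field F"
    unfolding N by (rule F.submodule_vspan[OF gen])
  fix n f assume n: "n \<in> N" and f: "f \<in> carrier F"
  from n have "n \<in> vspan F generators" by (simp add: N)
  from this gen show "ip F n f = 0"
  proof (induction rule: F.vspan_induct)
    case (base x)
    note r = generator_radical[OF base]
    show ?case by (rule F_radicalI[OF conjunct1[OF r] bspec[OF spec[OF conjunct2[OF r]]] f])
  next
    case zero then show ?case using f by simp
  next
    case (add x y)
    then have "x \<in> carrier F" "y \<in> carrier F" using F.vspan_carrier[OF gen] by blast+
    with add f show ?case by (simp add: F.ip_add_left)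
  next
    case (smult c x)
    then have "x \<in> carrier F" using F.vspan_carrier[OF gen] by blast
    with smult f show ?case by (simp add: F.ip_smult_left)
  qed
qed

lemma tensor_space_eq: "tensor_space G \<A> H \<rho> = quotient_space F N"
  by (simp add: tensor_space_def)

lemma inducible_iff: "inducible G \<A> H \<rho> \<longleftrightarrow> (\<forall>f\<in>carrier F. ip F f f \<in> \<real>\<^sub>\<ge>\<^sub>0)"
  unfolding inducible_def tensor_space_eq N.quotient_carrier by (simp add: N.quotient_ip)

end

locale inducible_rep = induction +
  assumes inducible: "inducible G \<A> H \<rho>"
begin

abbreviation "T \<equiv> tensor_space G \<A> H \<rho>"
abbreviation "P \<equiv> ind_prespace G \<A> H \<rho>"
abbreviation "I \<equiv> ind_space G \<A> H \<rho>"
abbreviation "J \<equiv> ind_vector G \<A> H \<rho>"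

sublocale T: positive_space T
proof -
  interpret T: hermitian_space T unfolding tensor_space_eq by (rule N.hermitian_quotient)
  show "positive_space T"
    using inducible unfolding inducible_def by unfold_locales blast
qed

sublocale K: form_quotient T "ip_kernel T"
  by (rule T.form_quotient_kernel)

lemma P_eq: "P = quotient_space T (ip_kernel T)"
  by (simp add: ind_prespace_def)

sublocale P: inner_space P
  unfolding P_eq by (rule T.inner_space_quotient)

lemma I_eq: "I = Defs.completion P"
  by (simp add: ind_space_def)

lemmas embed_facts = P.completion_facts[folded I_eq]

sublocale I: hilbert I
  by (rule embed_facts(1))

text \<open>The composition of the maps from the free space to the tensor product, to its quotient and to the
  completion. It preserves the forms, so facts about the induced space reduce to the free space.\<close>

definition \<Psi> where "\<Psi> f = completion_embed P (ip_kernel T +>\<^bsub>T\<^esub> (N +>\<^bsub>F\<^esub> f))"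

lemma tensor_closed: "f \<in> carrier F \<Longrightarrow> N +>\<^bsub>F\<^esub> f \<in> carrier T"
  unfolding tensor_space_eq N.quotient_carrier by blast

lemma pre_closed: "t \<in> carrier T \<Longrightarrow> ip_kernel T +>\<^bsub>T\<^esub> t \<in> carrier P"
  unfolding P_eq K.quotient_carrier by blast

lemma \<Psi>_closed: "f \<in> carrier F \<Longrightarrow> \<Psi> f \<in> carrier I"
  unfolding \<Psi>_def by (intro embed_facts(2) pre_closed tensor_closed)

lemma \<Psi>_add: "\<lbrakk>f \<in> carrier F; h \<in> carrier F\<rbrakk> \<Longrightarrow> \<Psi> (f \<oplus>\<^bsub>F\<^esub> h) = \<Psi> f \<oplus>\<^bsub>I\<^esub> \<Psi> h"
  unfolding \<Psi>_def
  using N.quotient_add[of f h, folded tensor_space_eq]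
    K.quotient_add[OF tensor_closed tensor_closed, of f h, folded P_eq]
    embed_facts(3)[OF pre_closed pre_closed, OF tensor_closed tensor_closed, of f h]
  by simp

lemma \<Psi>_smult: "f \<in> carrier F \<Longrightarrow> \<Psi> (c \<odot>\<^bsub>F\<^esub> f) = c \<odot>\<^bsub>I\<^esub> \<Psi> f"
  unfolding \<Psi>_def
  using N.quotient_smult[of f c, folded tensor_space_eq]
    K.quotient_smult[OF tensor_closed, of f c, folded P_eq]
    embed_facts(4)[OF pre_closed, OF tensor_closed, of f c]
  by simp

lemma \<Psi>_ip: "\<lbrakk>f \<in> carrier F; h \<in> carrier F\<rbrakk> \<Longrightarrow> ip I (\<Psi> f) (\<Psi> h) = ip F f h"
  unfolding \<Psi>_def
  using N.quotient_ip[of f h, folded tensor_space_eq]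
    K.quotient_ip[OF tensor_closed tensor_closed, of f h, folded P_eq]
    embed_facts(5)[OF pre_closed pre_closed, OF tensor_closed tensor_closed, of f h]
  by simp

lemma J_eq_\<Psi>: "J a v = \<Psi> (basis_vec a v)"
  by (simp add: ind_vector_def pure_tensor_def \<Psi>_def)

lemma \<Psi>_image: "\<Psi> ` carrier F = completion_embed P ` carrier P"
  unfolding P_eq K.quotient_carrier unfolding tensor_space_eq N.quotient_carrier
  by (auto simp: \<Psi>_def P_eq tensor_space_eq image_image)

abbreviation "tensors \<equiv> {J a v | a v. v \<in> \<rho>.D}"
abbreviation "K0 \<equiv> vspan I tensors"

lemma J_closed: "v \<in> \<rho>.D \<Longrightarrow> J a v \<in> carrier I"
  unfolding J_eq_\<Psi> by (intro \<Psi>_closed basis_closed)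

lemma tensors_closed: "tensors \<subseteq> carrier I"
  using J_closed by blast

lemma J_in_K0: "v \<in> \<rho>.D \<Longrightarrow> J a v \<in> K0"
  using I.vspan_subset[of tensors] by blast

lemma K0_closed: "x \<in> K0 \<Longrightarrow> x \<in> carrier I"
  using I.vspan_carrier[OF tensors_closed] by blast

lemma K0_submodule: "submodule K0 complex_field I"
  by (rule I.submodule_vspan[OF tensors_closed])

lemma J_ip: "\<lbrakk>v \<in> \<rho>.D; w \<in> \<rho>.D\<rbrakk> \<Longrightarrow> ip I (J a v) (J b w) = ip \<rho>.V (rep_op \<rho> (p (b\<^sup>\<star> * a)) v) w"
  unfolding J_eq_\<Psi> by (simp add: \<Psi>_ip basis_closed basis_ip)

lemma K0_eq: "K0 = completion_embed P ` carrier P"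
proof -
  have 1: "K0 \<subseteq> \<Psi> ` carrier F"
  proof (rule I.vspan_minimal)
    show "tensors \<subseteq> \<Psi> ` carrier F" unfolding J_eq_\<Psi> using basis_closed by blast
    show "submodule (\<Psi> ` carrier F) complex_field I"
      unfolding I.submodule_iff
    proof (intro conjI ballI allI)
      show "\<Psi> ` carrier F \<subseteq> carrier I" using \<Psi>_closed by blast
      have "\<Psi> \<zero>\<^bsub>F\<^esub> = \<zero>\<^bsub>I\<^esub>"
        using \<Psi>_smult[of "\<zero>\<^bsub>F\<^esub>" 0] \<Psi>_closed[of "\<zero>\<^bsub>F\<^esub>"] by simp
      then show "\<zero>\<^bsub>I\<^esub> \<in> \<Psi> ` carrier F" using F.zero_closed by (metis image_eqI)
      fix x assume "x \<in> \<Psi> ` carrier F"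
      then obtain f where f: "x = \<Psi> f" "f \<in> carrier F" by blast
      show "c \<odot>\<^bsub>I\<^esub> x \<in> \<Psi> ` carrier F" for c
        using f by (simp add: imageI flip: \<Psi>_smult)
      fix y assume "y \<in> \<Psi> ` carrier F"
      then obtain h where h: "y = \<Psi> h" "h \<in> carrier F" by blast
      show "x \<oplus>\<^bsub>I\<^esub> y \<in> \<Psi> ` carrier F"
        using f h by (simp add: imageI flip: \<Psi>_add)
    qed
  qed
  have 2: "\<Psi> f \<in> K0" if "f \<in> carrier F" for f
  proof -
    have sub: "basis \<subseteq> carrier F" using basis_closed by blast
    have "f \<in> vspan F basis" using that F_span by simp
    from this sub show ?thesis
    proof (induction rule: F.vspan_induct)
      case (base f)
      then obtain a v where "f = basis_vec a v" "v \<in> \<rho>.D" by blast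
      then show ?case using J_in_K0[of v a] by (simp add: J_eq_\<Psi>)
    next
      case zero
      have "\<Psi> \<zero>\<^bsub>F\<^esub> = \<zero>\<^bsub>I\<^esub>"
        using \<Psi>_smult[of "\<zero>\<^bsub>F\<^esub>" 0] \<Psi>_closed[of "\<zero>\<^bsub>F\<^esub>"] by simp
      then show ?case using I.vspan_zero[OF tensors_closed] by simp
    next
      case (add f h)
      then show ?case using I.vspan_add[OF tensors_closed] F_span by (simp add: \<Psi>_add)
    next
      case (smult c f)
      then show ?case using I.vspan_smult[OF tensors_closed] F_span by (simp add: \<Psi>_smult)
    qed
  qed
  show ?thesis unfolding \<Psi>_image[symmetric] by (rule equalityI[OF 1 image_subsetI[OF 2]])
qed

lemma tensors_total: "vtop I closure_of K0 = carrier I"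
  unfolding K0_eq by (rule embed_facts(6))

lemma I_eqI:
  assumes "x \<in> carrier I" "y \<in> carrier I"
    and "\<And>c w. w \<in> \<rho>.D \<Longrightarrow> ip I x (J c w) = ip I y (J c w)"
  shows "x = y"
  by (rule I.eq_of_ip_total[OF tensors_closed tensors_total assms(1,2)]) (use assms(3) in blast)

text \<open>Both sides have the same inner products with all tensors, because \<open>p\<close> is right \<open>\<A>\<^sub>H\<close>-linear.\<close>

lemma J_balanced:
  assumes b: "b \<in> A_H" and v: "v \<in> \<rho>.D"
  shows "J (a * b) v = J a (rep_op \<rho> b v)"
proof (rule I_eqI)
  have bv: "rep_op \<rho> b v \<in> \<rho>.D" using b v by (rule \<rho>.dom_invariant)
  show "J (a * b) v \<in> carrier I" "J a (rep_op \<rho> b v) \<in> carrier I"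
    using v bv by (simp_all add: J_closed)
  fix c w assume w: "w \<in> \<rho>.D"
  have "p (c\<^sup>\<star> * (a * b)) = p (c\<^sup>\<star> * a) * b"
    using b by (simp add: p_mult_right flip: mult.assoc)
  then show "ip I (J (a * b) v) (J c w) = ip I (J a (rep_op \<rho> b v)) (J c w)"
    using w v bv b by (simp add: J_ip \<rho>.rep_mult p_in)
qed

text \<open>To see that \<open>b \<otimes> v \<mapsto> ab \<otimes> v\<close> is well-defined on the quotient, the image is characterized by its
  inner products with all tensors, using \<open>a\<^sup>\<star>\<close>.\<close>

lemma left_mult_exists:
  assumes "x \<in> K0"
  shows "\<exists>y\<in>K0. \<forall>c. \<forall>w\<in>\<rho>.D. ip I y (J c w) = ip I x (J (a\<^sup>\<star> * c) w)"
  using assms tensors_closed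
proof (induction rule: I.vspan_induct)
  case (base x)
  then obtain b v where x: "x = J b v" "v \<in> \<rho>.D" by blast
  show ?case
  proof (intro bexI allI ballI)
    show "J (a * b) v \<in> K0" using x by (simp add: J_in_K0)
    fix c w assume "w \<in> \<rho>.D"
    then show "ip I (J (a * b) v) (J c w) = ip I x (J (a\<^sup>\<star> * c) w)"
      using x by (simp add: J_ip star_mult star_star mult.assoc)
  qed
next
  case zero
  show ?case
    by (rule bexI[OF _ I.vspan_zero[OF tensors_closed]]) (simp add: J_closed)
next
  case (add x y)
  then obtain x' y' where xy: "x' \<in> K0" "y' \<in> K0"
      "\<And>c w. w \<in> \<rho>.D \<Longrightarrow> ip I x' (J c w) = ip I x (J (a\<^sup>\<star> * c) w)"
      "\<And>c w. w \<in> \<rho>.D \<Longrightarrow> ip I y' (J c w) = ip I y (J (a\<^sup>\<star> * c) w)" by blast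
  show ?case
  proof (intro bexI allI ballI)
    show "x' \<oplus>\<^bsub>I\<^esub> y' \<in> K0" using xy by (intro I.vspan_add tensors_closed)
    fix c w assume "w \<in> \<rho>.D"
    then show "ip I (x' \<oplus>\<^bsub>I\<^esub> y') (J c w) = ip I (x \<oplus>\<^bsub>I\<^esub> y) (J (a\<^sup>\<star> * c) w)"
      using xy add by (simp add: I.ip_add_left K0_closed J_closed)
  qed
next
  case (smult d x)
  then obtain x' where x: "x' \<in> K0"
      "\<And>c w. w \<in> \<rho>.D \<Longrightarrow> ip I x' (J c w) = ip I x (J (a\<^sup>\<star> * c) w)" by blast
  show ?case
  proof (intro bexI allI ballI)
    show "d \<odot>\<^bsub>I\<^esub> x' \<in> K0" using x by (intro I.vspan_smult tensors_closed)
    fix c w assume "w \<in> \<rho>.D"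
    then show "ip I (d \<odot>\<^bsub>I\<^esub> x') (J c w) = ip I (d \<odot>\<^bsub>I\<^esub> x) (J (a\<^sup>\<star> * c) w)"
      using x smult by (simp add: I.ip_smult_left K0_closed J_closed)
  qed
qed

abbreviation "ind0 \<equiv> ind_rep0 G \<A> H \<rho>"

lemma ind0_simps: "rep_alg ind0 = UNIV" "rep_space ind0 = I" "rep_dom ind0 = K0"
  by (simp_all add: ind_rep0_def Let_def K0_eq)

text \<open>The property by which \<^const>\<open>ind_rep0\<close> selects the operator of \<open>a\<close>.\<close>

definition is_left_mult where
  "is_left_mult a L \<longleftrightarrow> L \<in> extensional K0 \<and> linear_map I K0 I L \<and>
    (\<forall>b. \<forall>v\<in>\<rho>.D. L (J b v) = J (a * b) v)"

lemma is_left_mult_unique: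
  assumes "is_left_mult a L" "is_left_mult a L'" shows "L = L'"
proof (rule extensionalityI)
  show "L \<in> extensional K0" "L' \<in> extensional K0" using assms by (auto simp: is_left_mult_def)
  fix x assume "x \<in> K0"
  from this tensors_closed show "L x = L' x"
  proof (induction rule: I.vspan_induct)
    case (base x) then show ?case using assms by (auto simp: is_left_mult_def)
  next
    case zero
    have "M \<zero>\<^bsub>I\<^esub> = \<zero>\<^bsub>I\<^esub>" if "is_left_mult a M" for M
      by (rule I.linear_map_zero[OF I.hermitian_space_axioms _ K0_submodule])
        (use that in \<open>simp add: is_left_mult_def\<close>)
    from this[OF assms(1)] this[OF assms(2)] show ?case by simp
  next
    case (add x y) then show ?case using assms by (simp add: is_left_mult_def linear_map_def)
  next
    case (smult c x) then show ?case using assms by (simp add: is_left_mult_def linear_map_def)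
  qed
qed

lemma left_mult:
  shows "is_left_mult a (rep_op ind0 a)"
    and "x \<in> K0 \<Longrightarrow> rep_op ind0 a x \<in> K0"
    and "\<lbrakk>x \<in> K0; w \<in> \<rho>.D\<rbrakk> \<Longrightarrow> ip I (rep_op ind0 a x) (J c w) = ip I x (J (a\<^sup>\<star> * c) w)"
proof -
  let ?adj = "\<lambda>x y. y \<in> K0 \<and> (\<forall>c. \<forall>w\<in>\<rho>.D. ip I y (J c w) = ip I x (J (a\<^sup>\<star> * c) w))"
  define L0 where "L0 x = (SOME y. ?adj x y)" for x
  have adj: "?adj x (L0 x)" if x: "x \<in> K0" for x
    unfolding L0_def by (rule someI_ex) (use left_mult_exists[OF x, of a] in blast)
  note L0 = conjunct1[OF adj] bspec[OF spec[OF conjunct2[OF adj]]]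
  define L where "L = restrict L0 K0"
  have L: "L x \<in> K0" if "x \<in> K0" for x using that L0 by (simp add: L_def)
  have Lip: "ip I (L x) (J c w) = ip I x (J (a\<^sup>\<star> * c) w)" if "x \<in> K0" "w \<in> \<rho>.D" for x c w
    using that L0 by (simp add: L_def)
  have lin: "linear_map I K0 I L"
    unfolding linear_map_def
  proof (intro conjI ballI allI)
    fix x assume x: "x \<in> K0"
    show "L x \<in> carrier I" using L x K0_closed by blast
    show "L (c \<odot>\<^bsub>I\<^esub> x) = c \<odot>\<^bsub>I\<^esub> L x" for c
    proof (rule I_eqI)
      have cx: "c \<odot>\<^bsub>I\<^esub> x \<in> K0" using x by (intro I.vspan_smult tensors_closed)
      show "L (c \<odot>\<^bsub>I\<^esub> x) \<in> carrier I" "c \<odot>\<^bsub>I\<^esub> L x \<in> carrier I"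
        using cx x L by (simp_all add: K0_closed)
      fix d w assume "w \<in> \<rho>.D"
      then show "ip I (L (c \<odot>\<^bsub>I\<^esub> x)) (J d w) = ip I (c \<odot>\<^bsub>I\<^esub> L x) (J d w)"
        using x cx L by (simp add: Lip I.ip_smult_left K0_closed J_closed)
    qed
    fix y assume y: "y \<in> K0"
    show "L (x \<oplus>\<^bsub>I\<^esub> y) = L x \<oplus>\<^bsub>I\<^esub> L y"
    proof (rule I_eqI)
      have xy: "x \<oplus>\<^bsub>I\<^esub> y \<in> K0" using x y by (intro I.vspan_add tensors_closed)
      show "L (x \<oplus>\<^bsub>I\<^esub> y) \<in> carrier I" "L x \<oplus>\<^bsub>I\<^esub> L y \<in> carrier I"
        using xy x y L by (simp_all add: K0_closed)
      fix d w assume "w \<in> \<rho>.D"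
      then show "ip I (L (x \<oplus>\<^bsub>I\<^esub> y)) (J d w) = ip I (L x \<oplus>\<^bsub>I\<^esub> L y) (J d w)"
        using x y xy L by (simp add: Lip I.ip_add_left K0_closed J_closed)
    qed
  qed
  have LJ: "L (J b v) = J (a * b) v" if v: "v \<in> \<rho>.D" for b v
  proof (rule I_eqI)
    show "L (J b v) \<in> carrier I" "J (a * b) v \<in> carrier I"
      using v L J_in_K0 K0_closed J_closed by blast+
    fix c w assume "w \<in> \<rho>.D"
    then show "ip I (L (J b v)) (J c w) = ip I (J (a * b) v) (J c w)"
      using v by (simp add: Lip J_in_K0 J_ip star_mult star_star mult.assoc)
  qed
  have isL: "is_left_mult a L"
    unfolding is_left_mult_def using lin LJ by (simp add: L_def)
  have op: "rep_op ind0 a = (THE L. is_left_mult a L)"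
    by (simp add: ind_rep0_def Let_def is_left_mult_def flip: K0_eq)
  have "rep_op ind0 a = L"
    unfolding op by (rule the_equality) (use isL is_left_mult_unique[OF _ isL] in blast)+
  then show "is_left_mult a (rep_op ind0 a)" "x \<in> K0 \<Longrightarrow> rep_op ind0 a x \<in> K0"
    "\<lbrakk>x \<in> K0; w \<in> \<rho>.D\<rbrakk> \<Longrightarrow> ip I (rep_op ind0 a x) (J c w) = ip I x (J (a\<^sup>\<star> * c) w)"
    using isL L Lip by simp_all
qed

lemma ind0_J: "v \<in> \<rho>.D \<Longrightarrow> rep_op ind0 a (J b v) = J (a * b) v"
  using left_mult(1)[of a] by (simp add: is_left_mult_def)

lemma ind0_adjoint:
  assumes x: "x \<in> K0" and y: "y \<in> K0"
  shows "ip I (rep_op ind0 a x) y = ip I x (rep_op ind0 (a\<^sup>\<star>) y)"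
  using y tensors_closed
proof (induction rule: I.vspan_induct)
  have lin: "linear_map I K0 I (rep_op ind0 (a\<^sup>\<star>))"
    using left_mult(1) by (simp add: is_left_mult_def)
  have ax: "rep_op ind0 a x \<in> carrier I" using left_mult(2)[OF x] by (rule K0_closed)
  have lc: "rep_op ind0 (a\<^sup>\<star>) z \<in> carrier I" if "z \<in> K0" for z
    using left_mult(2)[OF that] by (rule K0_closed)
  {
    case (base y)
    then show ?case using x by (auto simp: left_mult(3) ind0_J)
  next
    case zero
    have "rep_op ind0 (a\<^sup>\<star>) \<zero>\<^bsub>I\<^esub> = \<zero>\<^bsub>I\<^esub>"
      by (rule I.linear_map_zero[OF I.hermitian_space_axioms lin K0_submodule])
    then show ?case using ax x by (simp add: K0_closed)
  next
    case (add y z)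
    have "rep_op ind0 (a\<^sup>\<star>) (y \<oplus>\<^bsub>I\<^esub> z) = rep_op ind0 (a\<^sup>\<star>) y \<oplus>\<^bsub>I\<^esub> rep_op ind0 (a\<^sup>\<star>) z"
      using lin add by (simp add: linear_map_def)
    then show ?case using add ax x lc by (simp add: I.ip_add_right K0_closed)
  next
    case (smult c y)
    have "rep_op ind0 (a\<^sup>\<star>) (c \<odot>\<^bsub>I\<^esub> y) = c \<odot>\<^bsub>I\<^esub> rep_op ind0 (a\<^sup>\<star>) y"
      using lin smult by (simp add: linear_map_def)
    then show ?case using smult ax x lc by (simp add: I.ip_smult_right K0_closed)
  }
qed

sublocale ind0: adjointable_family ind0
  rewrites "rep_alg ind0 = UNIV" and "rep_space ind0 = I" and "rep_dom ind0 = K0"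
proof -
  show "adjointable_family ind0"
  proof (intro adjointable_family.intro operator_family.intro)
    show "inner_space (rep_space ind0)" unfolding ind0_simps ..
    show "operator_family_axioms ind0"
      by (rule operator_family_axioms.intro)
        (use K0_submodule left_mult(1) in \<open>simp_all add: ind0_simps is_left_mult_def\<close>)
    show "adjointable_family_axioms ind0"
      by (rule adjointable_family_axioms.intro)
        (use tensors_total ind0_adjoint in \<open>auto simp: ind0_simps\<close>)
  qed
qed (simp_all add: ind0_simps)

abbreviation "IndH \<equiv> Ind G \<A> H \<rho>"

lemma Ind_simps: "rep_alg IndH = UNIV" "rep_space IndH = I"
  "rep_dom IndH = {x. \<exists>F. graph_cauchy ind0 F \<and> limitin (vtop I) (\<lambda>x. x) x F}"
  unfolding Ind_def by (simp_all add: ind0.rep_closure_simps)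

lemma Ind_J:
  assumes "v \<in> \<rho>.D"
  shows "J b v \<in> rep_dom IndH" "rep_op IndH a (J b v) = J (a * b) v"
proof -
  note J = J_in_K0[OF assms, of b]
  show "J b v \<in> rep_dom IndH" unfolding Ind_def by (rule ind0.rep_closure_extends(1)[OF J])
  show "rep_op IndH a (J b v) = J (a * b) v"
    unfolding Ind_def using ind0.rep_closure_extends(2)[OF J UNIV_I, of a] ind0_J[OF assms] by simp
qed

end

section \<open>Projections and reducing subspaces\<close>

context inner_space
begin

lemma closure_of_closed: "vtop V closure_of S \<subseteq> carrier V"
  using closure_of_subset_topspace[of "vtop V" S] by simp

lemma orthogonal_closure:
  assumes X: "X \<subseteq> carrier V" and u: "u \<in> carrier V" and 0: "\<And>x. x \<in> X \<Longrightarrow> ip V u x = 0"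
    and z: "z \<in> vtop V closure_of (vspan V X)"
  shows "ip V u z = 0"
proof -
  have *: "ip V u z = 0" if "z \<in> vspan V X" for z
    using that X
  proof (induction rule: vspan_induct)
    case (base z) then show ?case by (rule 0)
  next
    case zero then show ?case using u by simp
  next
    case (add y z)
    then have "y \<in> carrier V" "z \<in> carrier V" using vspan_carrier[OF X] by blast+
    with add u show ?case by (simp add: ip_add_right)
  next
    case (smult c z)
    then have "z \<in> carrier V" using vspan_carrier[OF X] by blast
    with smult u show ?case by (simp add: ip_smult_right)
  qed
  obtain s where s: "\<And>n. s n \<in> vspan V X" "limitin (vtop V) s z sequentially"
    using closure_sequence[OF z vspan_carrier[OF X]] by blast
  have "(\<lambda>n. ip V u (s n)) \<longlonglongrightarrow> ip V u z" using s(2) u by (intro limit_ip) auto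
  moreover have "(\<lambda>n. ip V u (s n)) = (\<lambda>_. 0)" using * s(1) by auto
  ultimately show ?thesis by (simp add: LIMSEQ_const_iff)
qed

lemma proj_onto_eqI:
  assumes S: "submodule S complex_field V" and x: "x \<in> carrier V" and y: "y \<in> S"
    and orth: "\<And>z. z \<in> S \<Longrightarrow> ip V (x \<ominus> y) z = 0"
  shows "proj_onto V S x = y"
  unfolding proj_onto_def
proof (rule the_equality)
  show "y \<in> S \<and> (\<forall>z\<in>S. ip V (x \<ominus> y) z = 0)" using y orth by blast
  fix y' assume y': "y' \<in> S \<and> (\<forall>z\<in>S. ip V (x \<ominus> y') z = 0)"
  have c: "y \<in> carrier V" "y' \<in> carrier V" using S y y' by (auto simp: submodule_iff)
  let ?d = "y' \<ominus> y"
  have d: "?d \<in> S" using S y y' c by (auto simp: submodule_iff minus_scalar)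
  have "ip V ?d ?d = ip V (x \<ominus> y) ?d - ip V (x \<ominus> y') ?d"
    using c x by (simp add: ip_diff_left)
  also have "\<dots> = 0" using orth[OF d] y' d by simp
  finally have "?d = \<zero>" using c by (intro ip_definite) auto
  then show "y' = y" by (rule minus_eq_zero[OF c(2,1)])
qed

lemma op_closure_iff:
  assumes T: "T \<subseteq> carrier V \<times> carrier V"
  shows "(x, y) \<in> op_closure V T \<longleftrightarrow> x \<in> carrier V \<and> y \<in> carrier V \<and>
    (\<forall>r>0. \<exists>(u, w)\<in>T. vnorm V (x \<ominus> u) < r \<and> vnorm V (y \<ominus> w) < r)" (is "?L \<longleftrightarrow> ?R")
proof
  assume l: ?L
  then have xy: "x \<in> carrier V" "y \<in> carrier V"
    unfolding op_closure_def in_closure_of by auto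
  have l': "\<exists>q. q \<in> T \<and> q \<in> Q" if "(x, y) \<in> Q" "openin (prod_topology (vtop V) (vtop V)) Q" for Q
    using conjunct2[OF l[unfolded op_closure_def in_closure_of]] that by (elim allE[of _ Q]) simp
  have "\<exists>(u, w)\<in>T. vnorm V (x \<ominus> u) < r \<and> vnorm V (y \<ominus> w) < r" if r: "r > 0" for r
  proof -
    have 1: "openin (prod_topology (vtop V) (vtop V)) (M.mball x r \<times> M.mball y r)"
      by (simp add: openin_prod_Times_iff)
    have 2: "(x, y) \<in> M.mball x r \<times> M.mball y r" using xy r by simp
    obtain q where q: "q \<in> T" "q \<in> M.mball x r \<times> M.mball y r"
      using l'[OF 2 1] by blast
    then have "vnorm V (x \<ominus> fst q) < r \<and> vnorm V (y \<ominus> snd q) < r"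
      using T xy by (auto simp: mem_Times_iff)
    with q(1) show ?thesis by (intro bexI[of _ q]) (simp_all add: case_prod_unfold)
  qed
  with xy show ?R by blast
next
  assume r: ?R
  show ?L
    unfolding op_closure_def in_closure_of
  proof (intro conjI allI impI)
    show "(x, y) \<in> topspace (prod_topology (vtop V) (vtop V))" using r by simp
    fix Q assume Q: "(x, y) \<in> Q \<and> openin (prod_topology (vtop V) (vtop V)) Q"
    then obtain A B where AB: "openin (vtop V) A" "openin (vtop V) B" "x \<in> A" "y \<in> B" "A \<times> B \<subseteq> Q"
      unfolding openin_prod_topology_alt by blast
    then obtain r1 r2 where r12: "r1 > 0" "M.mball x r1 \<subseteq> A" "r2 > 0" "M.mball y r2 \<subseteq> B"
      unfolding M.openin_mtopology by meson
    have "min r1 r2 > 0" using r12 by simp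
    with r have "\<exists>(u, w)\<in>T. vnorm V (x \<ominus> u) < min r1 r2 \<and> vnorm V (y \<ominus> w) < min r1 r2" by blast
    then obtain u w where uw: "(u, w) \<in> T" "vnorm V (x \<ominus> u) < min r1 r2" "vnorm V (y \<ominus> w) < min r1 r2"
      by blast
    moreover have "u \<in> carrier V" "w \<in> carrier V" using uw T by auto
    ultimately have "u \<in> M.mball x r1" "w \<in> M.mball y r2" using r by auto
    then have "(u, w) \<in> Q" using r12 AB by blast
    with uw(1) show "\<exists>q. q \<in> T \<and> q \<in> Q" by blast
  qed
qed

end

locale projection_on = V: hilbert V
  for V :: "'v ip_space" and Pr :: "'v \<Rightarrow> 'v" +
  assumes projection: "projection V Pr"
begin

lemma Pr_closed [simp]: "x \<in> carrier V \<Longrightarrow> Pr x \<in> carrier V"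
  and Pr_add: "\<lbrakk>x \<in> carrier V; y \<in> carrier V\<rbrakk> \<Longrightarrow> Pr (x \<oplus>\<^bsub>V\<^esub> y) = Pr x \<oplus>\<^bsub>V\<^esub> Pr y"
  and Pr_smult: "x \<in> carrier V \<Longrightarrow> Pr (c \<odot>\<^bsub>V\<^esub> x) = c \<odot>\<^bsub>V\<^esub> Pr x"
  and Pr_idem: "x \<in> carrier V \<Longrightarrow> Pr (Pr x) = Pr x"
  and Pr_sym: "\<lbrakk>x \<in> carrier V; y \<in> carrier V\<rbrakk> \<Longrightarrow> ip V (Pr x) y = ip V x (Pr y)"
  using projection unfolding projection_def linear_map_def by blast+

lemma Pr_minus: "\<lbrakk>x \<in> carrier V; y \<in> carrier V\<rbrakk> \<Longrightarrow> Pr (x \<ominus>\<^bsub>V\<^esub> y) = Pr x \<ominus>\<^bsub>V\<^esub> Pr y"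
  by (simp add: V.minus_scalar Pr_add Pr_smult)

lemma Pr_zero: "Pr \<zero>\<^bsub>V\<^esub> = \<zero>\<^bsub>V\<^esub>"
  using Pr_smult[of "\<zero>\<^bsub>V\<^esub>" 0] by simp

lemma Pr_norm: assumes x: "x \<in> carrier V" shows "vnorm V (Pr x) \<le> vnorm V x"
proof -
  have "complex_of_real ((vnorm V (Pr x))\<^sup>2) = ip V (Pr x) (Pr x)" using x V.ip_self by simp
  also have "\<dots> = ip V x (Pr x)" using x Pr_sym[of x "Pr x"] Pr_idem by simp
  finally have "(vnorm V (Pr x))\<^sup>2 = cmod (ip V x (Pr x))" by (metis abs_of_nonneg norm_of_real zero_le_power2)
  also have "\<dots> \<le> vnorm V x * vnorm V (Pr x)" using x by (intro V.Cauchy_Schwarz) auto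
  finally have le: "vnorm V (Pr x) * vnorm V (Pr x) \<le> vnorm V x * vnorm V (Pr x)"
    by (simp add: power2_eq_square)
  show ?thesis
  proof (cases "vnorm V (Pr x) = 0")
    case False
    then have "vnorm V (Pr x) > 0" using x by (simp add: less_le)
    with le show ?thesis by simp
  qed (use x in simp)
qed

lemma Pr_limit:
  assumes "limitin (vtop V) f l F" shows "limitin (vtop V) (\<lambda>x. Pr (f x)) (Pr l) F"
proof (rule V.limit_le)
  have l: "l \<in> carrier V" and f: "eventually (\<lambda>x. f x \<in> carrier V) F"
    and 0: "((\<lambda>x. vnorm V (f x \<ominus>\<^bsub>V\<^esub> l)) \<longlongrightarrow> 0) F"
    using assms by (auto simp: V.limit_iff)
  show "Pr l \<in> carrier V" using l by simp
  show "eventually (\<lambda>x. Pr (f x) \<in> carrier V) F" using f by eventually_elim simp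
  show "eventually (\<lambda>x. vnorm V (Pr (f x) \<ominus>\<^bsub>V\<^esub> Pr l) \<le> vnorm V (f x \<ominus>\<^bsub>V\<^esub> l)) F"
    using f
  proof eventually_elim
    case (elim x)
    then show ?case using l Pr_norm[of "f x \<ominus>\<^bsub>V\<^esub> l"] by (simp add: Pr_minus)
  qed
  show "((\<lambda>x. vnorm V (f x \<ominus>\<^bsub>V\<^esub> l)) \<longlongrightarrow> 0) F" by (rule 0)
qed

abbreviation "S \<equiv> Pr ` carrier V"
abbreviation "VS \<equiv> V\<lparr>carrier := S\<rparr>"

lemma S_iff: "x \<in> S \<longleftrightarrow> x \<in> carrier V \<and> Pr x = x"
  by (auto simp: Pr_idem intro: rev_image_eqI)

lemma S_submodule: "submodule S complex_field V"
  unfolding V.submodule_iff by (auto simp: S_iff Pr_add Pr_smult Pr_zero Pr_idem)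

lemma S_closedin: "closedin (vtop V) S"
proof -
  have "vtop V closure_of S \<subseteq> S"
  proof
    fix x assume "x \<in> vtop V closure_of S"
    then obtain s where s: "\<And>n. s n \<in> S" "limitin (vtop V) s x sequentially"
      using V.closure_sequence[of x S] S_iff by blast
    have "limitin (vtop V) (\<lambda>n. Pr (s n)) (Pr x) sequentially" by (rule Pr_limit[OF s(2)])
    moreover have "(\<lambda>n. Pr (s n)) = s" using s(1) S_iff by blast
    ultimately have "limitin (vtop V) s (Pr x) sequentially" by simp
    then have "Pr x = x" using s(2) by (rule V.limit_unique) simp
    then show "x \<in> S" using V.limit_carrier[OF s(2)] by (simp add: S_iff)
  qed
  then show ?thesis using S_iff by (subst closure_of_subset_eq[symmetric]) auto
qed

lemma hilbert_VS: "hilbert VS"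
  by (rule V.hilbert_subspace[OF S_submodule S_closedin])

sublocale VS: hilbert VS
  by (rule hilbert_VS)

lemma VS_minus: "\<lbrakk>x \<in> S; y \<in> S\<rbrakk> \<Longrightarrow> x \<ominus>\<^bsub>VS\<^esub> y = x \<ominus>\<^bsub>V\<^esub> y"
  by (rule V.subspace_minus[OF S_submodule])

text \<open>An approximation of a point of \<open>S \<times> S\<close> by points of the graph of \<open>f\<close> is improved by applying the
  projection, which does not increase norms and leads to points of the graph over \<open>S\<close>.\<close>

lemma op_closure_reduced:
  assumes D: "D \<subseteq> carrier V" and f: "\<And>x. x \<in> D \<Longrightarrow> f x \<in> carrier V"
    and PrD: "\<And>x. x \<in> D \<Longrightarrow> Pr x \<in> D \<and> Pr (f x) = f (Pr x)"
  shows "op_closure VS {(x, f x) | x. x \<in> S \<inter> D} = op_closure V {(x, f x) | x. x \<in> D} \<inter> S \<times> S"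
proof -
  let ?T = "{(x, f x) | x. x \<in> D}" and ?TS = "{(x, f x) | x. x \<in> S \<inter> D}"
  have fS: "f x \<in> S" if "x \<in> S" "x \<in> D" for x
    using PrD[OF that(2)] that f S_iff by auto
  have T: "?T \<subseteq> carrier V \<times> carrier V" using D f by blast
  have TS: "?TS \<subseteq> carrier VS \<times> carrier VS" using fS by auto
  have "(x, y) \<in> op_closure VS ?TS \<longleftrightarrow> (x, y) \<in> op_closure V ?T" if xy: "x \<in> S" "y \<in> S" for x y
  proof -
    have xyV: "x \<in> carrier V" "y \<in> carrier V" using xy S_iff by auto
    have "(\<exists>(u, w)\<in>?TS. vnorm VS (x \<ominus>\<^bsub>VS\<^esub> u) < r \<and> vnorm VS (y \<ominus>\<^bsub>VS\<^esub> w) < r) \<longleftrightarrow>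
        (\<exists>(u, w)\<in>?T. vnorm V (x \<ominus>\<^bsub>V\<^esub> u) < r \<and> vnorm V (y \<ominus>\<^bsub>V\<^esub> w) < r)" (is "?A \<longleftrightarrow> ?B") for r
    proof
      assume ?A
      then obtain u where u: "u \<in> S" "u \<in> D" "vnorm VS (x \<ominus>\<^bsub>VS\<^esub> u) < r" "vnorm VS (y \<ominus>\<^bsub>VS\<^esub> f u) < r"
        by blast
      then have "vnorm V (x \<ominus>\<^bsub>V\<^esub> u) < r" "vnorm V (y \<ominus>\<^bsub>V\<^esub> f u) < r"
        using VS_minus[OF xy(1) u(1)] VS_minus[OF xy(2) fS[OF u(1,2)]] by simp_all
      then show ?B using u(2) by blast
    next
      assume ?B
      then obtain u where u: "u \<in> D" "vnorm V (x \<ominus>\<^bsub>V\<^esub> u) < r" "vnorm V (y \<ominus>\<^bsub>V\<^esub> f u) < r" by blast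
      have uV: "u \<in> carrier V" "f u \<in> carrier V" using u D f by auto
      have Pu: "Pr u \<in> S" "Pr u \<in> D" using uV PrD[OF u(1)] by auto
      have "x \<ominus>\<^bsub>V\<^esub> Pr u = Pr (x \<ominus>\<^bsub>V\<^esub> u)" "y \<ominus>\<^bsub>V\<^esub> f (Pr u) = Pr (y \<ominus>\<^bsub>V\<^esub> f u)"
        using xy uV PrD[OF u(1)] by (simp_all add: Pr_minus S_iff)
      then have "vnorm V (x \<ominus>\<^bsub>V\<^esub> Pr u) < r" "vnorm V (y \<ominus>\<^bsub>V\<^esub> f (Pr u)) < r"
        using u(2,3) xyV uV Pr_norm[of "x \<ominus>\<^bsub>V\<^esub> u"] Pr_norm[of "y \<ominus>\<^bsub>V\<^esub> f u"] by simp_all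
      then have "vnorm VS (x \<ominus>\<^bsub>VS\<^esub> Pr u) < r" "vnorm VS (y \<ominus>\<^bsub>VS\<^esub> f (Pr u)) < r"
        using VS_minus[OF xy(1) Pu(1)] VS_minus[OF xy(2) fS[OF Pu]] by simp_all
      then show ?A using Pu by blast
    qed
    then show ?thesis
      unfolding VS.op_closure_iff[OF TS] V.op_closure_iff[OF T] using xy xyV by simp
  qed
  moreover have "op_closure VS ?TS \<subseteq> S \<times> S"
  proof
    fix q assume q: "q \<in> op_closure VS ?TS"
    then have "(fst q, snd q) \<in> op_closure VS ?TS" by simp
    then show "q \<in> S \<times> S" unfolding VS.op_closure_iff[OF TS] by (auto simp: mem_Times_iff)
  qed
  ultimately show ?thesis by auto
qed

text \<open>For \<open>y\<close> and \<open>z\<close> in \<open>S\<close> the condition on \<open>x\<close> only involves \<open>Pr x\<close>.\<close>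

lemma op_adjoint_reduced:
  assumes D: "D \<subseteq> carrier V" and f: "\<And>x. x \<in> D \<Longrightarrow> f x \<in> carrier V"
    and PrD: "\<And>x. x \<in> D \<Longrightarrow> Pr x \<in> D \<and> Pr (f x) = f (Pr x)"
  shows "op_adjoint VS {(x, f x) | x. x \<in> S \<inter> D} = op_adjoint V {(x, f x) | x. x \<in> D} \<inter> S \<times> S"
proof -
  have *: "(\<forall>x\<in>S \<inter> D. ip V (f x) y = ip V x z) \<longleftrightarrow> (\<forall>x\<in>D. ip V (f x) y = ip V x z)" (is "?A \<longleftrightarrow> ?B")
    if yz: "y \<in> S" "z \<in> S" for y z
  proof
    assume a: ?A
    show ?B
    proof
      fix x assume x: "x \<in> D"
      have yzV: "y \<in> carrier V" "z \<in> carrier V" "Pr y = y" "Pr z = z" using yz S_iff by auto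
      have xV: "x \<in> carrier V" "f x \<in> carrier V" using x D f by auto
      have "ip V (f x) y = ip V (Pr (f x)) y" using Pr_sym[OF xV(2) yzV(1)] yzV by simp
      also have "\<dots> = ip V (f (Pr x)) y" using PrD[OF x] by simp
      also have "\<dots> = ip V (Pr x) z" using a PrD[OF x] xV by blast
      also have "\<dots> = ip V x z" using Pr_sym[OF xV(1) yzV(2)] yzV by simp
      finally show "ip V (f x) y = ip V x z" .
    qed
  qed blast
  have l: "(y, z) \<in> op_adjoint VS {(x, f x) | x. x \<in> S \<inter> D} \<longleftrightarrow>
      y \<in> S \<and> z \<in> S \<and> (\<forall>x\<in>S \<inter> D. ip V (f x) y = ip V x z)" for y z
    unfolding op_adjoint_def subspace_record_simps by simp blast
  have r: "(y, z) \<in> op_adjoint V {(x, f x) | x. x \<in> D} \<longleftrightarrow>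
      y \<in> carrier V \<and> z \<in> carrier V \<and> (\<forall>x\<in>D. ip V (f x) y = ip V x z)" for y z
    unfolding op_adjoint_def by simp blast
  show ?thesis
  proof (rule Set.set_eqI)
    fix q :: "'v \<times> 'v"
    obtain y z where q: "q = (y, z)" by fastforce
    show "q \<in> op_adjoint VS {(x, f x) | x. x \<in> S \<inter> D} \<longleftrightarrow> q \<in> op_adjoint V {(x, f x) | x. x \<in> D} \<inter> S \<times> S"
      unfolding q l unfolding Int_iff mem_Sigma_iff r using *[of y z] S_iff[of y] S_iff[of z] by blast
  qed
qed

end

text \<open>For a projection that commutes with a spectral measure, spectral integrals are reduced by its
  range: all ingredients of their definition stay in the range.\<close>

locale spectral_reduction = projection_on V Pr
  for V :: "'v ip_space" and Pr :: "'v \<Rightarrow> 'v" +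
  fixes M :: "'x measure" and E :: "'x set \<Rightarrow> 'v \<Rightarrow> 'v"
  assumes E: "spectral_measure M V E"
    and commute: "\<lbrakk>\<Delta> \<in> sets M; x \<in> carrier V\<rbrakk> \<Longrightarrow> Pr (E \<Delta> x) = E \<Delta> (Pr x)"
begin

lemma E_projection: "\<Delta> \<in> sets M \<Longrightarrow> projection V (E \<Delta>)"
  and E_space: "x \<in> carrier V \<Longrightarrow> E (space M) x = x"
  and E_limit: "\<lbrakk>range A \<subseteq> sets M; disjoint_family A; x \<in> carrier V\<rbrakk> \<Longrightarrow>
    limitin (vtop V) (\<lambda>n::nat. \<Oplus>\<^bsub>V\<^esub>i\<in>{..<n}. E (A i) x) (E (\<Union>i. A i) x) sequentially"
  using E unfolding spectral_measure_def by blast+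

lemma E_closed: "\<lbrakk>\<Delta> \<in> sets M; x \<in> carrier V\<rbrakk> \<Longrightarrow> E \<Delta> x \<in> carrier V"
  using E_projection[of \<Delta>] unfolding projection_def linear_map_def by blast

lemma E_S: "\<lbrakk>\<Delta> \<in> sets M; x \<in> S\<rbrakk> \<Longrightarrow> E \<Delta> x \<in> S"
  using commute[of \<Delta> x] E_closed[of \<Delta> x] by (simp add: S_iff)

lemma spectral_measure_reduced: "spectral_measure M VS E"
  unfolding spectral_measure_def
proof (intro conjI ballI allI impI)
  fix \<Delta> assume \<Delta>: "\<Delta> \<in> sets M"
  have SV: "x \<in> S \<Longrightarrow> x \<in> carrier V" for x by (simp add: S_iff)
  show "projection VS (E \<Delta>)"
    using E_projection[OF \<Delta>] E_S[OF \<Delta>] SV unfolding projection_def linear_map_def by simp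
next
  fix x assume "x \<in> carrier VS"
  then show "E (space M) x = x" by (simp add: E_space S_iff)
next
  fix \<Delta> :: "nat \<Rightarrow> 'x set" and x
  assume \<Delta>: "range \<Delta> \<subseteq> sets M \<and> disjoint_family \<Delta>" and "x \<in> carrier VS"
  then have x: "x \<in> S" by simp
  have fin: "(\<Oplus>\<^bsub>VS\<^esub>i\<in>{..<n}. E (\<Delta> i) x) = (\<Oplus>\<^bsub>V\<^esub>i\<in>{..<n}. E (\<Delta> i) x) \<and>
      (\<Oplus>\<^bsub>V\<^esub>i\<in>{..<n}. E (\<Delta> i) x) \<in> S" for n
    using \<Delta> E_S[OF _ x] by (intro V.finsum_subspace[OF S_submodule]) auto
  have "E (\<Union>i. \<Delta> i) x \<in> S" using \<Delta> by (intro E_S x sets.countable_UN) auto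
  moreover have "limitin (vtop V) (\<lambda>n. \<Oplus>\<^bsub>V\<^esub>i\<in>{..<n}. E (\<Delta> i) x) (E (\<Union>i. \<Delta> i) x) sequentially"
    using \<Delta> x by (intro E_limit) (auto simp: S_iff)
  ultimately show "limitin (vtop VS) (\<lambda>n. \<Oplus>\<^bsub>VS\<^esub>i\<in>{..<n}. E (\<Delta> i) x) (E (\<Union>i. \<Delta> i) x) sequentially"
    unfolding V.limit_subspace[OF S_submodule] using fin by simp
qed

lemma spectral_integral_reduced:
  "spectral_integral M VS E f = spectral_integral M V E f \<inter> S \<times> S"
proof -
  have sc: "scalar_measure M VS E x = scalar_measure M V E x" for x
    by (simp add: scalar_measure_def)
  have simple: "simple_spectral_integral M VS E s x = simple_spectral_integral M V E s x \<and>
      simple_spectral_integral M V E s x \<in> S" if s: "simple_function M s" and x: "x \<in> S" for s x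
  proof -
    have "c \<odot>\<^bsub>V\<^esub> E (s -` {c} \<inter> space M) x \<in> S" if "c \<in> s ` space M" for c
    proof -
      have "s -` {c} \<inter> space M \<in> sets M" using s that unfolding simple_function_def by blast
      from E_S[OF this x] show ?thesis using Pr_smult by (simp only: S_iff) simp
    qed
    moreover have "finite (s ` space M)" using s by (simp add: simple_function_def)
    ultimately show ?thesis
      unfolding simple_spectral_integral_def subspace_record_simps
      by (intro V.finsum_subspace[OF S_submodule])
  qed
  have lim: "limitin (vtop VS) (\<lambda>n. simple_spectral_integral M VS E (s n) x) y sequentially \<longleftrightarrow>
      limitin (vtop V) (\<lambda>n. simple_spectral_integral M V E (s n) x) y sequentially \<and> y \<in> S"
    if s: "\<forall>n::nat. simple_function M (s n)" and x: "x \<in> S" for s x y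
    unfolding V.limit_subspace[OF S_submodule] using simple[OF _ x] s by auto
  have "(x, y) \<in> spectral_integral M VS E f \<longleftrightarrow> (x, y) \<in> spectral_integral M V E f \<and> x \<in> S \<and> y \<in> S" for x y
  proof (cases "x \<in> S")
    case True
    then have "x \<in> carrier V" by (simp add: S_iff)
    then show ?thesis
      unfolding spectral_integral_def using True lim[OF _ True] by (auto simp: sc)
  next
    case False
    then show ?thesis by (simp add: spectral_integral_def)
  qed
  then show ?thesis by auto
qed

end

section \<open>The representation on the range of \<open>E H\<close>\<close>

locale imprimitivity = graded_subgroup G \<A> H
  for G :: "('g, 'm) monoid_scheme" and \<A> :: "'g \<Rightarrow> 'a::complex_star_algebra set" and H +
  fixes \<pi> :: "('a, 'h) rep" and E :: "'g set \<Rightarrow> 'h \<Rightarrow> 'h" and E\<^sub>\<pi>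
  assumes system: "imprimitivity_system G \<A> H \<pi> E"
    and nondegenerate: "nondegenerate_system G \<A> H \<pi> E"
    and well_behaved: "well_behaved_with G \<A> (carrier G) \<pi> E\<^sub>\<pi>"
    and commuting: "\<lbrakk>t \<in> lcosets\<^bsub>G\<^esub> H; \<Delta> \<in> sets (char_borel G \<A>); x \<in> carrier (rep_space \<pi>)\<rbrakk> \<Longrightarrow>
      E t (E\<^sub>\<pi> \<Delta> x) = E\<^sub>\<pi> \<Delta> (E t x)"

sublocale imprimitivity \<subseteq> \<pi>: star_rep UNIV \<pi>
  using system unfolding imprimitivity_system_def Let_def by unfold_locales simp_all

context imprimitivity
begin

abbreviation "V \<equiv> \<pi>.V"
abbreviation "D \<equiv> \<pi>.D"
abbreviation "Cos \<equiv> lcosets\<^bsub>G\<^esub> H"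

lemmas system_axioms = system[unfolded imprimitivity_system_def Let_def]

lemma E_projection: "t \<in> Cos \<Longrightarrow> projection V (E t)"
  using conjunct1[OF conjunct2[OF system_axioms]] by (rule bspec)

lemma E_orthogonal: "\<lbrakk>t \<in> Cos; u \<in> Cos; t \<noteq> u; x \<in> carrier V\<rbrakk> \<Longrightarrow> E t (E u x) = \<zero>\<^bsub>V\<^esub>"
  using conjunct1[OF conjunct2[OF conjunct2[OF system_axioms]]] by blast

lemma E_sum: "x \<in> carrier V \<Longrightarrow>
    limitin (vtop V) (\<lambda>F. \<Oplus>\<^bsub>V\<^esub>t\<in>F. E t x) x (finite_subsets_at_top Cos)"
  using conjunct1[OF conjunct2[OF conjunct2[OF conjunct2[OF system_axioms]]]] by (rule bspec)

lemma E_covariant: "\<lbrakk>g \<in> carrier G; t \<in> Cos; a \<in> \<A> g; x \<in> D\<rbrakk> \<Longrightarrow>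
    E t x \<in> D \<and> E (g <#\<^bsub>G\<^esub> t) (rep_op \<pi> a x) = rep_op \<pi> a (E t x)"
  using conjunct2[OF conjunct2[OF conjunct2[OF conjunct2[OF system_axioms]]]] by blast

lemma E_D: "\<lbrakk>t \<in> Cos; x \<in> D\<rbrakk> \<Longrightarrow> E t x \<in> D"
  using E_covariant[OF G.one_closed _ one_homogeneous] by blast

lemma H_Cos: "H \<in> Cos"
  using G.lcos_mult_one[OF H_subset] G.one_closed unfolding LCOSETS_def by blast

lemma Cos_mult: "\<lbrakk>g \<in> carrier G; t \<in> Cos\<rbrakk> \<Longrightarrow> g <#\<^bsub>G\<^esub> t \<in> Cos"
  unfolding LCOSETS_def using G.lcos_m_assoc[OF H_subset] by auto

lemma Cos_subset: "t \<in> Cos \<Longrightarrow> t \<subseteq> carrier G"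
  unfolding LCOSETS_def using G.l_coset_subset_G[OF H_subset] by auto

lemma Cos_repr: assumes t: "t \<in> Cos" and g: "g \<in> t" shows "g <#\<^bsub>G\<^esub> H = t"
proof -
  obtain x where x: "x \<in> carrier G" "t = x <#\<^bsub>G\<^esub> H" using t unfolding LCOSETS_def by blast
  show ?thesis using G.l_repr_independence[OF _ x(1) subgroup_H, of g] g x(2) by simp
qed

lemma Cos_inverse: "\<lbrakk>g \<in> carrier G; t \<in> Cos\<rbrakk> \<Longrightarrow> g <#\<^bsub>G\<^esub> (inv\<^bsub>G\<^esub> g <#\<^bsub>G\<^esub> t) = t"
  "\<lbrakk>g \<in> carrier G; t \<in> Cos\<rbrakk> \<Longrightarrow> inv\<^bsub>G\<^esub> g <#\<^bsub>G\<^esub> (g <#\<^bsub>G\<^esub> t) = t"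
  using Cos_subset by (simp_all add: G.lcos_m_assoc G.lcos_mult_one)

lemma projection_on_E: "t \<in> Cos \<Longrightarrow> projection_on V (E t)"
  using E_projection by unfold_locales

sublocale EH: projection_on V "E H"
  by (rule projection_on_E[OF H_Cos])

abbreviation "S \<equiv> EH.S"
abbreviation "VS \<equiv> EH.VS"
abbreviation "DH \<equiv> S \<inter> D"

lemma DH_iff: "x \<in> DH \<longleftrightarrow> x \<in> D \<and> E H x = x"
  by (auto simp: EH.S_iff EH.Pr_idem)

lemma EH_DH: "x \<in> D \<Longrightarrow> E H x \<in> DH"
  using E_D[OF H_Cos] by simp

text \<open>By covariance, \<open>E(gH)\<pi>(a) = \<pi>(a)E(H)\<close> for \<open>a\<close> of degree \<open>g\<close>.\<close>

lemma part_range: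
  assumes t: "t \<in> Cos" and a: "a \<in> graded_part \<A> t" and v: "v \<in> DH"
  shows "E t (rep_op \<pi> a v) = rep_op \<pi> a v"
  using a
proof (induction a rule: graded_part_induct)
  interpret Et: projection_on V "E t" by (rule projection_on_E[OF t])
  have vD: "v \<in> D" "E H v = v" using v DH_iff by auto
  have [simp]: "rep_op \<pi> a v \<in> carrier V" for a using vD by (simp add: \<pi>.alg)
  {
    case zero
    have "rep_op \<pi> 0 v = \<zero>\<^bsub>V\<^esub>" using \<pi>.rep_scale[of 0 v 0] vD by simp
    then show ?case by (simp add: Et.Pr_zero)
  next
    case (add a b) then show ?case by (simp add: \<pi>.rep_add vD Et.Pr_add)
  next
    case (scale c a) then show ?case by (simp add: \<pi>.rep_scale vD Et.Pr_smult)
  next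
    case (homogeneous g a)
    have g: "g \<in> carrier G" using homogeneous Cos_subset[OF t] by blast
    show ?case
      using E_covariant[OF g H_Cos homogeneous(2) vD(1)] Cos_repr[OF t homogeneous(1)] vD(2) by simp
  }
qed

lemma DH_invariant: "\<lbrakk>a \<in> A_H; v \<in> DH\<rbrakk> \<Longrightarrow> rep_op \<pi> a v \<in> DH"
  using part_range[OF H_Cos, of a v] \<pi>.dom_invariant[of a v] DH_iff by auto

text \<open>For \<open>g \<notin> H\<close> the vector \<open>\<pi>(a\<^sub>g) v\<close> lies in the range of \<open>E(gH)\<close>, which is orthogonal to \<open>w\<close>.\<close>

lemma ip_conditional_expectation:
  assumes v: "v \<in> DH" and w: "w \<in> DH"
  shows "ip V (rep_op \<pi> (p c) v) w = ip V (rep_op \<pi> c v) w"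
proof (induction c rule: homogeneous_induct)
  have vD: "v \<in> D" "E H v = v" and wD: "w \<in> D" "E H w = w" using v w DH_iff by auto
  have [simp]: "rep_op \<pi> a v \<in> carrier V" "w \<in> carrier V" for a using vD wD by (simp_all add: \<pi>.alg)
  {
    case zero show ?case by simp
  next
    case (add a b)
    then show ?case by (simp add: proj_add \<pi>.rep_add vD \<pi>.V.ip_add_left)
  next
    case (scale c a)
    then show ?case by (simp add: proj_scale \<pi>.rep_scale vD \<pi>.V.ip_smult_left)
  next
    case (homogeneous g a)
    show ?case
    proof (cases "g \<in> H")
      case True
      then show ?thesis using proj_homogeneous[OF homogeneous, of H] by simp
    next
      case False
      have gH: "g <#\<^bsub>G\<^esub> H \<in> Cos" using Cos_mult homogeneous(1) H_Cos by blast
      have ne: "H \<noteq> g <#\<^bsub>G\<^esub> H" using G.lcos_self[OF homogeneous(1) subgroup_H] False by blast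
      have "ip V (rep_op \<pi> a v) w = ip V (E (g <#\<^bsub>G\<^esub> H) (rep_op \<pi> a v)) (E H w)"
        using E_covariant[OF homogeneous(1) H_Cos homogeneous(2) vD(1)] vD(2) wD(2) by simp
      also have "\<dots> = ip V (E H (E (g <#\<^bsub>G\<^esub> H) (rep_op \<pi> a v))) w"
        using projection_on.Pr_closed[OF projection_on_E[OF gH]] by (simp add: EH.Pr_sym)
      also have "\<dots> = 0" using E_orthogonal[OF H_Cos gH ne] by simp
      moreover have "rep_op \<pi> 0 v = \<zero>\<^bsub>V\<^esub>" using \<pi>.rep_scale[of 0 v 0] vD by simp
      ultimately show ?thesis using proj_homogeneous[OF homogeneous, of H] False by simp
    qed
  }
qed

text \<open>This identifies the inner products of the vectors \<open>\<pi>(a)v\<close> with those of the tensors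
  \<open>[a \<otimes> v]\<close>.\<close>

lemma gram_DH:
  assumes v: "v \<in> DH" and w: "w \<in> DH"
  shows "ip V (rep_op \<pi> a v) (rep_op \<pi> b w) = ip V (rep_op \<pi> (p (b\<^sup>\<star> * a)) v) w"
proof -
  have vD: "v \<in> D" and wD: "w \<in> D" using v w by auto
  have aD: "rep_op \<pi> a v \<in> D" using vD \<pi>.dom_invariant by blast
  have "ip V (rep_op \<pi> (b\<^sup>\<star> * a) v) w = ip V (rep_op \<pi> a v) (rep_op \<pi> b w)"
    using \<pi>.rep_mult[of "b\<^sup>\<star>" a v] \<pi>.rep_star[of "b\<^sup>\<star>" "rep_op \<pi> a v" w] vD wD aD by (simp add: star_star)
  then show ?thesis using ip_conditional_expectation[OF v w] by simp
qed

definition \<rho> :: "('a, 'h) rep" where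
  "\<rho> = \<lparr>rep_alg = A_H, rep_space = VS, rep_dom = DH, rep_op = rep_op \<pi>\<rparr>"

lemma \<rho>_simps [simp]: "rep_alg \<rho> = A_H" "rep_space \<rho> = VS" "rep_dom \<rho> = DH" "rep_op \<rho> = rep_op \<pi>"
  by (simp_all add: \<rho>_def)

lemma star_representation_\<rho>: "star_representation A_H \<rho>"
proof -
  have D: "x \<in> D" if "x \<in> DH" for x using that by blast
  have dense: "vtop VS closure_of DH = carrier VS"
  proof -
    have "S \<subseteq> vtop V closure_of DH"
    proof
      fix x assume x: "x \<in> S"
      then have xV: "x \<in> carrier V" "E H x = x" using EH.S_iff by blast+
      then have "x \<in> vtop V closure_of D" using \<pi>.dense_dom by simp
      moreover have "D \<subseteq> carrier V" using \<pi>.D_closed by blast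
      ultimately obtain s where s: "\<And>n. s n \<in> D" "limitin (vtop V) s x sequentially"
        using \<pi>.V.closure_sequence by blast
      have "limitin (vtop V) (\<lambda>n. E H (s n)) x sequentially"
        using EH.Pr_limit[OF s(2)] xV(2) by simp
      moreover have "eventually (\<lambda>n. E H (s n) \<in> DH) sequentially"
        by (intro always_eventually allI EH_DH s(1))
      ultimately show "x \<in> vtop V closure_of DH"
        by (rule \<pi>.V.limit_in_closure) simp
    qed
    moreover have "vtop VS closure_of DH = vtop V closure_of DH \<inter> S"
      by (rule \<pi>.V.closure_subspace[OF EH.S_submodule]) blast
    ultimately show ?thesis by auto
  qed
  have sub: "submodule DH complex_field VS"
    unfolding EH.VS.submodule_iff subspace_record_simps
  proof (intro conjI ballI allI)
    show "DH \<subseteq> carrier VS" by simp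
    show "\<zero>\<^bsub>V\<^esub> \<in> DH" unfolding DH_iff using EH.Pr_zero by simp
    show "x \<oplus>\<^bsub>V\<^esub> y \<in> DH" if "x \<in> DH" "y \<in> DH" for x y
      using that unfolding DH_iff by (simp add: EH.Pr_add)
    show "c \<odot>\<^bsub>V\<^esub> x \<in> DH" if "x \<in> DH" for c x
      using that unfolding DH_iff by (simp add: EH.Pr_smult)
  qed
  have lin: "linear_map VS DH VS (rep_op \<pi> a)" if "a \<in> A_H" for a
    unfolding linear_map_def subspace_record_simps
  proof (intro conjI ballI allI)
    fix x assume x: "x \<in> DH"
    show "rep_op \<pi> a x \<in> carrier VS" using DH_invariant[OF that x] by simp
    show "rep_op \<pi> a (c \<odot>\<^bsub>V\<^esub> x) = c \<odot>\<^bsub>V\<^esub> rep_op \<pi> a x" for c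
      using D[OF x] by (intro \<pi>.op_smult) (simp_all add: \<pi>.alg)
    fix y assume y: "y \<in> DH"
    show "rep_op \<pi> a (x \<oplus>\<^bsub>V\<^esub> y) = rep_op \<pi> a x \<oplus>\<^bsub>V\<^esub> rep_op \<pi> a y"
      using D[OF x] D[OF y] by (intro \<pi>.op_add) (simp_all add: \<pi>.alg)
  qed
  show ?thesis
    unfolding star_representation_def Let_def \<rho>_simps hilbert_space_iff subspace_record_simps
  proof (intro conjI ballI allI)
    fix a b c x y
    assume "a \<in> A_H"
    show "linear_map VS DH VS (rep_op \<pi> a)" by (rule lin) fact
    show "rep_op \<pi> a ` DH \<subseteq> DH" using DH_invariant \<open>a \<in> A_H\<close> by blast
    assume x: "x \<in> DH"
    show "rep_op \<pi> (c *\<^sub>C a) x = c \<odot>\<^bsub>V\<^esub> rep_op \<pi> a x" using D[OF x] \<pi>.rep_scale by blast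
    show "ip V (rep_op \<pi> a x) y = ip V x (rep_op \<pi> (a\<^sup>\<star>) y)" if "y \<in> DH"
      using D[OF x] D[OF that] \<pi>.rep_star by blast
    show "rep_op \<pi> (a + b) x = rep_op \<pi> a x \<oplus>\<^bsub>V\<^esub> rep_op \<pi> b x" using D[OF x] \<pi>.rep_add by blast
    show "rep_op \<pi> (a * b) x = rep_op \<pi> a (rep_op \<pi> b x)" using D[OF x] \<pi>.rep_mult by blast
  qed (use dense sub EH.hilbert_VS in simp_all)
qed

sublocale R: induction G \<A> H \<rho>
  by unfold_locales (rule star_representation_\<rho>)

text \<open>The form on \<open>\<A> \<otimes> \<D>(\<rho>)\<close> is the pullback of the inner product of \<open>\<pi>\<close> under
  \<open>a \<otimes> v \<mapsto> \<pi>(a) v\<close>.\<close>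

lemma inducible_\<rho>: "inducible G \<A> H \<rho>"
  unfolding R.inducible_iff
proof
  fix f assume "f \<in> carrier R.F"
  then have f: "finite (R.supp f)" "\<And>x. x \<in> R.supp f \<Longrightarrow> snd x \<in> DH"
    unfolding R.F_simps by auto
  define s where "s x = f x \<odot>\<^bsub>V\<^esub> rep_op \<pi> (fst x) (snd x)" for x
  have op: "rep_op \<pi> (fst x) (snd x) \<in> carrier V" if "x \<in> R.supp f" for x
    using f(2)[OF that] by (simp add: \<pi>.alg)
  have s: "s x \<in> carrier V" if "x \<in> R.supp f" for x
    using op[OF that] by (simp add: s_def)
  have k: "ip V (s x) (s y) = f x * cnj (f y) * R.basis_form x y" if "x \<in> R.supp f" "y \<in> R.supp f" for x y
    unfolding s_def R.basis_form_def \<rho>_simps subspace_record_simps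
    using op that gram_DH[OF f(2) f(2), OF that, of "fst x" "fst y"]
    by (simp add: \<pi>.V.ip_smult_left \<pi>.V.ip_smult_right)
  let ?s = "finsum V s (R.supp f)"
  have sc: "?s \<in> carrier V" using s by (intro \<pi>.V.finsum_closed) auto
  have "ip V ?s ?s = (\<Sum>x\<in>R.supp f. \<Sum>y\<in>R.supp f. ip V (s x) (s y))"
  proof -
    have "ip V ?s ?s = (\<Sum>x\<in>R.supp f. ip V (s x) ?s)"
      by (rule \<pi>.V.ip_finsum_left[OF f(1) s sc])
    also have "\<dots> = (\<Sum>x\<in>R.supp f. \<Sum>y\<in>R.supp f. ip V (s x) (s y))"
      by (rule sum.cong[OF refl], rule \<pi>.V.ip_finsum_right[OF f(1) s s])
    finally show ?thesis .
  qed
  also have "\<dots> = ip R.F f f" unfolding R.F_simps by (intro sum.cong refl k) auto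
  finally show "ip R.F f f \<in> \<real>\<^sub>\<ge>\<^sub>0" using \<pi>.V.ip_nonneg[OF sc] by simp
qed

sublocale R: inducible_rep G \<A> H \<rho>
  by unfold_locales (rule inducible_\<rho>)

end

section \<open>Well-behavedness of the restriction\<close>

context imprimitivity
begin

abbreviation "B \<equiv> \<A> \<one>\<^bsub>G\<^esub>"
abbreviation "\<pi>B \<equiv> Res B \<pi>"
abbreviation "\<rho>B \<equiv> Res B \<rho>"

lemma Res_simps [simp]: "rep_alg (Res X \<sigma>) = X" "rep_space (Res X \<sigma>) = rep_space \<sigma>"
  "rep_dom (Res X \<sigma>) = rep_dom \<sigma>" "rep_op (Res X \<sigma>) = rep_op \<sigma>" "graph_norm (Res X \<sigma>) = graph_norm \<sigma>"
  "rep_graph (Res X \<sigma>) = rep_graph \<sigma>"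
  by (simp_all add: Res_def graph_norm_def rep_graph_def fun_eq_iff)

lemma B_nonempty: "B \<noteq> {}"
  using one_homogeneous by blast

lemma EB: "\<lbrakk>t \<in> Cos; b \<in> B; x \<in> D\<rbrakk> \<Longrightarrow> E t (rep_op \<pi> b x) = rep_op \<pi> b (E t x)"
  using E_covariant[OF G.one_closed, of t b x] Cos_subset[of t] by (simp add: G.lcos_mult_one)

lemma integrable: "closed_rep \<pi>B"
  "b \<in> B \<Longrightarrow> op_closure V (rep_graph \<pi> (b\<^sup>\<star>)) = op_adjoint V (rep_graph \<pi> b)"
  and spectral: "spectral_measure (char_borel G \<A>) V E\<^sub>\<pi>"
  and closure_spectral: "b \<in> B \<Longrightarrow>
    op_closure V (rep_graph \<pi> b) = spectral_integral (char_borel G \<A>) V E\<^sub>\<pi> (\<lambda>\<omega>. \<omega> b)"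
  and E\<pi>_covariant: "\<lbrakk>g \<in> carrier G; a \<in> \<A> g; \<Delta> \<in> sets (char_borel G \<A>); x \<in> D\<rbrakk> \<Longrightarrow>
    E\<^sub>\<pi> \<Delta> x \<in> D \<and> E\<^sub>\<pi> (set_action G \<A> g \<Delta>) (rep_op \<pi> a x) = rep_op \<pi> a (E\<^sub>\<pi> \<Delta> x)"
  using well_behaved unfolding well_behaved_with_def integrable_rep_def by simp_all

lemma B_star: "b \<in> B \<Longrightarrow> b\<^sup>\<star> \<in> B"
  using homogeneous_star[OF G.one_closed, of b] by simp

sublocale \<pi>B: operator_family \<pi>B
  by (intro operator_family.intro operator_family_axioms.intro; (unfold Res_simps)?)
    (use \<pi>.submodule_dom \<pi>.linear \<pi>.V.inner_space_axioms in auto)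

sublocale \<rho>B: operator_family \<rho>B
  by (intro operator_family.intro operator_family_axioms.intro; (unfold Res_simps)?)
    (use R.\<rho>.submodule_dom R.\<rho>.linear[OF A_H_unit_part] R.\<rho>.V.inner_space_axioms in auto)

lemma VS_minus': "\<lbrakk>x \<in> DH; y \<in> DH\<rbrakk> \<Longrightarrow> x \<ominus>\<^bsub>VS\<^esub> y = x \<ominus>\<^bsub>V\<^esub> y"
  by (rule EH.VS_minus) auto

lemma graph_norm_\<rho>: "graph_norm \<rho> a x = graph_norm \<pi> a x"
  by (simp add: graph_norm_def)

text \<open>A Cauchy filter on \<open>\<D>(\<rho>)\<close> converges in \<open>\<D>(\<pi>)\<close>, and in norm, so that its limit stays in the
  closed subspace \<open>S\<close>.\<close>

lemma closed_\<rho>: "closed_rep \<rho>B"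
  unfolding closed_rep_def
proof (intro allI impI)
  fix F assume F: "graph_cauchy \<rho>B F"
  have "graph_cauchy \<pi>B (filtermap (\<lambda>x. x) F)"
  proof (rule graph_cauchy_filtermap[OF F])
    show "x \<in> rep_dom \<pi>B" if "x \<in> rep_dom \<rho>B" for x using that by simp
    show "graph_norm \<pi>B a (x \<ominus>\<^bsub>rep_space \<pi>B\<^esub> y) \<le> graph_norm \<rho>B a (x \<ominus>\<^bsub>rep_space \<rho>B\<^esub> y)"
      if "x \<in> rep_dom \<rho>B" "y \<in> rep_dom \<rho>B" for a x y
      using that VS_minus'[of x y] by (simp add: graph_norm_\<rho>)
  qed simp
  then have "graph_cauchy \<pi>B F" by (simp add: filtermap_ident)
  then obtain x where x: "x \<in> D" and lim: "limitin (graph_topology \<pi>B) (\<lambda>x. x) x F"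
    using integrable(1) unfolding closed_rep_def by auto
  have FDH: "eventually (\<lambda>y. y \<in> DH) F" and ne: "F \<noteq> bot" using F by (auto simp: graph_cauchy_def)
  have "limitin (vtop V) (\<lambda>x. x) x F"
    using \<pi>B.limit_graph_imp_limit[OF _ lim] B_nonempty by simp
  then have xS: "x \<in> S"
    by (rule \<pi>.V.limit_closed_set[OF EH.S_closedin _ _ ne]) (use FDH in \<open>auto elim: eventually_mono\<close>)
  have "limitin (graph_topology \<rho>B) (\<lambda>x. x) x F"
  proof (subst \<rho>B.limit_graph_iff)
    show "rep_alg \<rho>B \<noteq> {}" using B_nonempty by simp
    have "eventually (\<lambda>i. graph_norm \<rho> a (i \<ominus>\<^bsub>VS\<^esub> x) < \<epsilon>) F" if "a \<in> B" "\<epsilon> > 0" for a \<epsilon>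
    proof -
      have "eventually (\<lambda>i. graph_norm \<pi> a (i \<ominus>\<^bsub>V\<^esub> x) < \<epsilon>) F"
        using lim that B_nonempty by (subst (asm) \<pi>B.limit_graph_iff) auto
      with FDH show ?thesis
        by eventually_elim (use x xS VS_minus'[of _ x] in \<open>simp add: graph_norm_\<rho>\<close>)
    qed
    then show "x \<in> rep_dom \<rho>B \<and> eventually (\<lambda>i. i \<in> rep_dom \<rho>B) F \<and> (\<forall>a\<in>rep_alg \<rho>B. \<forall>\<epsilon>>0.
        eventually (\<lambda>i. graph_norm \<rho>B a (i \<ominus>\<^bsub>rep_space \<rho>B\<^esub> x) < \<epsilon>) F)"
      using x xS FDH by simp
  qed
  then show "\<exists>x\<in>rep_dom \<rho>B. limitin (graph_topology \<rho>B) (\<lambda>x. x) x F"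
    using x xS by auto
qed

text \<open>The projection \<open>E(H)\<close> reduces the operators \<open>\<pi>(b)\<close>, \<open>b \<in> B\<close>, and the spectral measure of \<open>\<pi>\<close>, so each
  condition on \<open>\<rho>\<close> is the corresponding condition on \<open>\<pi>\<close> intersected with the range.\<close>

lemma well_behaved_\<rho>: "well_behaved_with G \<A> H \<rho> E\<^sub>\<pi>"
proof -
  interpret sr: spectral_reduction V "E H" "char_borel G \<A>" E\<^sub>\<pi>
    using spectral commuting[OF H_Cos] by unfold_locales auto
  have DV: "D \<subseteq> carrier V" using \<pi>.D_closed by blast
  have opV: "rep_op \<pi> b x \<in> carrier V" if "x \<in> D" for b x using that by (simp add: \<pi>.alg)
  have red: "E H x \<in> D \<and> E H (rep_op \<pi> b x) = rep_op \<pi> b (E H x)" if "b \<in> B" "x \<in> D" for b x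
    using that E_D[OF H_Cos] EB[OF H_Cos] by blast
  have gr\<pi>: "rep_graph \<pi> b = {(x, rep_op \<pi> b x) | x. x \<in> D}" for b
    unfolding rep_graph_def by blast
  have gr\<rho>: "rep_graph \<rho> b = {(x, rep_op \<pi> b x) | x. x \<in> S \<inter> D}" for b
    unfolding rep_graph_def by simp
  have clo: "op_closure VS (rep_graph \<rho> b) = op_closure V (rep_graph \<pi> b) \<inter> S \<times> S" if "b \<in> B" for b
    unfolding gr\<pi> gr\<rho> by (rule EH.op_closure_reduced[OF DV opV red[OF that]])
  have adj: "op_adjoint VS (rep_graph \<rho> b) = op_adjoint V (rep_graph \<pi> b) \<inter> S \<times> S" if "b \<in> B" for b
    unfolding gr\<pi> gr\<rho> by (rule EH.op_adjoint_reduced[OF DV opV red[OF that]])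
  show ?thesis
    unfolding well_behaved_with_def integrable_rep_def
  proof (intro conjI ballI)
    show "closed_rep \<rho>B" by (rule closed_\<rho>)
    show "op_closure (rep_space \<rho>B) (rep_graph \<rho>B (b\<^sup>\<star>)) = op_adjoint (rep_space \<rho>B) (rep_graph \<rho>B b)"
      if "b \<in> rep_alg \<rho>B" for b
    proof -
      have b: "b \<in> B" using that by simp
      show ?thesis unfolding Res_simps \<rho>_simps clo[OF B_star[OF b]] adj[OF b] integrable(2)[OF b] ..
    qed
    show "spectral_measure (char_borel G \<A>) (rep_space \<rho>) E\<^sub>\<pi>"
      unfolding \<rho>_simps by (rule sr.spectral_measure_reduced)
    show "op_closure (rep_space \<rho>) (rep_graph \<rho> b) =
        spectral_integral (char_borel G \<A>) (rep_space \<rho>) E\<^sub>\<pi> (\<lambda>\<omega>. \<omega> b)" if "b \<in> B" for b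
      unfolding \<rho>_simps clo[OF that] sr.spectral_integral_reduced closure_spectral[OF that] ..
    fix g a \<Delta> x assume g: "g \<in> H" and a: "a \<in> \<A> g" and \<Delta>: "\<Delta> \<in> sets (char_borel G \<A>)"
      and "x \<in> rep_dom \<rho>"
    then have x: "x \<in> S" "x \<in> D" by auto
    note cov = E\<pi>_covariant[OF H_carrier[OF g] a \<Delta> x(2)]
    show "E\<^sub>\<pi> \<Delta> x \<in> rep_dom \<rho>"
      using cov sr.E_S[OF \<Delta> x(1)] by simp
    show "E\<^sub>\<pi> (set_action G \<A> g \<Delta>) (rep_op \<rho> a x) = rep_op \<rho> a (E\<^sub>\<pi> \<Delta> x)"
      using cov by simp
  qed
qed

end

section \<open>Equivalence with the induced system\<close>

lemma limitin_filtermap: "limitin X f l (filtermap h F) \<longleftrightarrow> limitin X (\<lambda>x. f (h x)) l F"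
  by (simp add: limitin_def eventually_filtermap)

context imprimitivity
begin

text \<open>The counterpart in \<open>V\<close> of the tensors \<open>[a \<otimes> v]\<close>.\<close>

definition vectors where "vectors = {rep_op \<pi> a v | a v. v \<in> DH}"

abbreviation "K \<equiv> vspan V vectors"

lemma vectors_D: "vectors \<subseteq> D"
  unfolding vectors_def using \<pi>.dom_invariant by blast

lemma vectors_closed: "vectors \<subseteq> carrier V"
  using vectors_D \<pi>.D_closed by blast

lemma K_D: "K \<subseteq> D"
  by (rule \<pi>.V.vspan_minimal[OF \<pi>.submodule_dom vectors_D])

lemma K_submodule: "submodule K complex_field V"
  by (rule \<pi>.V.submodule_vspan[OF vectors_closed])

lemma alg_nonempty: "rep_alg \<pi> \<noteq> {}"
  by (simp add: \<pi>.alg)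

lemma E_closed: "\<lbrakk>t \<in> Cos; x \<in> carrier V\<rbrakk> \<Longrightarrow> E t x \<in> carrier V"
  by (rule projection_on.Pr_closed[OF projection_on_E])

lemma closure_of_system_dom:
  assumes t: "t \<in> Cos" and x: "x \<in> D"
  shows "E t x \<in> graph_topology \<pi> closure_of
    vspan V {rep_op \<pi> a v | a v. a \<in> graded_part \<A> t \<and> v \<in> DH}"
proof -
  have "E t x \<in> system_dom \<pi> E t"
    unfolding system_dom_def using E_D[OF t x] \<pi>.D_closed[OF x] by blast
  moreover have "system_dom \<pi> E H = DH" by (simp add: system_dom_def)
  ultimately show ?thesis
    using nondegenerate t unfolding nondegenerate_system_def by auto
qed

lemma approx_component:
  assumes t: "t \<in> Cos" and x: "x \<in> D"
  shows "\<pi>.approx (vspan V {rep_op \<pi> a v | a v. a \<in> graded_part \<A> t \<and> v \<in> DH}) (E t x)"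
  by (rule \<pi>.approx_of_closure[OF alg_nonempty closure_of_system_dom[OF t x] E_D[OF t x]])

lemma approx_mono: "\<lbrakk>\<pi>.approx M x; M \<subseteq> N\<rbrakk> \<Longrightarrow> \<pi>.approx N x"
  unfolding \<pi>.approx_def by blast

lemma approx_component_K:
  assumes "t \<in> Cos" "x \<in> D"
  shows "\<pi>.approx K (E t x)"
proof (rule approx_mono[OF approx_component[OF assms]])
  have "{rep_op \<pi> a v | a v. a \<in> graded_part \<A> t \<and> v \<in> DH} \<subseteq> vectors"
    unfolding vectors_def by blast
  then show "vspan V {rep_op \<pi> a v | a v. a \<in> graded_part \<A> t \<and> v \<in> DH} \<subseteq> K"
    using \<pi>.V.vspan_subset[of vectors] by (intro \<pi>.V.vspan_minimal[OF K_submodule]) blast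
qed

definition partial_sum where "partial_sum x F = (\<Oplus>\<^bsub>V\<^esub>t\<in>F. E t x)"

lemma partial_sum_approx:
  assumes "finite F" "F \<subseteq> Cos" "x \<in> D"
  shows "partial_sum x F \<in> D \<and> \<pi>.approx K (partial_sum x F)"
  using assms(1,2)
proof (induction F)
  case empty
  then show ?case using \<pi>.approx_zero[OF K_submodule] by (simp add: partial_sum_def)
next
  case (insert t F)
  have "(\<lambda>t. E t x) \<in> F \<rightarrow> carrier V" "E t x \<in> carrier V"
    using insert.prems assms(3) E_closed by auto
  then have "partial_sum x (insert t F) = E t x \<oplus>\<^bsub>V\<^esub> partial_sum x F"
    using insert.hyps unfolding partial_sum_def by (intro \<pi>.V.finsum_insert)
  moreover have t: "E t x \<in> D" "\<pi>.approx K (E t x)"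
    using insert.prems assms(3) E_D approx_component_K by auto
  moreover have "partial_sum x F \<in> D" "\<pi>.approx K (partial_sum x F)" using insert.IH insert.prems by auto
  ultimately show ?case
    using \<pi>.approx_add[OF K_submodule K_D t(2,1)] by simp
qed

lemma partial_sum_covariant:
  assumes g: "g \<in> carrier G" and a: "a \<in> \<A> g" and x: "x \<in> D" and F: "finite F" "F \<subseteq> Cos"
  shows "rep_op \<pi> a (partial_sum x F) = partial_sum (rep_op \<pi> a x) ((\<lambda>t. g <#\<^bsub>G\<^esub> t) ` F)"
  using F
proof (induction F)
  case empty
  then show ?case using \<pi>.op_zero[of a] by (simp add: partial_sum_def \<pi>.alg)
next
  case (insert t F)
  let ?g = "\<lambda>t. g <#\<^bsub>G\<^esub> t" and ?y = "rep_op \<pi> a x"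
  have t: "t \<in> Cos" and F: "F \<subseteq> Cos" using insert.prems by auto
  have y: "?y \<in> carrier V" using x by (simp add: \<pi>.alg)
  have "?g t \<notin> ?g ` F"
  proof
    assume "?g t \<in> ?g ` F"
    then obtain u where u: "u \<in> F" "?g t = ?g u" by blast
    then have "inv\<^bsub>G\<^esub> g <#\<^bsub>G\<^esub> ?g t = inv\<^bsub>G\<^esub> g <#\<^bsub>G\<^esub> ?g u" by simp
    then have "t = u" using Cos_inverse(2)[OF g] t F u(1) by auto
    then show False using u(1) insert.hyps by simp
  qed
  moreover have "(\<lambda>t. E t ?y) \<in> ?g ` F \<rightarrow> carrier V" using F Cos_mult[OF g] E_closed y by auto
  moreover have "E (?g t) ?y \<in> carrier V" using Cos_mult[OF g t] E_closed y by blast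
  ultimately have 1: "partial_sum ?y (?g ` insert t F) = E (?g t) ?y \<oplus>\<^bsub>V\<^esub> partial_sum ?y (?g ` F)"
    using insert.hyps unfolding partial_sum_def image_insert by (intro \<pi>.V.finsum_insert) auto
  have "(\<lambda>t. E t x) \<in> F \<rightarrow> carrier V" "E t x \<in> carrier V" using F t x E_closed by auto
  then have "partial_sum x (insert t F) = E t x \<oplus>\<^bsub>V\<^esub> partial_sum x F"
    using insert.hyps unfolding partial_sum_def by (intro \<pi>.V.finsum_insert)
  then have "rep_op \<pi> a (partial_sum x (insert t F)) = rep_op \<pi> a (E t x) \<oplus>\<^bsub>V\<^esub> rep_op \<pi> a (partial_sum x F)"
    using E_D[OF t x] partial_sum_approx[OF insert.hyps(1) F x] \<pi>.op_add[of a "E t x" "partial_sum x F"]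
    by (simp add: \<pi>.alg)
  then show ?case using 1 insert.IH[OF F] E_covariant[OF g t a x] by simp
qed

abbreviation "Fin \<equiv> finite_subsets_at_top Cos"

lemma Fin_eventually: "eventually (\<lambda>F. finite F \<and> F \<subseteq> Cos) Fin"
  by (intro eventually_finite_subsets_at_top_weakI) auto

text \<open>For homogeneous \<open>a\<close> the operator \<open>\<pi>(a)\<close> maps partial sums of \<open>x\<close> to partial sums of \<open>\<pi>(a)x\<close>,
  with the index set translated.\<close>

lemma partial_sum_limit:
  assumes x: "x \<in> D"
  shows "limitin (vtop V) (\<lambda>F. rep_op \<pi> a (partial_sum x F)) (rep_op \<pi> a x) Fin"
proof (induction a rule: homogeneous_induct)
  have xV [simp]: "rep_op \<pi> a x \<in> carrier V" for a using x by (simp add: \<pi>.alg)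
  have Dx: "eventually (\<lambda>F. partial_sum x F \<in> D) Fin"
    using Fin_eventually by (rule eventually_mono) (use partial_sum_approx x in blast)
  {
    case zero
    have z: "rep_op \<pi> 0 y = \<zero>\<^bsub>V\<^esub>" if "y \<in> D" for y
      using \<pi>.rep_scale[of 0 y 0] that by (simp add: \<pi>.alg)
    show ?case unfolding z[OF x]
      by (rule limitin_eventually) (use Dx z in \<open>auto elim!: eventually_mono\<close>)
  next
    case (add a b)
    have "eventually (\<lambda>F. rep_op \<pi> a (partial_sum x F) \<oplus>\<^bsub>V\<^esub> rep_op \<pi> b (partial_sum x F) = rep_op \<pi> (a + b) (partial_sum x F)) Fin"
      using Dx by (rule eventually_mono) (simp add: \<pi>.rep_add)
    from limitin_transform_eventually[OF this \<pi>.V.limit_add[OF add]] show ?case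
      using x by (simp add: \<pi>.rep_add)
  next
    case (scale c a)
    have "eventually (\<lambda>F. c \<odot>\<^bsub>V\<^esub> rep_op \<pi> a (partial_sum x F) = rep_op \<pi> (c *\<^sub>C a) (partial_sum x F)) Fin"
      using Dx by (rule eventually_mono) (simp add: \<pi>.rep_scale)
    from limitin_transform_eventually[OF this \<pi>.V.limit_smult[OF scale]] show ?case
      using x by (simp add: \<pi>.rep_scale)
  next
    case (homogeneous g a)
    let ?h = "\<lambda>F. (\<lambda>t. g <#\<^bsub>G\<^esub> t) ` F"
    have h: "filterlim ?h Fin Fin"
      unfolding filterlim_finite_subsets_at_top
    proof (intro allI impI)
      fix X assume X: "finite X \<and> X \<subseteq> Cos"
      let ?Y = "(\<lambda>t. inv\<^bsub>G\<^esub> g <#\<^bsub>G\<^esub> t) ` X"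
      have Y: "finite ?Y" "?Y \<subseteq> Cos" using X Cos_mult[OF G.inv_closed[OF homogeneous(1)]] by auto
      have *: "finite (?h F) \<and> X \<subseteq> ?h F \<and> ?h F \<subseteq> Cos" if F: "finite F" "?Y \<subseteq> F" "F \<subseteq> Cos" for F
      proof (intro conjI)
        show "X \<subseteq> ?h F"
        proof
          fix t assume t: "t \<in> X"
          then have "t = g <#\<^bsub>G\<^esub> (inv\<^bsub>G\<^esub> g <#\<^bsub>G\<^esub> t)"
            using Cos_inverse(1)[OF homogeneous(1)] X by auto
          then show "t \<in> ?h F" using t F(2) by blast
        qed
        show "?h F \<subseteq> Cos" using F(3) Cos_mult[OF homogeneous(1)] by blast
      qed (use F in simp)
      show "eventually (\<lambda>F. finite (?h F) \<and> X \<subseteq> ?h F \<and> ?h F \<subseteq> Cos) Fin"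
        unfolding eventually_finite_subsets_at_top
        by (rule exI[of _ ?Y]) (intro conjI[OF Y(1)] conjI[OF Y(2)] allI impI *; elim conjE; assumption)
    qed
    have "limitin (vtop V) (partial_sum (rep_op \<pi> a x)) (rep_op \<pi> a x) Fin"
      using E_sum[OF xV] unfolding partial_sum_def .
    then have "limitin (vtop V) (\<lambda>F. partial_sum (rep_op \<pi> a x) (?h F)) (rep_op \<pi> a x) Fin"
      using h unfolding limitin_def filterlim_iff by blast
    moreover have "eventually (\<lambda>F. partial_sum (rep_op \<pi> a x) (?h F) = rep_op \<pi> a (partial_sum x F)) Fin"
      using Fin_eventually
      by (rule eventually_mono) (simp add: partial_sum_covariant[OF homogeneous x])
    ultimately show ?case by (rule limitin_transform_eventually[rotated])
  }
qed

text \<open>The vector \<open>x\<close> is a graph limit of partial sums of \<open>\<Sum>\<^sub>t E(t)x\<close>, and each \<open>E(t)x\<close> is a graph limit of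
  elements of \<open>K\<close> by nondegeneracy.\<close>

lemma approx_K:
  assumes x: "x \<in> D" shows "\<pi>.approx K x"
proof (rule \<pi>.approx_trans[OF K_D])
  let ?M = "{partial_sum x F | F. finite F \<and> F \<subseteq> Cos}"
  show "?M \<subseteq> D" "\<And>y. y \<in> ?M \<Longrightarrow> \<pi>.approx K y" using partial_sum_approx[OF _ _ x] by blast+
  show "\<pi>.approx ?M x"
    unfolding \<pi>.approx_def
  proof (intro allI impI)
    fix A and \<epsilon> :: real assume A: "finite A \<and> A \<subseteq> rep_alg \<pi> \<and> \<epsilon> > 0"
    have ev: "eventually (\<lambda>F. \<pi>.gn a (partial_sum x F \<ominus>\<^bsub>V\<^esub> x) < \<epsilon>) Fin" for a
    proof -
      have "limitin (vtop V) (partial_sum x) x Fin"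
        using E_sum[OF \<pi>.D_closed[OF x]] unfolding partial_sum_def .
      then have "((\<lambda>F. vnorm V (partial_sum x F \<ominus>\<^bsub>V\<^esub> x) +
          vnorm V (rep_op \<pi> a (partial_sum x F) \<ominus>\<^bsub>V\<^esub> rep_op \<pi> a x)) \<longlongrightarrow> 0 + 0) Fin"
        using partial_sum_limit[OF x, of a] by (intro tendsto_add) (simp_all add: \<pi>.V.limit_iff)
      then have "eventually (\<lambda>F. vnorm V (partial_sum x F \<ominus>\<^bsub>V\<^esub> x) +
          vnorm V (rep_op \<pi> a (partial_sum x F) \<ominus>\<^bsub>V\<^esub> rep_op \<pi> a x) < \<epsilon>) Fin"
        using A by (intro order_tendstoD) auto
      with Fin_eventually show ?thesis
        by eventually_elim (use partial_sum_approx[OF _ _ x] x in \<open>simp add: \<pi>.gn_eq \<pi>.alg\<close>)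
    qed
    have "eventually (\<lambda>F. (finite F \<and> F \<subseteq> Cos) \<and> (\<forall>a\<in>A. \<pi>.gn a (partial_sum x F \<ominus>\<^bsub>V\<^esub> x) < \<epsilon>)) Fin"
      using A ev by (intro eventually_conj Fin_eventually eventually_ball_finite) auto
    from eventually_happens'[OF finite_subsets_at_top_neq_bot this]
    obtain F where "finite F \<and> F \<subseteq> Cos" "\<forall>a\<in>A. \<pi>.gn a (partial_sum x F \<ominus>\<^bsub>V\<^esub> x) < \<epsilon>"
      by (elim exE conjE) (rule that, intro conjI)
    then show "\<exists>y\<in>?M. \<forall>a\<in>A. \<pi>.gn a (y \<ominus>\<^bsub>V\<^esub> x) < \<epsilon>" by blast
  qed
qed (rule x)

lemma closure_of_approx:
  assumes "\<pi>.approx M x" "M \<subseteq> D" "x \<in> D"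
  shows "x \<in> vtop V closure_of M"
proof -
  obtain F where F: "F \<noteq> bot" "eventually (\<lambda>y. y \<in> M) F" "limitin (graph_topology \<pi>) (\<lambda>y. y) x F"
    using \<pi>.filter_of_approx[OF assms(2,1,3) alg_nonempty] by metis
  show ?thesis
    by (rule \<pi>.V.limit_in_closure[OF \<pi>.limit_graph_imp_limit[OF alg_nonempty F(3)] F(2,1)])
qed

lemma K_dense: "vtop V closure_of K = carrier V"
proof
  show "vtop V closure_of K \<subseteq> carrier V" by (rule \<pi>.V.closure_of_closed)
  have "D \<subseteq> vtop V closure_of K" using closure_of_approx[OF approx_K K_D] by blast
  then have "vtop V closure_of D \<subseteq> vtop V closure_of (vtop V closure_of K)" by (rule closure_of_mono)
  then show "carrier V \<subseteq> vtop V closure_of K" unfolding \<pi>.dense_dom closure_of_closure_of .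
qed

text \<open>\<open>\<pi>(a)v \<mapsto> [a \<otimes> v]\<close> is the equivalence of systems; both families are total and have the same
  Gram matrix.\<close>

lemma unitary_exists: "\<exists>U. unitary V R.I U \<and> (\<forall>a. \<forall>v\<in>DH. U (rep_op \<pi> a v) = R.J a v)"
proof -
  let ?x = "\<lambda>(a, v). rep_op \<pi> a v" and ?y = "\<lambda>(a, v). R.J a v"
  have x: "?x ` (UNIV \<times> DH) = vectors" unfolding vectors_def by auto
  have y: "?y ` (UNIV \<times> DH) = R.tensors" by auto
  have "\<exists>U. unitary V R.I U \<and> (\<forall>i\<in>UNIV \<times> DH. U (?x i) = ?y i)"
  proof (rule unitary_of_gram)
    show "hilbert V" by (rule \<pi>.hilbert)
    show "hilbert R.I" ..
    show "vtop V closure_of (vspan V (?x ` (UNIV \<times> DH))) = carrier V" unfolding x by (rule K_dense)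
    show "vtop R.I closure_of (vspan R.I (?y ` (UNIV \<times> DH))) = carrier R.I"
      unfolding y by (rule R.tensors_total)
    fix i j :: "'a \<times> 'h" assume i: "i \<in> UNIV \<times> DH" and j: "j \<in> UNIV \<times> DH"
    obtain a v b w where ij: "i = (a, v)" "j = (b, w)" by fastforce
    have vw: "v \<in> DH" "w \<in> DH" using i j unfolding ij by blast+
    show "?x i \<in> carrier V" using vw(1) by (simp add: ij \<pi>.alg)
    show "?y i \<in> carrier R.I" using R.J_closed[of v a] vw(1) by (simp add: ij)
    show "ip V (?x i) (?x j) = ip R.I (?y i) (?y j)"
      using gram_DH[OF vw] R.J_ip[of v w a b] vw by (simp add: ij)
  qed
  then obtain U where U: "unitary V R.I U" "\<forall>i\<in>UNIV \<times> DH. U (?x i) = ?y i" by blast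
  have "U (rep_op \<pi> a v) = R.J a v" if "v \<in> DH" for a v
    using bspec[OF U(2), of "(a, v)"] that by simp
  with U(1) show ?thesis by blast
qed

end

context imprimitivity
begin

text \<open>For \<open>x \<in> D\<close> this is nondegeneracy; the general case follows by continuity of \<open>E(t)\<close>.\<close>

lemma component_closure:
  assumes t: "t \<in> Cos" and x: "x \<in> carrier V"
  shows "E t x \<in> vtop V closure_of vspan V {rep_op \<pi> a v | a v. a \<in> graded_part \<A> t \<and> v \<in> DH}"
    (is "_ \<in> vtop V closure_of ?Kt")
proof -
  interpret Et: projection_on V "E t" by (rule projection_on_E[OF t])
  have KtD: "?Kt \<subseteq> D"
    by (rule \<pi>.V.vspan_minimal[OF \<pi>.submodule_dom]) (use \<pi>.dom_invariant in blast)
  have "x \<in> vtop V closure_of D" using x \<pi>.dense_dom by simp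
  moreover have "D \<subseteq> carrier V" using \<pi>.D_closed by blast
  ultimately obtain s where s: "\<And>n. s n \<in> D" "limitin (vtop V) s x sequentially"
    using \<pi>.V.closure_sequence by blast
  show ?thesis
  proof (rule \<pi>.V.limit_closed_set[OF closedin_closure_of Et.Pr_limit[OF s(2)]])
    show "eventually (\<lambda>n. E t (s n) \<in> vtop V closure_of ?Kt) sequentially"
      by (intro always_eventually allI closure_of_approx[OF approx_component[OF t s(1)] KtD E_D[OF t s(1)]])
  qed simp
qed

text \<open>The unitary map carries \<open>K\<close> onto the algebraic tensors and preserves graph norms. A vector of \<open>\<D>(\<pi>)\<close>
  is a graph limit of a filter on \<open>K\<close>, hence mapped into the domain of the closure. Conversely, a
  Cauchy filter of tensors comes from a Cauchy filter on \<open>K\<close>, which converges in \<open>\<D>(\<pi>)\<close> because the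
  restriction of \<open>\<pi>\<close> to \<open>\<A>\<^sub>e\<close> is closed. As to the projections, \<open>U(E(t)x)\<close> has the two properties
  that characterize the orthogonal projection of \<open>Ux\<close> onto the closed span of the \<open>[a \<otimes> v]\<close> with
  \<open>a \<in> \<A>\<^sub>t\<close>.\<close>

lemma systems_equivalent:
  "systems_unitarily_equivalent G H \<pi> E R.IndH (ind_projection G \<A> H \<rho>)"
proof -
  obtain U where U: "unitary V R.I U" and UJ': "\<forall>a. \<forall>v\<in>DH. U (rep_op \<pi> a v) = R.J a v"
    using unitary_exists by blast
  have UJ: "U (rep_op \<pi> a v) = R.J a v" if "v \<in> DH" for a v
    using UJ' that by blast
  interpret U: unitary_map V R.I U by unfold_locales (rule U)
  obtain U' where U': "unitary R.I V U'" and U'U: "\<And>x. x \<in> carrier V \<Longrightarrow> U' (U x) = x"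
    and UU': "\<And>y. y \<in> carrier R.I \<Longrightarrow> U (U' y) = y"
    by (rule U.inverse) (rule that)
  interpret U': unitary_map R.I V U' by unfold_locales (rule U')
  have K_closed: "x \<in> carrier V" if "x \<in> K" for x using that K_D \<pi>.D_closed by blast
  have Uspan: "U x \<in> vspan R.I {R.J a v | a v. a \<in> T \<and> v \<in> DH}"
    if "x \<in> vspan V {rep_op \<pi> a v | a v. a \<in> T \<and> v \<in> DH}" for x T
  proof -
    have X: "{rep_op \<pi> a v | a v. a \<in> T \<and> v \<in> DH} \<subseteq> carrier V" by (auto simp: \<pi>.alg)
    have Y: "{R.J a v | a v. a \<in> T \<and> v \<in> DH} \<subseteq> carrier R.I" using R.J_closed by auto
    from that X show ?thesis
    proof (induction rule: \<pi>.V.vspan_induct)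
      case (base x)
      then obtain a v where "x = rep_op \<pi> a v" "a \<in> T" "v \<in> DH" by blast
      then have "U x \<in> {R.J a v | a v. a \<in> T \<and> v \<in> DH}" using UJ by blast
      then show ?case by (rule subsetD[OF R.I.vspan_subset])
    next
      case zero
      show ?case unfolding U.zero by (rule R.I.vspan_zero[OF Y])
    next
      case (add x y)
      have "x \<in> carrier V" "y \<in> carrier V" using add \<pi>.V.vspan_carrier[OF X] by blast+
      then show ?case using R.I.vspan_add[OF Y add(3,4)] by (simp add: U.add)
    next
      case (smult c x)
      have "x \<in> carrier V" using smult \<pi>.V.vspan_carrier[OF X] by blast
      then show ?case using R.I.vspan_smult[OF Y smult(2)] by (simp add: U.smult)
    qed
  qed
  have UK: "U x \<in> R.K0" if "x \<in> K" for x
    using Uspan[of x UNIV] that by (simp add: vectors_def)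
  have U'K: "U' y \<in> K" if "y \<in> R.K0" for y
    using that R.tensors_closed
  proof (induction rule: R.I.vspan_induct)
    case (base y)
    then obtain a v where v: "y = R.J a v" "v \<in> DH" by auto
    have "rep_op \<pi> a v \<in> vectors" unfolding vectors_def using v(2) by blast
    moreover have "U' y = rep_op \<pi> a v"
      using UJ[OF v(2), of a] U'U[of "rep_op \<pi> a v"] v by (simp add: \<pi>.alg)
    ultimately show ?case using \<pi>.V.vspan_subset[of vectors] by auto
  next
    case zero
    show ?case unfolding U'.zero by (rule \<pi>.V.vspan_zero[OF vectors_closed])
  next
    case (add x y)
    then show ?case using \<pi>.V.vspan_add[OF vectors_closed add(3,4)] by (simp add: U'.add R.K0_closed)
  next
    case (smult c x)
    then show ?case using \<pi>.V.vspan_smult[OF vectors_closed smult(2)] by (simp add: U'.smult R.K0_closed)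
  qed
  have Uop: "U (rep_op \<pi> a x) = rep_op R.ind0 a (U x)" if "x \<in> K" for a x
    using that vectors_closed
  proof (induction rule: \<pi>.V.vspan_induct)
    case (base x)
    then obtain b v where v: "x = rep_op \<pi> b v" "v \<in> DH" unfolding vectors_def by blast
    have "rep_op \<pi> a x = rep_op \<pi> (a * b) v" unfolding v(1) by (rule \<pi>.rep_mult[symmetric]) (use v(2) in auto)
    then show ?case using UJ[OF v(2)] R.ind0_J[of v a b] v by simp
  next
    case zero
    show ?case unfolding U.zero using \<pi>.op_zero[of a] R.ind0.op_zero[of a] by (simp add: U.zero \<pi>.alg)
  next
    case (add x y)
    have D: "x \<in> D" "y \<in> D" using add K_D by auto
    have "U (rep_op \<pi> a (x \<oplus>\<^bsub>V\<^esub> y)) = U (rep_op \<pi> a x) \<oplus>\<^bsub>R.I\<^esub> U (rep_op \<pi> a y)"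
      using D by (simp add: \<pi>.op_add \<pi>.alg U.add)
    also have "\<dots> = rep_op R.ind0 a (U x \<oplus>\<^bsub>R.I\<^esub> U y)"
      using add UK R.ind0.op_add[of a "U x" "U y"] by simp
    finally show ?case using D by (simp add: U.add)
  next
    case (smult c x)
    have D: "x \<in> D" using smult K_D by auto
    have "U (rep_op \<pi> a (c \<odot>\<^bsub>V\<^esub> x)) = c \<odot>\<^bsub>R.I\<^esub> U (rep_op \<pi> a x)"
      using D by (simp add: \<pi>.op_smult \<pi>.alg U.smult)
    also have "\<dots> = rep_op R.ind0 a (c \<odot>\<^bsub>R.I\<^esub> U x)"
      using smult UK R.ind0.op_smult[of a "U x" c] by simp
    finally show ?case using D by (simp add: U.smult)
  qed
  have Ugn: "graph_norm R.ind0 a (U x \<ominus>\<^bsub>R.I\<^esub> U y) = graph_norm \<pi> a (x \<ominus>\<^bsub>V\<^esub> y)"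
    if xy: "x \<in> K" "y \<in> K" for a x y
  proof -
    have z: "x \<ominus>\<^bsub>V\<^esub> y \<in> K"
      using xy K_closed K_submodule unfolding \<pi>.V.submodule_iff by (simp add: \<pi>.V.minus_scalar)
    have "rep_op \<pi> a (x \<ominus>\<^bsub>V\<^esub> y) \<in> carrier V" using z K_D by (intro \<pi>.op_closed) (auto simp: \<pi>.alg)
    then show ?thesis
      unfolding graph_norm_def R.ind0_simps
      using xy K_closed z by (simp add: U.norm Uop[OF z, symmetric] flip: U.minus)
  qed
  have intertwine: "U x \<in> rep_dom R.IndH \<and> (\<forall>a. U (rep_op \<pi> a x) = rep_op R.IndH a (U x))"
    if x: "x \<in> D" for x
  proof -
    obtain F where F: "F \<noteq> bot" "eventually (\<lambda>y. y \<in> K) F" "graph_cauchy \<pi> F"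
        "limitin (graph_topology \<pi>) (\<lambda>y. y) x F"
      using \<pi>.filter_of_approx[OF K_D approx_K[OF x] x alg_nonempty] by metis
    \<comment> \<open>\<open>U\<close> respects graph norms on \<open>K\<close>, so \<open>\<pi>\<close> is first restricted to \<open>K\<close>.\<close>
    let ?\<sigma> = "\<pi>\<lparr>rep_dom := K\<rparr>"
    have gs: "graph_norm ?\<sigma> = graph_norm \<pi>" by (simp add: graph_norm_def fun_eq_iff)
    have "graph_cauchy ?\<sigma> F" using F(2,3) unfolding graph_cauchy_def gs by simp
    then have c: "graph_cauchy R.ind0 (filtermap U F)"
      by (rule graph_cauchy_filtermap) (use UK Ugn in \<open>simp_all add: R.ind0_simps gs \<pi>.alg\<close>)
    have l: "limitin (vtop V) (\<lambda>y. y) x F" by (rule \<pi>.limit_graph_imp_limit[OF alg_nonempty F(4)])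
    have lU: "limitin (vtop R.I) (\<lambda>y. y) (U x) (filtermap U F)"
      unfolding limitin_filtermap by (rule U.limit[OF l])
    have "rep_op R.IndH a (U x) = U (rep_op \<pi> a x)" for a
      unfolding Ind_def
    proof (rule R.ind0.rep_closure_op[OF c lU _ UNIV_I])
      have D: "eventually (\<lambda>y. y \<in> D) F" using F(2) by (rule eventually_mono) (use K_D in blast)
      have gn: "eventually (\<lambda>y. \<pi>.gn a (y \<ominus>\<^bsub>V\<^esub> x) < \<epsilon>) F" if "\<epsilon> > 0" for \<epsilon>
        using F(4) that unfolding \<pi>.limit_graph_iff[OF alg_nonempty] by (simp add: \<pi>.alg)
      have "limitin (vtop V) (rep_op \<pi> a) (rep_op \<pi> a x) F"
        unfolding \<pi>.V.M.limitin_metric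
      proof (intro conjI allI impI)
        show "rep_op \<pi> a x \<in> carrier V" using x by (simp add: \<pi>.alg)
        fix \<epsilon> :: real assume "\<epsilon> > 0"
        from gn[OF this] D show "eventually (\<lambda>y. rep_op \<pi> a y \<in> carrier V \<and>
            vdist V (rep_op \<pi> a y) (rep_op \<pi> a x) < \<epsilon>) F"
        proof eventually_elim
          case (elim y)
          have "vnorm V (rep_op \<pi> a y \<ominus>\<^bsub>V\<^esub> rep_op \<pi> a x) \<le> \<pi>.gn a (y \<ominus>\<^bsub>V\<^esub> x)"
            using elim(2) x by (simp add: \<pi>.gn_eq \<pi>.alg)
          with elim x show ?case by (simp add: \<pi>.alg)
        qed
      qed
      then have "limitin (vtop R.I) (\<lambda>y. U (rep_op \<pi> a y)) (U (rep_op \<pi> a x)) F" by (rule U.limit)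
      moreover have "eventually (\<lambda>y. U (rep_op \<pi> a y) = rep_op R.ind0 a (U y)) F"
        using F(2) by (rule eventually_mono) (rule Uop)
      ultimately show "limitin (vtop R.I) (rep_op R.ind0 a) (U (rep_op \<pi> a x)) (filtermap U F)"
        unfolding limitin_filtermap by (rule limitin_transform_eventually[rotated])
    qed
    moreover have "U x \<in> rep_dom R.IndH" unfolding R.Ind_simps using c lU by blast
    ultimately show ?thesis by simp
  qed
  have dom: "\<exists>x\<in>D. U x = y" if y: "y \<in> rep_dom R.IndH" for y
  proof -
    obtain F where F: "graph_cauchy R.ind0 F" "limitin (vtop R.I) (\<lambda>x. x) y F"
      using y unfolding R.Ind_simps by blast
    have "graph_cauchy \<pi>B (filtermap U' F)"
    proof (rule graph_cauchy_filtermap[OF F(1)])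
      show "U' x \<in> rep_dom \<pi>B" if "x \<in> rep_dom R.ind0" for x
        using U'K[of x] that K_D by (auto simp: R.ind0_simps)
      show "graph_norm \<pi>B a (U' x \<ominus>\<^bsub>rep_space \<pi>B\<^esub> U' z) \<le> graph_norm R.ind0 a (x \<ominus>\<^bsub>rep_space R.ind0\<^esub> z)"
        if "x \<in> rep_dom R.ind0" "z \<in> rep_dom R.ind0" for a x z
        using that Ugn[OF U'K U'K, of x z a] by (simp add: R.ind0_simps UU' R.K0_closed)
    qed (simp add: R.ind0_simps)
    then obtain x where x: "x \<in> D" "limitin (graph_topology \<pi>B) (\<lambda>x. x) x (filtermap U' F)"
      using integrable(1) unfolding closed_rep_def by auto
    have "limitin (vtop V) (\<lambda>x. x) x (filtermap U' F)"
      using \<pi>B.limit_graph_imp_limit[OF _ x(2)] B_nonempty by simp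
    then have "limitin (vtop V) U' x F" unfolding limitin_filtermap .
    moreover have "limitin (vtop V) U' (U' y) F" using U'.limit[OF F(2)] .
    moreover have "F \<noteq> bot" using F(1) by (simp add: graph_cauchy_def)
    ultimately have "x = U' y" by (rule \<pi>.V.limit_unique)
    then show ?thesis using x(1) UU' R.I.limit_carrier[OF F(2)] by blast
  qed
  have proj: "U (E t x) = ind_projection G \<A> H \<rho> t (U x)" if t: "t \<in> Cos" and x: "x \<in> carrier V" for t x
  proof -
    interpret Et: projection_on V "E t" by (rule projection_on_E[OF t])
    let ?X = "{rep_op \<pi> a v | a v. a \<in> graded_part \<A> t \<and> v \<in> DH}"
    let ?Y = "{R.J a v | a v. a \<in> graded_part \<A> t \<and> v \<in> DH}"
    have X: "?X \<subseteq> carrier V" by (auto simp: \<pi>.alg)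
    have Y: "?Y \<subseteq> carrier R.I" using R.J_closed by auto
    have Etx: "E t x \<in> carrier V" using x by simp
    obtain s where s: "\<And>n. s n \<in> vspan V ?X" "limitin (vtop V) s (E t x) sequentially"
      using \<pi>.V.closure_sequence[OF component_closure[OF t x] \<pi>.V.vspan_carrier[OF X]] by blast
    have mem: "U (E t x) \<in> vtop R.I closure_of vspan R.I ?Y"
      by (rule R.I.limit_in_closure[OF U.limit[OF s(2)]]) (use Uspan[OF s(1)] in auto)
    have orth: "ip R.I (U x \<ominus>\<^bsub>R.I\<^esub> U (E t x)) z = 0" if z: "z \<in> vtop R.I closure_of vspan R.I ?Y" for z
    proof (rule R.I.orthogonal_closure[OF Y _ _ z])
      show "U x \<ominus>\<^bsub>R.I\<^esub> U (E t x) \<in> carrier R.I" using x Etx by simp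
      fix y assume "y \<in> ?Y"
      then obtain a v where y: "y = U (rep_op \<pi> a v)" "a \<in> graded_part \<A> t" "v \<in> DH"
        using UJ by (smt (verit) mem_Collect_eq)
      have av: "rep_op \<pi> a v \<in> carrier V" using y(3) by (simp add: \<pi>.alg)
      have "ip R.I (U x \<ominus>\<^bsub>R.I\<^esub> U (E t x)) y = ip V x (rep_op \<pi> a v) - ip V (E t x) (rep_op \<pi> a v)"
        using x Etx av by (simp add: y(1) U.ip R.I.ip_diff_left)
      also have "ip V (E t x) (rep_op \<pi> a v) = ip V x (rep_op \<pi> a v)"
        using Et.Pr_sym[OF x av] part_range[OF t y(2,3)] by simp
      finally show "ip R.I (U x \<ominus>\<^bsub>R.I\<^esub> U (E t x)) y = 0" by simp
    qed
    have sub: "submodule (vtop R.I closure_of vspan R.I ?Y) complex_field R.I"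
      by (rule R.I.submodule_closure[OF R.I.submodule_vspan[OF Y]])
    show ?thesis
      unfolding ind_projection_def \<rho>_simps
      by (rule R.I.proj_onto_eqI[OF sub _ mem orth, symmetric]) (use x in simp)
  qed
  show ?thesis
    unfolding systems_unitarily_equivalent_def R.Ind_simps(1,2) \<pi>.alg
  proof (intro conjI exI[of _ U] ballI refl)
    show "unitary V R.I U" by (rule U)
    show "U ` D = rep_dom R.IndH" using intertwine dom by blast
  qed (use intertwine proj in blast)+
qed

end


section \<open>The operator of the unit\<close>

lemma space_char_borel: "space (char_borel G \<A>) = pos_chars G \<A>"
proof -
  have "topspace (char_topology G \<A>) \<subseteq> pos_chars G \<A>"
    unfolding char_topology_def topology_generated_by_topspace by blast
  then have "{U. openin (char_topology G \<A>) U} \<subseteq> Pow (pos_chars G \<A>)"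
    using openin_subset by blast
  then show ?thesis unfolding char_borel_def by (rule space_measure_of)
qed

context induction
begin

text \<open>Characters take the value \<open>1\<close> at the unit, so \<open>\<integral> \<omega>(1) dE(\<omega>)\<close> is the identity, with constant simple
  functions as approximants.\<close>

lemma spectral_integral_one:
  assumes E: "spectral_measure (char_borel G \<A>) \<rho>.V E" and x: "x \<in> carrier \<rho>.V"
  shows "(x, x) \<in> spectral_integral (char_borel G \<A>) \<rho>.V E (\<lambda>\<omega>. \<omega> 1)"
proof -
  let ?M = "char_borel G \<A>"
  let ?m = "scalar_measure ?M \<rho>.V E x"
  have one: "\<omega> 1 = 1" if "\<omega> \<in> space ?M" for \<omega>
  proof -
    have "character (\<A> \<one>\<^bsub>G\<^esub>) \<omega>" using that unfolding space_char_borel pos_chars_def by simp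
    then obtain b where b: "b \<in> \<A> \<one>\<^bsub>G\<^esub>" "\<omega> b \<noteq> 0" "\<omega> (1 * b) = \<omega> 1 * \<omega> b"
      using one_homogeneous unfolding character_def by blast
    then show ?thesis by simp
  qed
  have space: "space ?m = space ?M"
    unfolding scalar_measure_def by (rule space_measure_of[OF sets.space_closed])
  have fin: "emeasure ?m (space ?m) < \<infinity>"
    unfolding scalar_measure_def emeasure_measure_of_conv by simp
  have "(\<integral>\<^sup>+\<omega>. ennreal ((cmod (\<omega> 1))\<^sup>2) \<partial>?m) = (\<integral>\<^sup>+\<omega>. 1 \<partial>?m)"
    by (rule nn_integral_cong) (simp add: one space)
  also have "\<dots> < \<infinity>" using fin by simp
  finally have 1: "(\<integral>\<^sup>+\<omega>. ennreal ((cmod (\<omega> 1))\<^sup>2) \<partial>?m) < \<infinity>" .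
  have 2: "(\<integral>\<^sup>+\<omega>. ennreal ((cmod (\<omega> 1 - 1))\<^sup>2) \<partial>?m) = 0"
  proof -
    have "(\<integral>\<^sup>+\<omega>. ennreal ((cmod (\<omega> 1 - 1))\<^sup>2) \<partial>?m) = (\<integral>\<^sup>+\<omega>. 0 \<partial>?m)"
      by (rule nn_integral_cong) (simp add: one space)
    then show ?thesis by simp
  qed
  have Esp: "E (space ?M) x = x" using E x unfolding spectral_measure_def by blast
  have 3: "simple_spectral_integral ?M \<rho>.V E (\<lambda>_. 1) x = x"
  proof (cases "space ?M = {}")
    case False
    have "(\<lambda>_. 1::complex) ` space ?M = {1}" using False by auto
    then show ?thesis
      unfolding simple_spectral_integral_def using x Esp by (simp add: \<rho>.V.finsum_insert)
  next
    case True
    \<comment> \<open>Then \<open>E {} = I\<close>; countable additivity for a sequence of empty sets gives \<open>x = x + x\<close>.\<close>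
    have "limitin (vtop \<rho>.V) (\<lambda>n. \<Oplus>\<^bsub>\<rho>.V\<^esub>i\<in>{..<n}. E {} x) (E (\<Union>i::nat. {}) x) sequentially"
      using E x unfolding spectral_measure_def
      by (elim conjE) (drule spec[of _ "\<lambda>_::nat. {}"], auto simp: disjoint_family_on_def)
    then have l: "limitin (vtop \<rho>.V) (\<lambda>n. \<Oplus>\<^bsub>\<rho>.V\<^esub>i\<in>{..<n}. x) x sequentially"
      using True Esp by simp
    have "limitin (vtop \<rho>.V) (\<lambda>n. \<Oplus>\<^bsub>\<rho>.V\<^esub>i\<in>{..<Suc n}. x) x sequentially"
      using limitin_sequentially_offset[OF l, of 1] by simp
    moreover have "(\<Oplus>\<^bsub>\<rho>.V\<^esub>i\<in>{..<Suc n}. x) = x \<oplus>\<^bsub>\<rho>.V\<^esub> (\<Oplus>\<^bsub>\<rho>.V\<^esub>i\<in>{..<n}. x)" for n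
      unfolding lessThan_Suc using x by (intro \<rho>.V.finsum_insert) auto
    ultimately have "limitin (vtop \<rho>.V) (\<lambda>n. x \<oplus>\<^bsub>\<rho>.V\<^esub> (\<Oplus>\<^bsub>\<rho>.V\<^esub>i\<in>{..<n}. x)) x sequentially" by simp
    moreover have "limitin (vtop \<rho>.V) (\<lambda>n. x \<oplus>\<^bsub>\<rho>.V\<^esub> (\<Oplus>\<^bsub>\<rho>.V\<^esub>i\<in>{..<n}. x)) (x \<oplus>\<^bsub>\<rho>.V\<^esub> x) sequentially"
      by (rule \<rho>.V.limit_add[OF _ l]) (use x in simp)
    ultimately have "x = x \<oplus>\<^bsub>\<rho>.V\<^esub> x" by (rule \<rho>.V.limit_unique) simp
    then have "x = \<zero>\<^bsub>\<rho>.V\<^esub>" using x by (metis \<rho>.V.add.l_cancel_one')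
    then show ?thesis unfolding simple_spectral_integral_def using True by simp
  qed
  have "limitin (vtop \<rho>.V) (\<lambda>n::nat. simple_spectral_integral ?M \<rho>.V E (\<lambda>_. 1) x) x sequentially"
    using x by (simp add: 3)
  then show ?thesis
    unfolding spectral_integral_def using x 1 2
    by (auto intro!: exI[of _ "\<lambda>_ _. 1"] simp: simple_function_const)
qed

text \<open>A representation is not assumed to be unital, but the closure of \<open>\<rho>(1)\<close> contains the graph of the
  identity. Approximate \<open>(x, x)\<close> by points \<open>(u, \<rho>(1)u)\<close> and use that \<open>\<rho>(1)\<close> is symmetric.\<close>

lemma rep_one:
  assumes wb: "well_behaved G \<A> H \<rho>" and x: "x \<in> \<rho>.D"
  shows "rep_op \<rho> 1 x = x"
proof (rule \<rho>.eq_of_ip_D)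
  obtain E where E: "spectral_measure (char_borel G \<A>) \<rho>.V E"
      "op_closure \<rho>.V (rep_graph \<rho> 1) = spectral_integral (char_borel G \<A>) \<rho>.V E (\<lambda>\<omega>. \<omega> 1)"
    using wb one_homogeneous unfolding well_behaved_def well_behaved_with_def by blast
  have op [simp]: "rep_op \<rho> 1 y \<in> carrier \<rho>.V" if "y \<in> \<rho>.D" for y
    using that A_H_one by (simp add: \<rho>.alg)
  have T: "rep_graph \<rho> 1 \<subseteq> carrier \<rho>.V \<times> carrier \<rho>.V" unfolding rep_graph_def using op by auto
  have xV: "x \<in> carrier \<rho>.V" using x by simp
  have "(x, x) \<in> op_closure \<rho>.V (rep_graph \<rho> 1)"
    unfolding E(2) by (rule spectral_integral_one[OF E(1) xV])
  then have approx: "\<exists>u\<in>\<rho>.D. vnorm \<rho>.V (x \<ominus>\<^bsub>\<rho>.V\<^esub> u) < r \<and> vnorm \<rho>.V (x \<ominus>\<^bsub>\<rho>.V\<^esub> rep_op \<rho> 1 u) < r"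
    if "r > 0" for r
  proof -
    have "\<exists>(u, w)\<in>rep_graph \<rho> 1. vnorm \<rho>.V (x \<ominus>\<^bsub>\<rho>.V\<^esub> u) < r \<and> vnorm \<rho>.V (x \<ominus>\<^bsub>\<rho>.V\<^esub> w) < r"
      using that \<open>(x, x) \<in> op_closure \<rho>.V (rep_graph \<rho> 1)\<close> unfolding \<rho>.V.op_closure_iff[OF T] by blast
    then show ?thesis unfolding rep_graph_def by blast
  qed
  fix y assume y: "y \<in> \<rho>.D"
  have sym: "ip \<rho>.V (rep_op \<rho> 1 u) y = ip \<rho>.V u (rep_op \<rho> 1 y)" if "u \<in> \<rho>.D" for u
    using \<rho>.rep_star[OF A_H_one that y] by (simp add: star_one)
  have bound: "cmod (ip \<rho>.V x (rep_op \<rho> 1 y) - ip \<rho>.V x y) \<le> r * (vnorm \<rho>.V (rep_op \<rho> 1 y) + vnorm \<rho>.V y)"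
    if r: "r > 0" for r
  proof -
    obtain u where u: "u \<in> \<rho>.D" "vnorm \<rho>.V (x \<ominus>\<^bsub>\<rho>.V\<^esub> u) < r" "vnorm \<rho>.V (x \<ominus>\<^bsub>\<rho>.V\<^esub> rep_op \<rho> 1 u) < r"
      using approx[OF r] by blast
    have "ip \<rho>.V x (rep_op \<rho> 1 y) - ip \<rho>.V x y =
        ip \<rho>.V (x \<ominus>\<^bsub>\<rho>.V\<^esub> u) (rep_op \<rho> 1 y) - ip \<rho>.V (x \<ominus>\<^bsub>\<rho>.V\<^esub> rep_op \<rho> 1 u) y"
      using xV y u(1) sym[OF u(1)] by (simp add: \<rho>.V.ip_diff_left)
    also have "cmod \<dots> \<le> cmod (ip \<rho>.V (x \<ominus>\<^bsub>\<rho>.V\<^esub> u) (rep_op \<rho> 1 y)) +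
        cmod (ip \<rho>.V (x \<ominus>\<^bsub>\<rho>.V\<^esub> rep_op \<rho> 1 u) y)"
      by (rule norm_triangle_ineq4)
    also have "\<dots> \<le> vnorm \<rho>.V (x \<ominus>\<^bsub>\<rho>.V\<^esub> u) * vnorm \<rho>.V (rep_op \<rho> 1 y) +
        vnorm \<rho>.V (x \<ominus>\<^bsub>\<rho>.V\<^esub> rep_op \<rho> 1 u) * vnorm \<rho>.V y"
      using xV y u(1) by (intro add_mono \<rho>.V.Cauchy_Schwarz) auto
    also have "\<dots> \<le> r * vnorm \<rho>.V (rep_op \<rho> 1 y) + r * vnorm \<rho>.V y"
      using u y by (intro add_mono mult_right_mono) auto
    finally show ?thesis by (simp add: distrib_left)
  qed
  have "cmod (ip \<rho>.V x (rep_op \<rho> 1 y) - ip \<rho>.V x y) \<le> 0"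
  proof (rule field_le_epsilon)
    fix e :: real assume e: "e > 0"
    let ?c = "vnorm \<rho>.V (rep_op \<rho> 1 y) + vnorm \<rho>.V y"
    have c: "?c \<ge> 0" using y by (intro add_nonneg_nonneg) auto
    have "cmod (ip \<rho>.V x (rep_op \<rho> 1 y) - ip \<rho>.V x y) \<le> e / (?c + 1) * ?c"
      using e c by (intro bound) (simp add: add_nonneg_pos)
    also have "\<dots> \<le> e" using e c by (simp add: field_simps)
    finally show "cmod (ip \<rho>.V x (rep_op \<rho> 1 y) - ip \<rho>.V x y) \<le> 0 + e" by simp
  qed
  then show "ip \<rho>.V (rep_op \<rho> 1 x) y = ip \<rho>.V x y" using sym[OF x] by simp
qed (use x A_H_one in \<open>simp_all add: \<rho>.alg\<close>)

end

section \<open>Uniqueness and the imprimitivity theorem\<close>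

context imprimitivity
begin

text \<open>With \<open>P\<close> the projection of the induced system at \<open>H\<close>, the map \<open>j : v \<mapsto> [1 \<otimes> v]\<close> is an isometry of
  \<open>\<D>(\<rho>')\<close> onto the vectors of the induced domain that are fixed by \<open>P\<close>. The equivalence of systems
  carries these vectors to \<open>\<D>(\<rho>)\<close>. The resulting bijection of dense domains extends to a unitary
  map.\<close>

lemma unique:
  fixes \<rho>' :: "('a, 'k) rep"
  assumes star: "star_representation A_H \<rho>'" and ind: "inducible G \<A> H \<rho>'"
    and wb: "well_behaved G \<A> H \<rho>'"
    and equiv: "systems_unitarily_equivalent G H \<pi> E (Ind G \<A> H \<rho>') (ind_projection G \<A> H \<rho>')"
  shows "unitarily_equivalent \<rho>' \<rho>"
proof -
  interpret Q: induction G \<A> H \<rho>' by unfold_locales (rule star)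
  interpret Q: inducible_rep G \<A> H \<rho>' by unfold_locales (rule ind)
  define P where "P = ind_projection G \<A> H \<rho>' H"
  obtain W where W: "unitary V Q.I W" and WD: "W ` D = rep_dom Q.IndH"
      and Wop': "\<forall>a\<in>UNIV. \<forall>x\<in>D. W (rep_op \<pi> a x) = rep_op Q.IndH a (W x)"
      and WE': "\<forall>t\<in>Cos. \<forall>x\<in>carrier V. W (E t x) = ind_projection G \<A> H \<rho>' t (W x)"
    using equiv unfolding systems_unitarily_equivalent_def Q.Ind_simps(1,2) \<pi>.alg by blast
  have Wop: "W (rep_op \<pi> a x) = rep_op Q.IndH a (W x)" if "x \<in> D" for a x
    using Wop' that by blast
  have WE: "W (E H x) = P (W x)" if "x \<in> carrier V" for x
    using WE' H_Cos that unfolding P_def by blast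
  interpret W: unitary_map V Q.I W by unfold_locales (rule W)
  obtain W' where W': "unitary Q.I V W'" and W'W: "\<And>x. x \<in> carrier V \<Longrightarrow> W' (W x) = x"
    and WW': "\<And>y. y \<in> carrier Q.I \<Longrightarrow> W (W' y) = y"
    by (rule W.inverse) (rule that)
  interpret W': unitary_map Q.I V W' by unfold_locales (rule W')
  have P_eq: "P y = W (E H (W' y))" if "y \<in> carrier Q.I" for y
    using WE[of "W' y"] WW'[OF that] that by simp
  have P_closed: "P y \<in> carrier Q.I" if "y \<in> carrier Q.I" for y
    using that by (simp add: P_eq)
  have P_add: "P (x \<oplus>\<^bsub>Q.I\<^esub> y) = P x \<oplus>\<^bsub>Q.I\<^esub> P y" if "x \<in> carrier Q.I" "y \<in> carrier Q.I" for x y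
    using that by (simp add: P_eq W'.add EH.Pr_add W.add)
  have P_smult: "P (c \<odot>\<^bsub>Q.I\<^esub> x) = c \<odot>\<^bsub>Q.I\<^esub> P x" if "x \<in> carrier Q.I" for c x
    using that by (simp add: P_eq W'.smult EH.Pr_smult W.smult)
  have P_minus: "P (x \<ominus>\<^bsub>Q.I\<^esub> y) = P x \<ominus>\<^bsub>Q.I\<^esub> P y" if "x \<in> carrier Q.I" "y \<in> carrier Q.I" for x y
    using that by (simp add: Q.I.minus_scalar P_add P_smult P_closed)
  have P_norm: "vnorm Q.I (P x) \<le> vnorm Q.I x" if "x \<in> carrier Q.I" for x
    using EH.Pr_norm[of "W' x"] that by (simp add: P_eq W.norm W'.norm)
  have P_zero: "P \<zero>\<^bsub>Q.I\<^esub> = \<zero>\<^bsub>Q.I\<^esub>"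
    using P_smult[of "\<zero>\<^bsub>Q.I\<^esub>" 0] P_closed[of "\<zero>\<^bsub>Q.I\<^esub>"] by simp
  have P_limit: "limitin (vtop Q.I) (\<lambda>x. P (f x)) (P l) F" if f: "limitin (vtop Q.I) f l F" for f l and F :: "'z filter"
  proof -
    have l: "l \<in> carrier Q.I" "eventually (\<lambda>x. f x \<in> carrier Q.I) F"
      using f by (auto simp: Q.I.limit_iff)
    have "eventually (\<lambda>x. W (E H (W' (f x))) = P (f x)) F"
      using l(2) by (rule eventually_mono) (simp add: P_eq)
    from limitin_transform_eventually[OF this W.limit[OF EH.Pr_limit[OF W'.limit[OF f]]]] show ?thesis
      using l(1) by (simp add: P_eq)
  qed

  define j where "j v = Q.J 1 v" for v
  have j_closed: "j v \<in> carrier Q.I" if "v \<in> Q.\<rho>.D" for v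
    unfolding j_def using that by (rule Q.J_closed)
  have one: "rep_op \<rho>' 1 v = v" if "v \<in> Q.\<rho>.D" for v
    by (rule Q.rep_one[OF wb that])
  have j_ip: "ip Q.I (j v) (j w) = ip Q.\<rho>.V v w" if "v \<in> Q.\<rho>.D" "w \<in> Q.\<rho>.D" for v w
    unfolding j_def using that Q.J_ip[of v w 1 1] by (simp add: star_one p_fix A_H_one one)
  have pc: "p c \<in> rep_alg \<rho>'" for c using p_in by (simp add: Q.\<rho>.alg)
  have j_smult: "j (c \<odot>\<^bsub>Q.\<rho>.V\<^esub> v) = c \<odot>\<^bsub>Q.I\<^esub> j v" if v: "v \<in> Q.\<rho>.D" for c v
  proof (rule Q.I_eqI)
    fix d w assume w: "w \<in> Q.\<rho>.D"
    show "ip Q.I (j (c \<odot>\<^bsub>Q.\<rho>.V\<^esub> v)) (Q.J d w) = ip Q.I (c \<odot>\<^bsub>Q.I\<^esub> j v) (Q.J d w)"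
      using v w pc unfolding j_def
      by (simp add: Q.J_ip Q.I.ip_smult_left Q.J_closed Q.\<rho>.op_smult Q.\<rho>.V.ip_smult_left)
  qed (use v in \<open>simp_all add: j_closed\<close>)
  have j_add: "j (v \<oplus>\<^bsub>Q.\<rho>.V\<^esub> u) = j v \<oplus>\<^bsub>Q.I\<^esub> j u" if v: "v \<in> Q.\<rho>.D" "u \<in> Q.\<rho>.D" for v u
  proof (rule Q.I_eqI)
    fix d w assume w: "w \<in> Q.\<rho>.D"
    show "ip Q.I (j (v \<oplus>\<^bsub>Q.\<rho>.V\<^esub> u)) (Q.J d w) = ip Q.I (j v \<oplus>\<^bsub>Q.I\<^esub> j u) (Q.J d w)"
      using v w pc unfolding j_def
      by (simp add: Q.J_ip Q.I.ip_add_left Q.J_closed Q.\<rho>.op_add Q.\<rho>.V.ip_add_left)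
  qed (use v in \<open>simp_all add: j_closed\<close>)
  have j_norm: "vnorm Q.\<rho>.V (v \<ominus>\<^bsub>Q.\<rho>.V\<^esub> u) = vnorm Q.I (j v \<ominus>\<^bsub>Q.I\<^esub> j u)"
    if v: "v \<in> Q.\<rho>.D" "u \<in> Q.\<rho>.D" for v u
  proof -
    have "j (v \<ominus>\<^bsub>Q.\<rho>.V\<^esub> u) = j v \<ominus>\<^bsub>Q.I\<^esub> j u"
      using v by (simp add: Q.\<rho>.V.minus_scalar Q.I.minus_scalar j_add j_smult j_closed)
    then show ?thesis using j_ip[of "v \<ominus>\<^bsub>Q.\<rho>.V\<^esub> u" "v \<ominus>\<^bsub>Q.\<rho>.V\<^esub> u"] v by (simp add: vnorm_def)
  qed

  \<comment> \<open>On the algebraic tensors the projection is \<open>a \<otimes> u \<mapsto> 1 \<otimes> \<rho>'(p(a))u\<close>.\<close>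
  have P_J: "P (Q.J a u) = j (rep_op \<rho>' (p a) u)" if u: "u \<in> Q.\<rho>.D" for a u
  proof -
    let ?Y = "{Q.J a v | a v. a \<in> A_H \<and> v \<in> Q.\<rho>.D}"
    have Y: "?Y \<subseteq> carrier Q.I" using Q.J_closed by blast
    have sub: "submodule (vtop Q.I closure_of vspan Q.I ?Y) complex_field Q.I"
      by (rule Q.I.submodule_closure[OF Q.I.submodule_vspan[OF Y]])
    have pu: "rep_op \<rho>' (p a) u \<in> Q.\<rho>.D" by (rule Q.\<rho>.dom_invariant[OF p_in u])
    have "j (rep_op \<rho>' (p a) u) \<in> ?Y" unfolding j_def using pu A_H_one by blast
    then have mem: "j (rep_op \<rho>' (p a) u) \<in> vtop Q.I closure_of vspan Q.I ?Y"
      using Q.I.vspan_subset[of ?Y] closure_of_subset[of "vspan Q.I ?Y" "vtop Q.I"]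
        Q.I.vspan_carrier[OF Y] by auto
    have orth: "ip Q.I (Q.J a u \<ominus>\<^bsub>Q.I\<^esub> j (rep_op \<rho>' (p a) u)) z = 0"
      if z: "z \<in> vtop Q.I closure_of vspan Q.I ?Y" for z
    proof (rule Q.I.orthogonal_closure[OF Y _ _ z])
      show "Q.J a u \<ominus>\<^bsub>Q.I\<^esub> j (rep_op \<rho>' (p a) u) \<in> carrier Q.I"
        using u pu by (simp add: Q.J_closed j_closed)
      fix y assume "y \<in> ?Y"
      then obtain c w where y: "y = Q.J c w" "c \<in> A_H" "w \<in> Q.\<rho>.D" by blast
      have "p (c\<^sup>\<star> * a) = c\<^sup>\<star> * p a" "p (c\<^sup>\<star> * 1) = c\<^sup>\<star>"
        using p_mult_left[OF A_H_star[OF y(2)]] p_fix[OF A_H_star[OF y(2)]] by simp_all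
      moreover have "rep_op \<rho>' (c\<^sup>\<star> * p a) u = rep_op \<rho>' (c\<^sup>\<star>) (rep_op \<rho>' (p a) u)"
        by (rule Q.\<rho>.rep_mult[OF A_H_star[OF y(2)] p_in u])
      ultimately show "ip Q.I (Q.J a u \<ominus>\<^bsub>Q.I\<^esub> j (rep_op \<rho>' (p a) u)) y = 0"
        using u pu y(3) by (simp add: y(1) j_def Q.I.ip_diff_left Q.J_closed Q.J_ip)
    qed
    show ?thesis
      unfolding P_def ind_projection_def
      by (rule Q.I.proj_onto_eqI[OF sub _ mem orth]) (rule Q.J_closed[OF u])
  qed
  have P_j: "P (j v) = j v" if v: "v \<in> Q.\<rho>.D" for v
    using P_J[OF v, of 1] v by (simp add: j_def p_fix A_H_one one)

  have P_K0: "\<exists>v\<in>Q.\<rho>.D. P x = j v \<and> (\<forall>b\<in>A_H. P (rep_op Q.ind0 b x) = j (rep_op \<rho>' b v))"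
    if "x \<in> Q.K0" for x
    using that Q.tensors_closed
  proof (induction rule: Q.I.vspan_induct)
    case (base x)
    then obtain a u where x: "x = Q.J a u" "u \<in> Q.\<rho>.D" by blast
    show ?case
    proof (intro bexI conjI ballI)
      show "rep_op \<rho>' (p a) u \<in> Q.\<rho>.D" by (rule Q.\<rho>.dom_invariant[OF p_in x(2)])
      show "P x = j (rep_op \<rho>' (p a) u)" unfolding x(1) by (rule P_J[OF x(2)])
      fix b assume b: "b \<in> A_H"
      show "P (rep_op Q.ind0 b x) = j (rep_op \<rho>' b (rep_op \<rho>' (p a) u))"
        using x P_J[OF x(2), of "b * a"] Q.\<rho>.rep_mult[OF b p_in x(2), of a]
        by (simp add: Q.ind0_J p_mult_left[OF b])
    qed
  next
    case zero
    have z: "\<zero>\<^bsub>Q.\<rho>.V\<^esub> \<in> Q.\<rho>.D" by simp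
    have "j \<zero>\<^bsub>Q.\<rho>.V\<^esub> = \<zero>\<^bsub>Q.I\<^esub>" using j_smult[OF z, of 0] j_closed[OF z] by simp
    moreover have "rep_op Q.ind0 b \<zero>\<^bsub>Q.I\<^esub> = \<zero>\<^bsub>Q.I\<^esub>" for b by (rule Q.ind0.op_zero) simp
    moreover have "rep_op \<rho>' b \<zero>\<^bsub>Q.\<rho>.V\<^esub> = \<zero>\<^bsub>Q.\<rho>.V\<^esub>" if "b \<in> A_H" for b
      using that by (intro Q.\<rho>.op_zero) (simp add: Q.\<rho>.alg)
    ultimately show ?case using z P_zero by (intro bexI[OF _ z]) simp
  next
    case (add x y)
    then obtain v u where vu: "v \<in> Q.\<rho>.D" "P x = j v" "\<And>b. b \<in> A_H \<Longrightarrow> P (rep_op Q.ind0 b x) = j (rep_op \<rho>' b v)"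
        "u \<in> Q.\<rho>.D" "P y = j u" "\<And>b. b \<in> A_H \<Longrightarrow> P (rep_op Q.ind0 b y) = j (rep_op \<rho>' b u)" by blast
    have c: "x \<in> carrier Q.I" "y \<in> carrier Q.I" using add Q.K0_closed by auto
    show ?case
    proof (intro bexI conjI ballI)
      show "v \<oplus>\<^bsub>Q.\<rho>.V\<^esub> u \<in> Q.\<rho>.D" using vu by simp
      show "P (x \<oplus>\<^bsub>Q.I\<^esub> y) = j (v \<oplus>\<^bsub>Q.\<rho>.V\<^esub> u)" using vu c by (simp add: P_add j_add)
      fix b assume b: "b \<in> A_H"
      have "rep_op Q.ind0 b (x \<oplus>\<^bsub>Q.I\<^esub> y) = rep_op Q.ind0 b x \<oplus>\<^bsub>Q.I\<^esub> rep_op Q.ind0 b y"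
        by (rule Q.ind0.op_add) (use add in simp_all)
      moreover have "rep_op \<rho>' b (v \<oplus>\<^bsub>Q.\<rho>.V\<^esub> u) = rep_op \<rho>' b v \<oplus>\<^bsub>Q.\<rho>.V\<^esub> rep_op \<rho>' b u"
        using b vu by (intro Q.\<rho>.op_add) (simp_all add: Q.\<rho>.alg)
      moreover have "rep_op Q.ind0 b x \<in> carrier Q.I" "rep_op Q.ind0 b y \<in> carrier Q.I"
        using Q.left_mult(2) add Q.K0_closed by blast+
      ultimately show "P (rep_op Q.ind0 b (x \<oplus>\<^bsub>Q.I\<^esub> y)) = j (rep_op \<rho>' b (v \<oplus>\<^bsub>Q.\<rho>.V\<^esub> u))"
        using vu b Q.\<rho>.dom_invariant[OF b] by (simp add: P_add j_add)
    qed
  next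
    case (smult c x)
    then obtain v where v: "v \<in> Q.\<rho>.D" "P x = j v" "\<And>b. b \<in> A_H \<Longrightarrow> P (rep_op Q.ind0 b x) = j (rep_op \<rho>' b v)"
      by blast
    have x: "x \<in> carrier Q.I" using smult Q.K0_closed by auto
    show ?case
    proof (intro bexI conjI ballI)
      show "c \<odot>\<^bsub>Q.\<rho>.V\<^esub> v \<in> Q.\<rho>.D" using v by simp
      show "P (c \<odot>\<^bsub>Q.I\<^esub> x) = j (c \<odot>\<^bsub>Q.\<rho>.V\<^esub> v)" using v x by (simp add: P_smult j_smult)
      fix b assume b: "b \<in> A_H"
      have "rep_op Q.ind0 b (c \<odot>\<^bsub>Q.I\<^esub> x) = c \<odot>\<^bsub>Q.I\<^esub> rep_op Q.ind0 b x"
        by (rule Q.ind0.op_smult) (use smult in simp_all)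
      moreover have "rep_op \<rho>' b (c \<odot>\<^bsub>Q.\<rho>.V\<^esub> v) = c \<odot>\<^bsub>Q.\<rho>.V\<^esub> rep_op \<rho>' b v"
        using b v by (intro Q.\<rho>.op_smult) (simp_all add: Q.\<rho>.alg)
      moreover have "rep_op Q.ind0 b x \<in> carrier Q.I"
        using Q.left_mult(2) smult Q.K0_closed by blast
      ultimately show "P (rep_op Q.ind0 b (c \<odot>\<^bsub>Q.I\<^esub> x)) = j (rep_op \<rho>' b (c \<odot>\<^bsub>Q.\<rho>.V\<^esub> v))"
        using v b Q.\<rho>.dom_invariant[OF b] by (simp add: P_smult j_smult)
    qed
  qed

  \<comment> \<open>\<open>y v\<close> is the vector of \<open>\<D>(\<rho>)\<close> that corresponds to \<open>v\<close>.\<close>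
  define y where "y v = W' (j v)" for v
  have y_DH: "y v \<in> DH" if v: "v \<in> Q.\<rho>.D" for v
    unfolding DH_iff
  proof
    have "j v \<in> W ` D" unfolding WD j_def by (rule Q.Ind_J[OF v])
    then obtain x where x: "x \<in> D" "j v = W x" by blast
    then have yx: "y v = x" unfolding y_def using W'W \<pi>.D_closed by simp
    show "y v \<in> D" using yx x by simp
    have "W (E H x) = W x" using WE[of x] x P_j[OF v] by simp
    then show "E H (y v) = y v" using x(1) unfolding yx by (intro W.inj) simp_all
  qed

  let ?\<rho>B = "Res B \<rho>'"
  interpret QB: operator_family ?\<rho>B
    by (intro operator_family.intro operator_family_axioms.intro; (unfold Res_simps)?)
      (use Q.\<rho>.submodule_dom Q.\<rho>.linear[OF A_H_unit_part] Q.\<rho>.V.inner_space_axioms in auto)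
  have closed: "closed_rep ?\<rho>B"
    using wb unfolding well_behaved_def well_behaved_with_def integrable_rep_def by blast
  \<comment> \<open>A net of tensors that is Cauchy in the graph topology of \<open>\<A>\<close> is mapped by the projection to a
    Cauchy net of \<open>\<D>(\<rho>')\<close>, which converges there since the restriction of \<open>\<rho>'\<close> to \<open>\<A>\<^sub>e\<close> is
    closed.\<close>
  have y_onto: "\<exists>v\<in>Q.\<rho>.D. y v = x" if x: "x \<in> DH" for x
  proof -
    have xD: "x \<in> D" "E H x = x" using x DH_iff by auto
    then have "W x \<in> rep_dom Q.IndH" using WD by blast
    then obtain F where F: "graph_cauchy Q.ind0 F" "limitin (vtop Q.I) (\<lambda>x. x) (W x) F"
      unfolding Q.Ind_simps by blast
    \<comment> \<open>\<open>f\<close> is the projection \<open>P\<close> on tensors, read in \<open>\<D>(\<rho>')\<close> through the isometry \<open>j\<close>.\<close>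
    let ?spec = "\<lambda>x v. v \<in> Q.\<rho>.D \<and> P x = j v \<and> (\<forall>b\<in>A_H. P (rep_op Q.ind0 b x) = j (rep_op \<rho>' b v))"
    define f where "f x = (SOME v. ?spec x v)" for x
    have f: "?spec x (f x)" if "x \<in> Q.K0" for x
      unfolding f_def by (rule someI_ex) (use P_K0[OF that] in blast)
    have "graph_cauchy ?\<rho>B (filtermap f F)"
    proof (rule graph_cauchy_filtermap[OF F(1)])
      show "rep_alg ?\<rho>B \<subseteq> rep_alg Q.ind0" by (simp add: Q.ind0_simps)
      show "f x \<in> rep_dom ?\<rho>B" if "x \<in> rep_dom Q.ind0" for x
        using f[of x] that by (simp add: Q.ind0_simps)
      fix b x z assume b: "b \<in> rep_alg ?\<rho>B" and xz: "x \<in> rep_dom Q.ind0" "z \<in> rep_dom Q.ind0"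
      then have bH: "b \<in> A_H" and xK: "x \<in> Q.K0" and zK: "z \<in> Q.K0"
        using A_H_unit_part by (simp_all add: Q.ind0_simps)
      note fx = f[OF xK] and fz = f[OF zK]
      have bx: "rep_op Q.ind0 b x \<in> carrier Q.I" "rep_op Q.ind0 b z \<in> carrier Q.I"
        using Q.left_mult(2) xK zK Q.K0_closed by blast+
      have bf: "rep_op \<rho>' b (f x) \<in> Q.\<rho>.D" "rep_op \<rho>' b (f z) \<in> Q.\<rho>.D"
        using Q.\<rho>.dom_invariant[OF bH] fx fz by blast+
      have "vnorm Q.\<rho>.V (f x \<ominus>\<^bsub>Q.\<rho>.V\<^esub> f z) = vnorm Q.I (P (x \<ominus>\<^bsub>Q.I\<^esub> z))"
        using fx fz j_norm[of "f x" "f z"] P_minus[of x z] xK zK Q.K0_closed by simp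
      also have "\<dots> \<le> vnorm Q.I (x \<ominus>\<^bsub>Q.I\<^esub> z)"
        using xK zK Q.K0_closed by (intro P_norm) simp
      finally have 1: "vnorm Q.\<rho>.V (f x \<ominus>\<^bsub>Q.\<rho>.V\<^esub> f z) \<le> vnorm Q.I (x \<ominus>\<^bsub>Q.I\<^esub> z)" .
      have "vnorm Q.\<rho>.V (rep_op \<rho>' b (f x) \<ominus>\<^bsub>Q.\<rho>.V\<^esub> rep_op \<rho>' b (f z)) =
          vnorm Q.I (P (rep_op Q.ind0 b x \<ominus>\<^bsub>Q.I\<^esub> rep_op Q.ind0 b z))"
        using fx fz bH j_norm[OF bf] P_minus[OF bx] by simp
      also have "\<dots> \<le> vnorm Q.I (rep_op Q.ind0 b x \<ominus>\<^bsub>Q.I\<^esub> rep_op Q.ind0 b z)"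
        using bx by (intro P_norm) simp
      finally have 2: "vnorm Q.\<rho>.V (rep_op \<rho>' b (f x) \<ominus>\<^bsub>Q.\<rho>.V\<^esub> rep_op \<rho>' b (f z)) \<le>
          vnorm Q.I (rep_op Q.ind0 b x \<ominus>\<^bsub>Q.I\<^esub> rep_op Q.ind0 b z)" .
      have "graph_norm \<rho>' b (f x \<ominus>\<^bsub>Q.\<rho>.V\<^esub> f z) \<le> graph_norm Q.ind0 b (x \<ominus>\<^bsub>Q.I\<^esub> z)"
        using 1 2 fx fz bH Q.\<rho>.gn_eq[of b "f x" "f z"] Q.ind0.gn_eq[of b x z] xK zK
        by (simp add: Q.\<rho>.alg)
      then show "graph_norm ?\<rho>B b (f x \<ominus>\<^bsub>rep_space ?\<rho>B\<^esub> f z) \<le> graph_norm Q.ind0 b (x \<ominus>\<^bsub>rep_space Q.ind0\<^esub> z)"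
        by (simp add: Q.ind0_simps)
    qed
    then obtain v where v: "v \<in> Q.\<rho>.D" "limitin (graph_topology ?\<rho>B) (\<lambda>x. x) v (filtermap f F)"
      using closed unfolding closed_rep_def by auto
    have "limitin (vtop Q.\<rho>.V) (\<lambda>x. x) v (filtermap f F)"
      using QB.limit_graph_imp_limit[OF _ v(2)] B_nonempty by simp
    then have lf: "limitin (vtop Q.\<rho>.V) f v F" unfolding limitin_filtermap .
    have FK: "eventually (\<lambda>x. x \<in> Q.K0) F" and Fne: "F \<noteq> bot"
      using F(1) by (auto simp: graph_cauchy_def Q.ind0_simps)
    have "limitin (vtop Q.I) P (j v) F"
    proof (rule Q.I.limit_le)
      show "j v \<in> carrier Q.I" by (rule j_closed[OF v(1)])
      show "eventually (\<lambda>x. P x \<in> carrier Q.I) F"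
        using FK by (rule eventually_mono) (intro P_closed Q.K0_closed)
      show "eventually (\<lambda>x. vnorm Q.I (P x \<ominus>\<^bsub>Q.I\<^esub> j v) \<le> vnorm Q.\<rho>.V (f x \<ominus>\<^bsub>Q.\<rho>.V\<^esub> v)) F"
        using FK
      proof (rule eventually_mono)
        fix x assume "x \<in> Q.K0"
        from f[OF this] show "vnorm Q.I (P x \<ominus>\<^bsub>Q.I\<^esub> j v) \<le> vnorm Q.\<rho>.V (f x \<ominus>\<^bsub>Q.\<rho>.V\<^esub> v)"
          using j_norm[of "f x" v] v(1) by simp
      qed
      show "((\<lambda>x. vnorm Q.\<rho>.V (f x \<ominus>\<^bsub>Q.\<rho>.V\<^esub> v)) \<longlongrightarrow> 0) F"
        using lf by (simp add: Q.\<rho>.V.limit_iff)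
    qed
    moreover have "limitin (vtop Q.I) P (W x) F"
      using P_limit[OF F(2)] WE[of x] xD by simp
    ultimately have "j v = W x" using Fne by (rule Q.I.limit_unique)
    then have "y v = x" unfolding y_def using W'W xD by simp
    with v(1) show ?thesis by blast
  qed
  have yD: "y ` Q.\<rho>.D = DH"
  proof (rule equalityI)
    show "y ` Q.\<rho>.D \<subseteq> DH" by (rule image_subsetI) (rule y_DH)
    show "DH \<subseteq> y ` Q.\<rho>.D"
    proof
      fix x assume "x \<in> DH"
      from y_onto[OF this] obtain v where "v \<in> Q.\<rho>.D" "y v = x" by blast
      then show "x \<in> y ` Q.\<rho>.D" by (rule rev_image_eqI[OF _ sym])
    qed
  qed

  have "\<exists>U. unitary Q.\<rho>.V VS U \<and> (\<forall>v\<in>Q.\<rho>.D. U v = y v)"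
  proof (rule unitary_of_gram)
    show "hilbert Q.\<rho>.V" by (rule Q.\<rho>.hilbert)
    show "hilbert VS" by (rule EH.hilbert_VS)
    show "v \<in> carrier Q.\<rho>.V" if "v \<in> Q.\<rho>.D" for v using that by simp
    show "y v \<in> carrier VS" if "v \<in> Q.\<rho>.D" for v using y_DH[OF that] by simp
    show "ip Q.\<rho>.V v w = ip VS (y v) (y w)" if "v \<in> Q.\<rho>.D" "w \<in> Q.\<rho>.D" for v w
      unfolding y_def subspace_record_simps using that by (simp add: W'.ip j_closed j_ip)
    have "vspan Q.\<rho>.V Q.\<rho>.D = Q.\<rho>.D"
      by (rule subset_antisym[OF Q.\<rho>.V.vspan_minimal[OF Q.\<rho>.submodule_dom order_refl] Q.\<rho>.V.vspan_subset])
    then show "vtop Q.\<rho>.V closure_of vspan Q.\<rho>.V ((\<lambda>v. v) ` Q.\<rho>.D) = carrier Q.\<rho>.V"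
      using Q.\<rho>.dense_dom by simp
    have "vspan VS DH = DH"
      by (rule subset_antisym[OF EH.VS.vspan_minimal[OF R.\<rho>.submodule_dom[unfolded \<rho>_simps] order_refl]
            EH.VS.vspan_subset])
    then show "vtop VS closure_of vspan VS (y ` Q.\<rho>.D) = carrier VS"
      unfolding yD using R.\<rho>.dense_dom unfolding \<rho>_simps by simp
  qed
  then obtain U where U: "unitary Q.\<rho>.V VS U" and Uy: "\<forall>v\<in>Q.\<rho>.D. U v = y v" by blast
  have inter: "U (rep_op \<rho>' a v) = rep_op \<pi> a (U v)" if a: "a \<in> A_H" and v: "v \<in> Q.\<rho>.D" for a v
  proof -
    have av: "rep_op \<rho>' a v \<in> Q.\<rho>.D" by (rule Q.\<rho>.dom_invariant[OF a v])
    have yvD: "y v \<in> D" using y_DH[OF v] by blast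
    have jav: "j (rep_op \<rho>' a v) = Q.J a v"
      using Q.J_balanced[OF a v, of 1] by (simp add: j_def)
    have "W (rep_op \<pi> a (y v)) = rep_op Q.IndH a (j v)"
      using Wop[OF yvD] WW'[OF j_closed[OF v]] by (simp add: y_def)
    also have "\<dots> = Q.J a v" using Q.Ind_J(2)[OF v, of a 1] by (simp add: j_def)
    finally have "W' (Q.J a v) = rep_op \<pi> a (y v)"
      using W'W[of "rep_op \<pi> a (y v)"] yvD by (simp add: \<pi>.alg)
    then show ?thesis using Uy av v jav by (simp add: y_def)
  qed
  show ?thesis
    unfolding unitarily_equivalent_def \<rho>_simps Q.\<rho>.alg
  proof (intro conjI refl exI[of _ U] ballI)
    show "unitary Q.\<rho>.V VS U" by (rule U)
    show "U ` Q.\<rho>.D = DH" unfolding yD[symmetric] by (rule image_cong[OF refl bspec[OF Uy]])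
  qed (rule inter)
qed

end

theorem theorem3:
  fixes G :: "('g, 'm) monoid_scheme"
    and \<A> :: "'g \<Rightarrow> 'a::complex_star_algebra set"
    and H :: "'g set"
    and \<pi> :: "('a, 'h) rep"
    and E :: "'g set \<Rightarrow> 'h \<Rightarrow> 'h"
  assumes "graded_star_algebra G \<A>"
    and "\<forall>x\<in>\<A> \<one>\<^bsub>G\<^esub>. \<forall>y\<in>\<A> \<one>\<^bsub>G\<^esub>. x * y = y * x"
    and "countably_generated (\<A> \<one>\<^bsub>G\<^esub>)"
    and "\<forall>\<omega>\<in>pos_chars G \<A>. \<forall>g\<in>carrier G. \<forall>c\<in>\<A> g. \<forall>d\<in>\<A> g.
           \<omega> (c\<^sup>\<star> * d) * \<omega> (d\<^sup>\<star> * c) = \<omega> (c\<^sup>\<star> * c) * \<omega> (d\<^sup>\<star> * d)"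
    and "locally_compact_space (char_topology G \<A>)"
    and "subgroup H G"
    and "imprimitivity_system G \<A> H \<pi> E"
    and "nondegenerate_system G \<A> H \<pi> E"
    and "well_behaved_system G \<A> H \<pi> E"
  shows "\<exists>\<rho> :: ('a, 'h) rep.
    (star_representation (graded_part \<A> H) \<rho> \<and> inducible G \<A> H \<rho> \<and> well_behaved G \<A> H \<rho> \<and>
     systems_unitarily_equivalent G H \<pi> E (Ind G \<A> H \<rho>) (ind_projection G \<A> H \<rho>)) \<and>
    (\<forall>\<rho>' :: ('a, 'k) rep.
      star_representation (graded_part \<A> H) \<rho>' \<and> inducible G \<A> H \<rho>' \<and> well_behaved G \<A> H \<rho>' \<and>
      systems_unitarily_equivalent G H \<pi> E (Ind G \<A> H \<rho>') (ind_projection G \<A> H \<rho>') \<longrightarrow>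
      unitarily_equivalent \<rho>' \<rho>)"
proof -
  obtain E\<^sub>\<pi> where E: "well_behaved_with G \<A> (carrier G) \<pi> E\<^sub>\<pi>"
      "\<forall>t\<in>lcosets\<^bsub>G\<^esub> H. \<forall>\<Delta>\<in>sets (char_borel G \<A>). \<forall>x\<in>carrier (rep_space \<pi>).
        E t (E\<^sub>\<pi> \<Delta> x) = E\<^sub>\<pi> \<Delta> (E t x)"
    using assms(9) unfolding well_behaved_system_def by blast
  interpret imprimitivity G \<A> H \<pi> E E\<^sub>\<pi>
    by (intro imprimitivity.intro graded_subgroup.intro graded_algebra.intro
        graded_subgroup_axioms.intro imprimitivity_axioms.intro assms(1,6,7,8) E(1))
      (use E(2) in blast)
  have "well_behaved G \<A> H \<rho>"
    unfolding well_behaved_def using well_behaved_\<rho> by blast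
  then show ?thesis
    using star_representation_\<rho> inducible_\<rho> systems_equivalent unique
    by (intro exI[of _ \<rho>] conjI allI impI) blast+
qed

end
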